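(* Let $p$ be a prime, let $d\ge0$ be an integer, and let $G$ be a finitely generated pro-$p$-group such that $$P_{\mathrm{gr}(\mathbb{F}_p[[G]])}(t)=\frac{1}{1-dt}.$$ Then $G$ is a free pro-$p$-group of rank $d$.
   Context: Finitely generated means topologically finitely generated. $\mathbb{F}_p[[G]]=\varprojlim_N\mathbb{F}_p[G/N]$ ($N$ over open normal subgroups of $G$) is the completed group algebra, $I(G)$ is its augmentation ideal (kernel of $\mathbb{F}_p[[G]]\to\mathbb{F}_p$, $g\mapsto1$), $I^n(G)$ is the $n$-th power of $I(G)$ (with $I^0(G)=\mathbb{F}_p[[G]]$), $\mathrm{gr}(\mathbb{F}_p[[G]])=\bigoplus_{n\ge0}I^n(G)/I^{n+1}(G)$, and its Hilbert–Poincaré series is $P_{\mathrm{gr}(\mathbb{F}_p[[G]])}(t)=\sum_{n\ge0}\dim_{\mathbb{F}_p}(I^n(G)/I^{n+1}(G))\,t^n\in\mathbb{Z}[[t]]$. (The series $1/(1-dt)$ is the Hilbert–Poincaré series attached to a free pro-$p$-group of rank $d$.) *)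

theory Defs
  imports
    "HOL-Algebra.Algebra"
    "HOL-Number_Theory.Residues"
    "HOL-Analysis.Analysis"
    "HOL-Computational_Algebra.Formal_Power_Series"
begin

section \<open>Pro-p groups\<close>

definition topological_group :: "('a, 'b) monoid_scheme \<Rightarrow> 'a topology \<Rightarrow> bool"
  where "topological_group G T \<longleftrightarrow>
    group G \<and> topspace T = carrier G \<and>
    continuous_map (prod_topology T T) T (\<lambda>(x, y). x \<otimes>\<^bsub>G\<^esub> y) \<and>
    continuous_map T T (\<lambda>x. inv\<^bsub>G\<^esub> x)"

definition open_normal_subgroups :: "('a, 'b) monoid_scheme \<Rightarrow> 'a topology \<Rightarrow> 'a set set"
  where "open_normal_subgroups G T = {N. N \<lhd> G \<and> openin T N}"

definition profinite_group :: "('a, 'b) monoid_scheme \<Rightarrow> 'a topology \<Rightarrow> bool"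
  where "profinite_group G T \<longleftrightarrow>
    topological_group G T \<and> compact_space T \<and> Hausdorff_space T \<and>
    (\<forall>U. openin T U \<and> \<one>\<^bsub>G\<^esub> \<in> U \<longrightarrow> (\<exists>H. subgroup H G \<and> openin T H \<and> H \<subseteq> U))"

definition pro_p_group :: "nat \<Rightarrow> ('a, 'b) monoid_scheme \<Rightarrow> 'a topology \<Rightarrow> bool"
  where "pro_p_group p G T \<longleftrightarrow>
    profinite_group G T \<and>
    (\<forall>N \<in> open_normal_subgroups G T. \<exists>k. card (rcosets\<^bsub>G\<^esub> N) = p ^ k)"

definition topologically_finitely_generated ::
    "('a, 'b) monoid_scheme \<Rightarrow> 'a topology \<Rightarrow> bool"
  where "topologically_finitely_generated G T \<longleftrightarrow>
    (\<exists>S. finite S \<and> S \<subseteq> carrier G \<and> T closure_of (generate G S) = carrier G)"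

definition topologically_isomorphic ::
    "('a, 'b) monoid_scheme \<Rightarrow> 'a topology \<Rightarrow> ('c, 'd) monoid_scheme \<Rightarrow> 'c topology \<Rightarrow> bool"
  where "topologically_isomorphic G T H S \<longleftrightarrow> (\<exists>\<phi> \<in> iso G H. homeomorphic_map T S \<phi>)"


section \<open>Free pro-p groups\<close>

text \<open>The letter \<^term>\<open>(x, True)\<close> stands for the generator \<^term>\<open>x\<close> and
  \<^term>\<open>(x, False)\<close> for its formal inverse.\<close>

inductive cancels :: "'x set \<Rightarrow> ('x \<times> bool) list \<Rightarrow> ('x \<times> bool) list \<Rightarrow> bool"
  for S
  where "x \<in> S \<Longrightarrow> cancels S (u @ [(x, b), (x, \<not> b)] @ v) (u @ v)"

definition word_rel :: "'x set \<Rightarrow> (('x \<times> bool) list \<times> ('x \<times> bool) list) set"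
  where "word_rel S =
    {(u, v). u \<in> lists (S \<times> UNIV) \<and> v \<in> lists (S \<times> UNIV) \<and> equivclp (cancels S) u v}"

definition free_group :: "'x set \<Rightarrow> ('x \<times> bool) list set monoid"
  where "free_group S =
    \<lparr>carrier = lists (S \<times> UNIV) // word_rel S,
     monoid.mult = (\<lambda>A B. \<Union>u\<in>A. \<Union>v\<in>B. word_rel S `` {u @ v}),
     monoid.one = word_rel S `` {[]}\<rparr>"

text \<open>The inverse limit of the quotients of a group by a family of normal subgroups ordered
  by reverse inclusion. For \<^prop>\<open>N \<subseteq> M\<close> the transition map sends \<^term>\<open>N #>\<^bsub>G\<^esub> g\<close>
  to \<^term>\<open>(N #>\<^bsub>G\<^esub> g) <#>\<^bsub>G\<^esub> M\<close>, which is \<^term>\<open>M #>\<^bsub>G\<^esub> g\<close>.\<close>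

definition quotient_limit ::
    "('a, 'b) monoid_scheme \<Rightarrow> 'a set set \<Rightarrow> ('a set \<Rightarrow> 'a set) monoid"
  where "quotient_limit G \<N> =
    (product_group \<N> (\<lambda>N. G Mod N))
      \<lparr>carrier := {x \<in> carrier (product_group \<N> (\<lambda>N. G Mod N)).
          \<forall>N\<in>\<N>. \<forall>M\<in>\<N>. N \<subseteq> M \<longrightarrow> x N <#>\<^bsub>G\<^esub> M = x M}\<rparr>"

definition quotient_limit_topology ::
    "('a, 'b) monoid_scheme \<Rightarrow> 'a set set \<Rightarrow> ('a set \<Rightarrow> 'a set) topology"
  where "quotient_limit_topology G \<N> =
    subtopology (product_topology (\<lambda>N. discrete_topology (carrier (G Mod N))) \<N>)
      (carrier (quotient_limit G \<N>))"

text \<open>Subgroups of infinite index are excluded, as \<^const>\<open>card\<close> is 0 on infinite sets.\<close>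

definition p_power_index_normal_subgroups :: "nat \<Rightarrow> ('a, 'b) monoid_scheme \<Rightarrow> 'a set set"
  where "p_power_index_normal_subgroups p G =
    {N. N \<lhd> G \<and> (\<exists>k. card (rcosets\<^bsub>G\<^esub> N) = p ^ k)}"

text \<open>The free pro-p group of finite rank \<^term>\<open>d\<close> is the pro-p completion of the abstract free
  group on \<^term>\<open>d\<close> letters.\<close>

definition free_pro_p_group ::
    "nat \<Rightarrow> nat \<Rightarrow> ((nat \<times> bool) list set set \<Rightarrow> (nat \<times> bool) list set set) monoid"
  where "free_pro_p_group p d =
    quotient_limit (free_group {..<d}) (p_power_index_normal_subgroups p (free_group {..<d}))"

definition free_pro_p_topology ::
    "nat \<Rightarrow> nat \<Rightarrow> ((nat \<times> bool) list set set \<Rightarrow> (nat \<times> bool) list set set) topology"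
  where "free_pro_p_topology p d =
    quotient_limit_topology (free_group {..<d})
      (p_power_index_normal_subgroups p (free_group {..<d}))"

definition is_free_pro_p_of_rank ::
    "nat \<Rightarrow> nat \<Rightarrow> ('a, 'b) monoid_scheme \<Rightarrow> 'a topology \<Rightarrow> bool"
  where "is_free_pro_p_of_rank p d G T \<longleftrightarrow>
    topologically_isomorphic G T (free_pro_p_group p d) (free_pro_p_topology p d)"


section \<open>Completed group algebras\<close>

text \<open>Group algebras are only used for finite groups \<^term>\<open>Q\<close>: there is no finite support
  condition, and the convolution is a sum over the whole of \<^term>\<open>Q\<close>.\<close>

definition group_algebra ::
    "('r, 'c) ring_scheme \<Rightarrow> ('q, 'b) monoid_scheme \<Rightarrow> ('q \<Rightarrow> 'r) ring"
  where "group_algebra F Q =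
    \<lparr>carrier = carrier Q \<rightarrow>\<^sub>E carrier F,
     monoid.mult = (\<lambda>f h. \<lambda>x\<in>carrier Q.
       \<Oplus>\<^bsub>F\<^esub>y\<in>carrier Q. f y \<otimes>\<^bsub>F\<^esub> h (inv\<^bsub>Q\<^esub> y \<otimes>\<^bsub>Q\<^esub> x)),
     monoid.one = (\<lambda>x\<in>carrier Q. if x = \<one>\<^bsub>Q\<^esub> then \<one>\<^bsub>F\<^esub> else \<zero>\<^bsub>F\<^esub>),
     ring.zero = (\<lambda>x\<in>carrier Q. \<zero>\<^bsub>F\<^esub>),
     ring.add = (\<lambda>f h. \<lambda>x\<in>carrier Q. f x \<oplus>\<^bsub>F\<^esub> h x)\<rparr>"

text \<open>The linear extension to group algebras of a homomorphism \<^term>\<open>\<phi>\<close> from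
  \<^term>\<open>Q\<close> to \<^term>\<open>Q'\<close>.\<close>

definition group_algebra_map ::
    "('r, 'c) ring_scheme \<Rightarrow> ('q, 'b) monoid_scheme \<Rightarrow> ('s, 'd) monoid_scheme
      \<Rightarrow> ('q \<Rightarrow> 's) \<Rightarrow> ('q \<Rightarrow> 'r) \<Rightarrow> ('s \<Rightarrow> 'r)"
  where "group_algebra_map F Q Q' \<phi> f =
    (\<lambda>c\<in>carrier Q'. \<Oplus>\<^bsub>F\<^esub>x\<in>{x \<in> carrier Q. \<phi> x = c}. f x)"

abbreviation Fp :: "nat \<Rightarrow> int ring"
  where "Fp p \<equiv> residue_ring (int p)"

type_synonym 'a completed_element = "'a set \<Rightarrow> 'a set \<Rightarrow> int"

definition completed_group_algebra ::
    "nat \<Rightarrow> ('a, 'b) monoid_scheme \<Rightarrow> 'a topology \<Rightarrow> 'a completed_element ring"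
  where "completed_group_algebra p G T =
    \<lparr>carrier =
       {x \<in> (\<Pi>\<^sub>E N\<in>open_normal_subgroups G T. carrier (group_algebra (Fp p) (G Mod N))).
          \<forall>N\<in>open_normal_subgroups G T. \<forall>M\<in>open_normal_subgroups G T. N \<subseteq> M \<longrightarrow>
            group_algebra_map (Fp p) (G Mod N) (G Mod M) (\<lambda>C. C <#>\<^bsub>G\<^esub> M) (x N) = x M},
     monoid.mult = (\<lambda>x y. \<lambda>N\<in>open_normal_subgroups G T.
       x N \<otimes>\<^bsub>group_algebra (Fp p) (G Mod N)\<^esub> y N),
     monoid.one = (\<lambda>N\<in>open_normal_subgroups G T. \<one>\<^bsub>group_algebra (Fp p) (G Mod N)\<^esub>),
     ring.zero = (\<lambda>N\<in>open_normal_subgroups G T. \<zero>\<^bsub>group_algebra (Fp p) (G Mod N)\<^esub>),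
     ring.add = (\<lambda>x y. \<lambda>N\<in>open_normal_subgroups G T.
       x N \<oplus>\<^bsub>group_algebra (Fp p) (G Mod N)\<^esub> y N)\<rparr>"

definition completed_scalar ::
    "('a, 'b) monoid_scheme \<Rightarrow> 'a topology \<Rightarrow> int \<Rightarrow> 'a completed_element"
  where "completed_scalar G T c =
    (\<lambda>N\<in>open_normal_subgroups G T. \<lambda>C\<in>carrier (G Mod N). if C = \<one>\<^bsub>G Mod N\<^esub> then c else 0)"

text \<open>The sum of the coefficients of the component of \<^term>\<open>x\<close> at \<^term>\<open>N\<close> does not depend
  on the open normal subgroup \<^term>\<open>N\<close>; it is taken at \<^term>\<open>N = carrier G\<close>.\<close>

definition augmentation ::
    "nat \<Rightarrow> ('a, 'b) monoid_scheme \<Rightarrow> 'a completed_element \<Rightarrow> int"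
  where "augmentation p G x = (\<Oplus>\<^bsub>Fp p\<^esub>C\<in>carrier (G Mod carrier G). x (carrier G) C)"

definition augmentation_ideal ::
    "nat \<Rightarrow> ('a, 'b) monoid_scheme \<Rightarrow> 'a topology \<Rightarrow> 'a completed_element set"
  where "augmentation_ideal p G T =
    a_kernel (completed_group_algebra p G T) (Fp p) (augmentation p G)"

primrec ideal_power :: "('a, 'b) ring_scheme \<Rightarrow> 'a set \<Rightarrow> nat \<Rightarrow> 'a set"
  where
    "ideal_power R I 0 = carrier R"
  | "ideal_power R I (Suc n) = ideal_prod R (ideal_power R I n) I"


section \<open>The Hilbert--Poincare series of the associated graded algebra\<close>

text \<open>The graded piece $I^n / I^{n+1}$ is realised as the image of $I^n$ in the quotient ring by
  $I^{n+1}$. The image of the scalars in that ring is a subfield isomorphic to the field with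
  \<^term>\<open>p\<close> elements, and \<^const>\<open>ring.dim\<close> is the dimension over it. The value is only
  meaningful for finite dimension, which holds when the pro-p group is topologically finitely
  generated.\<close>

definition graded_dim :: "nat \<Rightarrow> ('a, 'b) monoid_scheme \<Rightarrow> 'a topology \<Rightarrow> nat \<Rightarrow> nat"
  where "graded_dim p G T n =
    (let R = completed_group_algebra p G T;
         I = ideal_power R (augmentation_ideal p G T)
     in ring.dim (R Quot I (Suc n))
          ((\<lambda>c. I (Suc n) +>\<^bsub>R\<^esub> completed_scalar G T c) ` carrier (Fp p))
          ((\<lambda>x. I (Suc n) +>\<^bsub>R\<^esub> x) ` I n))"

text \<open>Rational coefficients make the division of power series available.\<close>

definition hilbert_poincare_series ::
    "nat \<Rightarrow> ('a, 'b) monoid_scheme \<Rightarrow> 'a topology \<Rightarrow> rat fps"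
  where "hilbert_poincare_series p G T = Abs_fps (\<lambda>n. of_nat (graded_dim p G T n))"

end

theory Submission
  imports Defs
begin

text \<open>
  Write \<open>\<Lambda>\<close> for the completed group algebra of \<open>G\<close> and \<open>I\<close> for its augmentation ideal. The idea is
  that the hypothesis on the series leaves no room for relations. The piece \<open>I / I\<^sup>2\<close> has dimension
  \<open>d\<close>, so there are \<open>d\<close> elements \<open>x\<^sub>i\<close> of \<open>G\<close> such that the differences \<open>X\<^sub>i = x\<^sub>i - 1\<close> span \<open>I\<close> modulo
  \<open>I\<^sup>2\<close>. Their monomials of degree \<open>n\<close> then span the \<open>n\<close>-th graded piece, and there are \<open>d ^ n\<close> of them,
  which is its dimension; hence the monomials of degree below \<open>m\<close> are linearly independent modulo the
  \<open>m\<close>-th power of \<open>I\<close>.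

  Let \<open>F\<close> be the abstract free group on \<open>d\<close> letters and map it to \<open>G\<close> by sending the letters to the
  \<open>x\<^sub>i\<close>. The group \<open>G\<close> is the pro-p completion of \<open>F\<close> along this map once two things are known
  (\<open>topologically_isomorphic_quotient_limit\<close>): the image is dense, and every normal subgroup \<open>N\<close> of
  \<open>F\<close> of p-power index contains the preimage of an open normal subgroup of \<open>G\<close>.

  Both rest on the nilpotency of the augmentation ideal of \<open>F\<^sub>p[Q]\<close> for a finite p-group \<open>Q\<close>
  (\<open>aug_ideal_nilpotent\<close>). Density (\<open>free_hom_dense\<close>): in a finite quotient of \<open>G\<close> a power of \<open>I\<close>
  vanishes, so monomials in the \<open>X\<^sub>i\<close> span the whole group algebra, and the subgroup generated by the
  \<open>x\<^sub>i\<close> is everything. Cofinality (\<open>p_power_index_contains_preimage\<close>): a word \<open>w\<close> in the letters has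
  integral Magnus coefficients, obtained by expanding each letter as \<open>1 + X\<^sub>i\<close>. The same coefficients
  describe its value in \<open>\<Lambda>\<close> modulo the \<open>m\<close>-th power of \<open>I\<close> and its value in \<open>F\<^sub>p[F / N]\<close>, where the
  \<open>m\<close>-th power of the augmentation ideal is zero for suitable \<open>m\<close> (\<open>magnus_expansion\<close>). If the value
  of \<open>w\<close> in \<open>G\<close> is congruent to 1 modulo the \<open>m\<close>-th power of \<open>I\<close>, then by linear independence all
  coefficients of positive degree below \<open>m\<close> are divisible by \<open>p\<close>, and therefore \<open>w\<close> lies in \<open>N\<close>.

  It remains to see that the elements of \<open>G\<close> congruent to 1 modulo a power of \<open>I\<close> contain an open
  normal subgroup, and that the graded pieces are finite-dimensional. Finite generation and
  compactness give both: linear equations over \<open>\<Lambda>\<close> that are solvable in all \<open>F\<^sub>p[G / N]\<close> are solvable in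
  \<open>\<Lambda>\<close> (\<open>lift_left_comb\<close>), so \<open>I\<close> is generated as a left ideal by the differences \<open>s - 1\<close> for finitely many
  topological generators \<open>s\<close>, and every power of \<open>I\<close> is already determined in a single \<open>F\<^sub>p[G / N]\<close>
  (\<open>CI_power_open\<close>).
\<close>

section \<open>Integral combinations of words in a ring\<close>

abbreviation zmul :: "('r, 'm) ring_scheme \<Rightarrow> int \<Rightarrow> 'r \<Rightarrow> 'r"
  where "zmul R m a \<equiv> add_pow R m a"

text \<open>Coefficients are integers rather than elements of a ground field, so that one family of
  coefficients can be evaluated in several rings of characteristic \<open>p\<close>.\<close>

primrec word_sum ::
    "('r, 'm) ring_scheme \<Rightarrow> nat \<Rightarrow> (nat \<Rightarrow> 'r) \<Rightarrow> nat \<Rightarrow> (nat list \<Rightarrow> int) \<Rightarrow> 'r"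
  where
    "word_sum R k x 0 c = zmul R (c []) \<one>\<^bsub>R\<^esub>"
  | "word_sum R k x (Suc n) c =
       (\<Oplus>\<^bsub>R\<^esub>i\<in>{..<k}. x i \<otimes>\<^bsub>R\<^esub> word_sum R k x n (\<lambda>v. c (i # v)))"

primrec word_sum_below ::
    "('r, 'm) ring_scheme \<Rightarrow> nat \<Rightarrow> (nat \<Rightarrow> 'r) \<Rightarrow> nat \<Rightarrow> (nat list \<Rightarrow> int) \<Rightarrow> 'r"
  where
    "word_sum_below R k x 0 c = \<zero>\<^bsub>R\<^esub>"
  | "word_sum_below R k x (Suc n) c = word_sum_below R k x n c \<oplus>\<^bsub>R\<^esub> word_sum R k x n c"

text \<open>The coefficients of \<open>(1 + X\<^sub>i) f\<close>, where \<open>f\<close> is the formal series in non-commuting variables with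
  coefficients \<open>c\<close>.\<close>

definition cons_coeff :: "nat \<Rightarrow> (nat list \<Rightarrow> int) \<Rightarrow> nat list \<Rightarrow> int"
  where "cons_coeff i c v = c v + (case v of [] \<Rightarrow> 0 | j # u \<Rightarrow> if i = j then c u else 0)"

text \<open>The coefficients of \<open>f\<close> multiplied on the left by the inverse of \<open>1 + X\<^sub>i\<close>; the recursion
  solves \<open>(1 + X\<^sub>i) f' = f\<close> for \<open>f'\<close>.\<close>

primrec inv_cons_coeff :: "nat \<Rightarrow> (nat list \<Rightarrow> int) \<Rightarrow> nat list \<Rightarrow> int"
  where
    "inv_cons_coeff i c [] = c []"
  | "inv_cons_coeff i c (j # v) = c (j # v) - (if i = j then inv_cons_coeff i c v else 0)"

primrec magnus_coeff :: "(nat \<times> bool) list \<Rightarrow> nat list \<Rightarrow> int"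
  where
    "magnus_coeff [] = (\<lambda>v. if v = [] then 1 else 0)"
  | "magnus_coeff (l # w) =
       (if snd l then cons_coeff (fst l) (magnus_coeff w)
        else inv_cons_coeff (fst l) (magnus_coeff w))"

lemma cons_coeff_inv_cons_coeff: "cons_coeff i (inv_cons_coeff i c) = c"
proof
  fix v show "cons_coeff i (inv_cons_coeff i c) v = c v"
    by (cases v) (auto simp: cons_coeff_def)
qed

context ring
begin

lemma int_smult_closed [simp, intro]: "a \<in> carrier R \<Longrightarrow> zmul R m a \<in> carrier R"
  by (rule add.int_pow_closed)

lemma int_smult_add: "a \<in> carrier R \<Longrightarrow> zmul R (m + m') a = zmul R m a \<oplus> zmul R m' a"
  by (rule add.int_pow_mult)

lemma int_smult_zero: "zmul R 0 a = \<zero>"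
  by (rule int_pow_0[of "add_monoid R", folded add_pow_def, simplified])

lemma int_smult_one: "a \<in> carrier R \<Longrightarrow> zmul R 1 a = a"
  using add.int_pow_1 by auto

lemma int_smult_mult: "a \<in> carrier R \<Longrightarrow> zmul R (m * m') a = zmul R m (zmul R m' a)"
  by (simp add: add.int_pow_pow mult.commute)

lemma int_smult_eq_mult_one: "a \<in> carrier R \<Longrightarrow> zmul R m a = (zmul R m \<one>) \<otimes> a"
  by (simp add: add_pow_ldistr_int)

lemma int_smult_distrib:
  "a \<in> carrier R \<Longrightarrow> b \<in> carrier R \<Longrightarrow> zmul R m (a \<oplus> b) = zmul R m a \<oplus> zmul R m b"
  by (rule add.int_pow_distrib)

lemma int_smult_minus: "a \<in> carrier R \<Longrightarrow> zmul R (- m) a = \<ominus> (zmul R m a)"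
  using add.int_pow_neg[of a m] by (simp add: a_inv_def)

lemma int_smult_eq_zero_if_dvd:
  assumes "zmul R p \<one> = \<zero>" "p dvd m" "a \<in> carrier R"
  shows "zmul R m a = \<zero>"
proof -
  obtain q where "m = q * p" using assms(2) by (metis dvd_def mult.commute)
  moreover have "zmul R (q * p) \<one> = \<zero>"
    using assms(1) by (subst int_smult_mult) (auto simp: add.int_pow_one)
  ultimately show ?thesis using assms(3) int_smult_eq_mult_one[of a m] by simp
qed

lemma int_smult_mod:
  assumes "zmul R p \<one> = \<zero>" "a \<in> carrier R"
  shows "zmul R (m mod p) a = zmul R m a"
proof -
  have "zmul R m a = zmul R (m mod p + p * (m div p)) a" by simp
  also have "\<dots> = zmul R (m mod p) a \<oplus> zmul R (p * (m div p)) a"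
    by (rule int_smult_add[OF assms(2)])
  also have "zmul R (p * (m div p)) a = \<zero>"
    by (rule int_smult_eq_zero_if_dvd[OF assms(1) _ assms(2)]) simp
  finally show ?thesis using assms(2) by simp
qed

lemma add_diff_cancel:
  assumes "y \<in> carrier R" "w \<in> carrier R"
  shows "y = w \<oplus> (y \<ominus> w)"
proof -
  have "w \<oplus> (y \<ominus> w) = y \<oplus> (w \<oplus> \<ominus> w)"
    unfolding minus_eq by (rule a_lcomm) (use assms in auto)
  then show ?thesis using assms by (simp add: r_neg)
qed

lemma finsum_single:
  assumes "i \<in> A" "finite A" "a \<in> carrier R"
  shows "(\<Oplus>j\<in>A. if i = j then a else \<zero>) = a"
  using add.finprod_singleton[OF assms(1,2), of "\<lambda>_. a"] assms(3) by simp

lemma ideal_add: "ideal I R \<Longrightarrow> a \<in> I \<Longrightarrow> b \<in> I \<Longrightarrow> a \<oplus> b \<in> I"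
  by (meson additive_subgroup.a_closed ideal.axioms(1))

lemma ideal_zero: "ideal I R \<Longrightarrow> \<zero> \<in> I"
  by (meson additive_subgroup.zero_closed ideal.axioms(1))

lemma ideal_minus: "ideal I R \<Longrightarrow> a \<in> I \<Longrightarrow> \<ominus> a \<in> I"
  by (meson additive_subgroup.a_inv_closed ideal.axioms(1))

lemma ideal_diff: "ideal I R \<Longrightarrow> a \<in> I \<Longrightarrow> b \<in> I \<Longrightarrow> a \<ominus> b \<in> I"
  by (simp add: a_minus_def ideal_add ideal_minus)

lemma ideal_finsum:
  assumes "ideal I R" "finite A" "\<And>i. i \<in> A \<Longrightarrow> f i \<in> I"
  shows "(\<Oplus>i\<in>A. f i) \<in> I"
  using assms(2,3)
proof (induction A rule: finite_induct)
  case empty then show ?case using ideal_zero[OF assms(1)] by simp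
next
  case (insert a A)
  have car: "\<And>i. i \<in> insert a A \<Longrightarrow> f i \<in> carrier R"
    using insert.prems ideal.Icarr[OF assms(1)] by auto
  then show ?case using insert ideal_add[OF assms(1)] by (simp add: Pi_def)
qed

lemma ideal_add_cancel:
  assumes "ideal I R" "a \<in> carrier R" "b \<in> I" "a \<oplus> b \<in> I"
  shows "a \<in> I"
proof -
  have "b \<in> carrier R" by (rule ideal.Icarr[OF assms(1,3)])
  then have "a = (a \<oplus> b) \<ominus> b" using assms(2) by (simp add: a_minus_def a_assoc r_neg)
  then show ?thesis using ideal_diff[OF assms(1,4,3)] by simp
qed

end

locale ring_family = ring +
  fixes k :: nat and x :: "nat \<Rightarrow> 'a"
  assumes family_closed: "\<And>i. i < k \<Longrightarrow> x i \<in> carrier R"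
begin

abbreviation ws where "ws \<equiv> word_sum R k x"
abbreviation wsb where "wsb \<equiv> word_sum_below R k x"

lemma word_sum_closed [simp, intro]: "ws n c \<in> carrier R"
  by (induction n arbitrary: c) (auto intro!: finsum_closed simp: family_closed)

lemma word_sum_below_closed [simp, intro]: "wsb n c \<in> carrier R"
  by (induction n) auto

lemma word_sum_cong:
  "(\<And>v. length v = n \<Longrightarrow> set v \<subseteq> {..<k} \<Longrightarrow> c v = c' v) \<Longrightarrow> ws n c = ws n c'"
proof (induction n arbitrary: c c')
  case (Suc n)
  have "ws n (\<lambda>v. c (i # v)) = ws n (\<lambda>v. c' (i # v))" if "i < k" for i
    by (rule Suc.IH) (use Suc.prems that in auto)
  then show ?case by (auto intro!: finsum_cong' simp: family_closed)
qed simp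

lemma word_sum_below_cong:
  "(\<And>v. length v < n \<Longrightarrow> set v \<subseteq> {..<k} \<Longrightarrow> c v = c' v) \<Longrightarrow> wsb n c = wsb n c'"
proof (induction n)
  case (Suc n)
  have "wsb n c = wsb n c'" "ws n c = ws n c'"
    using Suc.prems by (auto intro!: Suc.IH word_sum_cong)
  then show ?case by simp
qed simp

lemma word_sum_add: "ws n (\<lambda>v. c v + c' v) = ws n c \<oplus> ws n c'"
proof (induction n arbitrary: c c')
  case 0 then show ?case by (simp add: int_smult_add)
next
  case (Suc n)
  have "ws (Suc n) (\<lambda>v. c v + c' v)
      = (\<Oplus>i\<in>{..<k}. x i \<otimes> ws n (\<lambda>v. c (i # v)) \<oplus> x i \<otimes> ws n (\<lambda>v. c' (i # v)))"
    unfolding word_sum.simps Suc.IH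
    by (rule finsum_cong') (auto simp: family_closed r_distr)
  also have "\<dots> = ws (Suc n) c \<oplus> ws (Suc n) c'"
    by (simp, rule finsum_addf) (auto simp: family_closed)
  finally show ?case .
qed

lemma word_sum_smult: "ws n (\<lambda>v. m * c v) = zmul R m (ws n c)"
proof (induction n arbitrary: c)
  case 0 then show ?case by (simp add: int_smult_mult)
next
  case (Suc n)
  have "ws (Suc n) (\<lambda>v. m * c v) = (\<Oplus>i\<in>{..<k}. (zmul R m \<one>) \<otimes> (x i \<otimes> ws n (\<lambda>v. c (i # v))))"
    using Suc.IH
    by (auto intro!: finsum_cong' simp: family_closed add_pow_rdistr_int add_pow_ldistr_int)
  also have "\<dots> = zmul R m (ws (Suc n) c)"
    by (subst finsum_rdistr[symmetric]) (auto simp: family_closed int_smult_eq_mult_one[symmetric])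
  finally show ?case .
qed

lemma word_sum_eq_zero_if_dvd:
  assumes "zmul R p \<one> = \<zero>" "\<And>v. length v = n \<Longrightarrow> set v \<subseteq> {..<k} \<Longrightarrow> p dvd c v"
  shows "ws n c = \<zero>"
proof -
  have "ws n c = ws n (\<lambda>v. p * (c v div p))" by (rule word_sum_cong) (use assms(2) in auto)
  also have "\<dots> = \<zero>"
    by (subst word_sum_smult, rule int_smult_eq_zero_if_dvd[OF assms(1)]) auto
  finally show ?thesis .
qed

lemma word_sum_below_eq_zero_if_dvd:
  assumes "zmul R p \<one> = \<zero>" "\<And>v. length v < n \<Longrightarrow> set v \<subseteq> {..<k} \<Longrightarrow> p dvd c v"
  shows "wsb n c = \<zero>"
  using assms(2)
proof (induction n)
  case (Suc n)
  have "ws n c = \<zero>" by (rule word_sum_eq_zero_if_dvd[OF assms(1)]) (use Suc.prems in auto)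
  then show ?case using Suc by auto
qed simp

lemma word_sum_below_add: "wsb n (\<lambda>v. c v + c' v) = wsb n c \<oplus> wsb n c'"
  by (induction n) (auto simp: word_sum_add a_ac)

lemma word_sum_below_unit: "wsb (Suc n) (\<lambda>v. if v = [] then m else 0) = zmul R m \<one>"
proof (induction n)
  case (Suc n)
  have "ws (Suc n) (\<lambda>v. if v = [] then m else 0) = ws (Suc n) (\<lambda>v. 0 * 0)"
    by (rule word_sum_cong) auto
  also have "\<dots> = \<zero>" unfolding word_sum_smult by (rule int_smult_zero)
  finally show ?case using Suc by simp
qed simp

text \<open>This identity and the next one keep words in step with products: prefixing a letter to the
  words corresponds to left multiplication, appending one to right multiplication.\<close>

lemma word_sum_cons_coeff:
  assumes "i < k"
  shows "ws (Suc n) (cons_coeff i c) = ws (Suc n) c \<oplus> x i \<otimes> ws n c"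
proof -
  have if_ws: "ws n (\<lambda>v. if i = j then c v else 0) = (if i = j then ws n c else \<zero>)" for j
    using word_sum_smult[of n 0 "\<lambda>_. 0"] by (simp add: int_smult_zero)
  have "ws (Suc n) (cons_coeff i c)
      = (\<Oplus>j\<in>{..<k}. x j \<otimes> ws n (\<lambda>v. c (j # v)) \<oplus> (if i = j then x i \<otimes> ws n c else \<zero>))"
    unfolding word_sum.simps cons_coeff_def list.case word_sum_add if_ws
    by (rule finsum_cong') (auto simp: family_closed assms r_distr)
  also have "\<dots> = ws (Suc n) c \<oplus> (\<Oplus>j\<in>{..<k}. if i = j then x i \<otimes> ws n c else \<zero>)"
    by (simp, rule finsum_addf) (auto simp: family_closed assms)
  also have "(\<Oplus>j\<in>{..<k}. if i = j then x i \<otimes> ws n c else \<zero>) = x i \<otimes> ws n c"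
    by (rule finsum_single) (auto simp: assms family_closed)
  finally show ?thesis .
qed

lemma word_sum_snoc_coeff:
  assumes "i < k"
  shows "ws n c \<otimes> x i = ws (Suc n) (\<lambda>v. if v \<noteq> [] \<and> last v = i then c (butlast v) else 0)"
proof (induction n arbitrary: c)
  case 0
  have "ws (Suc 0) (\<lambda>v. if v \<noteq> [] \<and> last v = i then c (butlast v) else 0)
      = (\<Oplus>j\<in>{..<k}. if i = j then ws 0 c \<otimes> x i else \<zero>)"
    by (auto intro!: finsum_cong' simp: family_closed assms int_smult_zero
        add_pow_rdistr_int add_pow_ldistr_int)
  also have "\<dots> = ws 0 c \<otimes> x i"
    by (rule finsum_single) (auto simp: assms family_closed)
  finally show ?case by simp
next
  case (Suc n)
  have "ws (Suc n) c \<otimes> x i = (\<Oplus>j\<in>{..<k}. x j \<otimes> ws n (\<lambda>v. c (j # v)) \<otimes> x i)"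
    by (simp, rule finsum_ldistr) (auto simp: family_closed assms)
  also have "\<dots> = (\<Oplus>j\<in>{..<k}. x j \<otimes> ws (Suc n)
      (\<lambda>v. if v \<noteq> [] \<and> last v = i then c (j # butlast v) else 0))"
    using Suc.IH
    by (auto intro!: finsum_cong' simp: family_closed assms m_assoc simp del: word_sum.simps)
  also have "\<dots> = (\<Oplus>j\<in>{..<k}. x j \<otimes> ws (Suc n)
      (\<lambda>v. if j # v \<noteq> [] \<and> last (j # v) = i then c (butlast (j # v)) else 0))"
  proof (rule finsum_cong')
    fix j assume "j \<in> {..<k}"
    have "ws (Suc n) (\<lambda>v. if v \<noteq> [] \<and> last v = i then c (j # butlast v) else 0)
      = ws (Suc n) (\<lambda>v. if j # v \<noteq> [] \<and> last (j # v) = i then c (butlast (j # v)) else 0)"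
      by (rule word_sum_cong) auto
    then show "x j \<otimes> ws (Suc n) (\<lambda>v. if v \<noteq> [] \<and> last v = i then c (j # butlast v) else 0)
      = x j \<otimes> ws (Suc n) (\<lambda>v. if j # v \<noteq> [] \<and> last (j # v) = i then c (butlast (j # v)) else 0)"
      by simp
  qed (auto simp: family_closed simp del: word_sum.simps)
  finally show ?case by (subst word_sum.simps(2)) simp
qed

lemma word_sum_below_cons_coeff:
  assumes "i < k"
  shows "wsb (Suc n) (cons_coeff i c) = wsb (Suc n) c \<oplus> x i \<otimes> wsb n c"
proof (induction n)
  case 0 then show ?case using assms by (simp add: cons_coeff_def family_closed)
next
  case (Suc n)
  have "wsb (Suc (Suc n)) (cons_coeff i c)
      = (wsb (Suc n) c \<oplus> x i \<otimes> wsb n c) \<oplus> (ws (Suc n) c \<oplus> x i \<otimes> ws n c)"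
    using Suc word_sum_cons_coeff[OF assms, of n c] by simp
  also have "\<dots> = wsb (Suc (Suc n)) c \<oplus> x i \<otimes> wsb (Suc n) c"
    using family_closed[OF assms]
    by (simp add: r_distr a_ac del: word_sum.simps)
  finally show ?case .
qed

lemma finite_word_sums:
  assumes "zmul R p \<one> = \<zero>" "p > 0"
  shows "finite (range (ws n))"
proof (induction n)
  case 0
  have "range (ws 0) \<subseteq> (\<lambda>m. zmul R m \<one>) ` {0..<p}"
  proof
    fix y assume "y \<in> range (ws 0)"
    then obtain c where "y = zmul R (c []) \<one>" by auto
    then have "y = zmul R (c [] mod p) \<one>" using int_smult_mod[OF assms(1)] by simp
    then show "y \<in> (\<lambda>m. zmul R m \<one>) ` {0..<p}" using assms(2) by auto
  qed
  then show ?case by (rule finite_subset) auto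
next
  case (Suc n)
  have "range (ws (Suc n)) \<subseteq> (\<lambda>f. \<Oplus>i\<in>{..<k}. x i \<otimes> f i) ` (\<Pi>\<^sub>E i\<in>{..<k}. range (ws n))"
  proof
    fix y assume "y \<in> range (ws (Suc n))"
    then obtain c where y: "y = ws (Suc n) c" by auto
    let ?f = "\<lambda>i\<in>{..<k}. ws n (\<lambda>v. c (i # v))"
    have "y = (\<Oplus>i\<in>{..<k}. x i \<otimes> ?f i)"
      unfolding y by (auto intro!: finsum_cong' simp: family_closed)
    moreover have "?f \<in> (\<Pi>\<^sub>E i\<in>{..<k}. range (ws n))" by auto
    ultimately show "y \<in> (\<lambda>f. \<Oplus>i\<in>{..<k}. x i \<otimes> f i) ` (\<Pi>\<^sub>E i\<in>{..<k}. range (ws n))" by blast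
  qed
  then show ?case by (rule finite_subset) (auto intro!: finite_PiE simp: Suc)
qed

lemma finite_word_sums_below:
  assumes "zmul R p \<one> = \<zero>" "p > 0"
  shows "finite (range (wsb n))"
proof (induction n)
  case (Suc n)
  have "range (wsb (Suc n)) \<subseteq> (\<lambda>(a, b). a \<oplus> b) ` (range (wsb n) \<times> range (ws n))" by auto
  then show ?case by (rule finite_subset) (auto simp: Suc finite_word_sums[OF assms])
qed simp

end

lemma (in ring_hom_ring) hom_int_smult:
  "a \<in> carrier R \<Longrightarrow> h (zmul R m a) = zmul S m (h a)"
  unfolding add_pow_def
  by (rule group_hom.hom_int_pow[OF a_group_hom, simplified])

lemma (in ring_hom_ring) hom_finsum':
  "(\<And>i. i \<in> A \<Longrightarrow> f i \<in> carrier R) \<Longrightarrow> h (\<Oplus>\<^bsub>R\<^esub>i\<in>A. f i) = (\<Oplus>\<^bsub>S\<^esub>i\<in>A. h (f i))"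
  using hom_finsum[of f A] by (simp add: Pi_def o_def)

lemma (in ring_hom_ring) hom_word_sum:
  assumes "\<And>i. i < k \<Longrightarrow> x i \<in> carrier R"
  shows "h (word_sum R k x n c) = word_sum S k (\<lambda>i. h (x i)) n c"
proof -
  interpret ring_family R k x by unfold_locales (rule assms)
  show ?thesis
  proof (induction n arbitrary: c)
    case 0 then show ?case by (simp add: hom_int_smult)
  next
    case (Suc n)
    have "h (ws (Suc n) c) = (\<Oplus>\<^bsub>S\<^esub>i\<in>{..<k}. h (x i \<otimes>\<^bsub>R\<^esub> ws n (\<lambda>v. c (i # v))))"
      by (simp, rule hom_finsum') (auto simp: assms)
    also have "\<dots> = word_sum S k (\<lambda>i. h (x i)) (Suc n) c"
    proof (simp, rule S.finsum_cong')
      have closed: "word_sum S k (\<lambda>i. h (x i)) n c' \<in> carrier S" for c'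
        using Suc.IH[of c', symmetric] by simp
      then show "(\<lambda>i. h (x i) \<otimes>\<^bsub>S\<^esub> word_sum S k (\<lambda>i. h (x i)) n (\<lambda>v. c (i # v)))
          \<in> {..<k} \<rightarrow> carrier S"
        by (auto simp: assms)
    qed (auto simp: Suc.IH assms)
    finally show ?case .
  qed
qed

lemma (in ring_hom_ring) hom_word_sum_below:
  assumes "\<And>i. i < k \<Longrightarrow> x i \<in> carrier R"
  shows "h (word_sum_below R k x n c) = word_sum_below S k (\<lambda>i. h (x i)) n c"
proof -
  interpret ring_family R k x by unfold_locales (rule assms)
  show ?thesis by (induction n) (auto simp: hom_word_sum[OF assms])
qed

section \<open>Powers of an ideal\<close>

context ring
begin

lemma ideal_power_ideal: "ideal I R \<Longrightarrow> ideal (ideal_power R I n) R"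
  by (induction n) (auto intro: ideal_prod_is_ideal oneideal)

lemma ideal_power_closed: "ideal I R \<Longrightarrow> a \<in> ideal_power R I n \<Longrightarrow> a \<in> carrier R"
  using ideal.Icarr[OF ideal_power_ideal] by auto

lemma ideal_power_Suc_subset: "ideal I R \<Longrightarrow> ideal_power R I (Suc n) \<subseteq> ideal_power R I n"
  using ideal_prod_inter[OF ideal_power_ideal[of I n]] by auto

lemma ideal_power_antimono:
  assumes "ideal I R" "m \<le> n"
  shows "ideal_power R I n \<subseteq> ideal_power R I m"
  using assms(2) by (induction rule: dec_induct) (use ideal_power_Suc_subset[OF assms(1)] in blast)+

lemma ideal_power_one: "ideal I R \<Longrightarrow> ideal_power R I (Suc 0) = I"
proof
  assume I: "ideal I R"
  show "ideal_power R I (Suc 0) \<subseteq> I"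
    using ideal_prod_inter[OF oneideal I] by auto
  show "I \<subseteq> ideal_power R I (Suc 0)"
  proof
    fix i assume "i \<in> I"
    then have "\<one> \<otimes> i \<in> carrier R \<cdot> I" by (intro ideal_prod.prod) auto
    then show "i \<in> ideal_power R I (Suc 0)" using ideal.Icarr[OF I \<open>i \<in> I\<close>] by simp
  qed
qed

lemma ideal_power_mult:
  assumes "ideal I R" "a \<in> ideal_power R I m" "b \<in> ideal_power R I n"
  shows "a \<otimes> b \<in> ideal_power R I (m + n)"
  using assms(2,3)
proof (induction n arbitrary: b)
  case 0
  then show ?case using ideal.I_r_closed[OF ideal_power_ideal[OF assms(1)]] by auto
next
  case (Suc n)
  have car: "a \<in> carrier R" using ideal_power_closed[OF assms(1) Suc.prems(1)] .
  note closed = ideal_power_closed[OF assms(1), of _ n]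
  have "b \<in> ideal_power R I n \<cdot> I" using Suc.prems(2) by simp
  then have "b \<in> carrier R \<and> a \<otimes> b \<in> ideal_power R I (m + n) \<cdot> I"
  proof (induction b rule: ideal_prod.induct)
    case (prod i j)
    have "i \<in> carrier R" "j \<in> carrier R"
      using prod ideal_power_closed[OF assms(1)] ideal.Icarr[OF assms(1)] by auto
    moreover have "(a \<otimes> i) \<otimes> j \<in> ideal_power R I (m + n) \<cdot> I"
      by (intro ideal_prod.prod Suc.IH Suc.prems(1) prod)
    ultimately show ?case using car by (simp add: m_assoc)
  next
    case (sum s1 s2)
    then show ?case using car ideal_prod.sum[of "a \<otimes> s1" R _ I "a \<otimes> s2"] by (simp add: r_distr)
  qed
  then show ?case by simp
qed

end

lemma (in ring_hom_ring) hom_ideal_power: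
  assumes "ideal I R" "h ` I \<subseteq> J" "a \<in> ideal_power R I n"
  shows "h a \<in> ideal_power S J n"
  using assms(3)
proof (induction n arbitrary: a)
  case (Suc n)
  have "a \<in> ideal_power R I n \<cdot>\<^bsub>R\<^esub> I" using Suc.prems by simp
  then have "a \<in> carrier R \<and> h a \<in> ideal_power S J n \<cdot>\<^bsub>S\<^esub> J"
  proof (induction a rule: ideal_prod.induct)
    case (prod i j)
    have "i \<in> carrier R" "j \<in> carrier R"
      using prod R.ideal_power_closed[OF assms(1)] ideal.Icarr[OF assms(1)] by auto
    then show ?case
      using prod assms(2) ideal_prod.prod[of "h i" "ideal_power S J n" "h j" J S] Suc.IH by auto
  next
    case (sum s1 s2)
    then show ?case by (auto intro: ideal_prod.sum)
  qed
  then show ?case by simp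
qed auto

context ring_family
begin

lemma word_sum_in_ideal_power:
  assumes "ideal I R" "\<And>i. i < k \<Longrightarrow> x i \<in> I"
  shows "ws n c \<in> ideal_power R I n"
proof (induction n arbitrary: c)
  case (Suc n)
  have "x i \<otimes> ws n (\<lambda>v. c (i # v)) \<in> ideal_power R I (Suc n)" if "i < k" for i
    using ideal_power_mult[OF assms(1), of "x i" "Suc 0" "ws n (\<lambda>v. c (i # v))" n]
      Suc assms(2)[OF that] by (simp add: ideal_power_one[OF assms(1), simplified])
  then show ?case
    using ideal_finsum[OF ideal_power_ideal[OF assms(1), of "Suc n"], of "{..<k}"]
    by simp
qed auto

lemma range_word_sum_finsum:
  assumes "finite A" "\<And>i. i \<in> A \<Longrightarrow> f i \<in> range (ws n)"
  shows "(\<Oplus>i\<in>A. f i) \<in> range (ws n)"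
  using assms
proof (induction A rule: finite_induct)
  case empty
  have "\<zero> = ws n (\<lambda>_. 0)" using word_sum_smult[of n 0 "\<lambda>_. 0"] by (simp add: int_smult_zero)
  then show ?case by simp
next
  case (insert a A)
  obtain c c' where c: "f a = ws n c" "(\<Oplus>i\<in>A. f i) = ws n c'" using insert by force
  have "f \<in> A \<rightarrow> carrier R" "f a \<in> carrier R" using insert.prems by force+
  then have "(\<Oplus>i\<in>insert a A. f i) = ws n (\<lambda>v. c v + c' v)"
    using insert.hyps c by (simp add: word_sum_add)
  then show ?case by simp
qed

lemma word_sum_mult_linear: "ws n c \<otimes> ws (Suc 0) e \<in> range (ws (Suc n))"
proof -
  have "ws n c \<otimes> ws (Suc 0) e = (\<Oplus>i\<in>{..<k}. ws n c \<otimes> (x i \<otimes> zmul R (e [i]) \<one>))"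
    by (simp, rule finsum_rdistr) (auto simp: family_closed)
  also have "\<dots> = (\<Oplus>i\<in>{..<k}. zmul R (e [i]) (ws n c \<otimes> x i))"
    by (rule finsum_cong') (auto simp: family_closed add_pow_rdistr_int)
  also have "\<dots> \<in> range (ws (Suc n))"
    using word_sum_snoc_coeff
    by (intro range_word_sum_finsum) (auto simp: word_sum_smult[symmetric] simp del: word_sum.simps)
  finally show ?thesis .
qed

text \<open>The graded ring of \<open>I\<close> is generated in degree one: multiplying the expansions of elements of the
  \<open>n\<close>-th power and of \<open>I\<close> gives words of length \<open>n + 1\<close> and an error in the power \<open>n + 2\<close>.\<close>

lemma ideal_power_expansion:
  assumes I: "ideal I R" and x: "\<And>i. i < k \<Longrightarrow> x i \<in> I"
    and unit: "\<And>y. y \<in> carrier R \<Longrightarrow> \<exists>m. \<exists>r\<in>I. y = zmul R m \<one> \<oplus> r"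
    and gen: "\<And>y. y \<in> I \<Longrightarrow> \<exists>c. \<exists>r\<in>ideal_power R I 2. y = ws (Suc 0) c \<oplus> r"
    and y: "y \<in> ideal_power R I n"
  shows "\<exists>c. \<exists>r\<in>ideal_power R I (Suc n). y = ws n c \<oplus> r"
  using y
proof (induction n arbitrary: y)
  case 0
  then obtain m r where "r \<in> I" "y = zmul R m \<one> \<oplus> r" using unit[of y] by auto
  then show ?case
    by (intro exI[of _ "\<lambda>_. m"] bexI[of _ r]) (auto simp: ideal_power_one[OF I, simplified])
next
  case (Suc n)
  note closed = ideal_power_closed[OF I]
  have "y \<in> ideal_power R I n \<cdot> I" using Suc.prems by simp
  then show ?case
  proof (induction y rule: ideal_prod.induct)
    case (prod i j)
    obtain c r where i: "r \<in> ideal_power R I (Suc n)" "i = ws n c \<oplus> r"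
      using Suc.IH[OF prod(1)] by blast
    obtain e s where j: "s \<in> ideal_power R I 2" "j = ws (Suc 0) e \<oplus> s"
      using gen[OF prod(2)] by blast
    obtain c' where c': "ws n c \<otimes> ws (Suc 0) e = ws (Suc n) c'"
      using word_sum_mult_linear[of n c e] by blast
    have "ws n c \<otimes> s \<in> ideal_power R I (n + 2)"
      by (rule ideal_power_mult[OF I word_sum_in_ideal_power[OF I x] j(1)])
    moreover have "r \<otimes> j \<in> ideal_power R I (Suc n + 1)"
      by (rule ideal_power_mult[OF I i(1)]) (use prod(2) ideal_power_one[OF I] in simp)
    ultimately have r': "ws n c \<otimes> s \<oplus> r \<otimes> j \<in> ideal_power R I (Suc (Suc n))"
      by (intro ideal_add ideal_power_ideal I) auto
    have car: "r \<in> carrier R" "s \<in> carrier R" "j \<in> carrier R"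
      using closed[OF i(1)] closed[OF j(1)] ideal.Icarr[OF I prod(2)] by auto
    have "i \<otimes> j = ws n c \<otimes> j \<oplus> r \<otimes> j" using i car by (simp add: l_distr)
    also have "ws n c \<otimes> j = ws (Suc n) c' \<oplus> ws n c \<otimes> s"
      using j(2) car c' by (simp add: r_distr del: word_sum.simps)
    finally have "i \<otimes> j = ws (Suc n) c' \<oplus> (ws n c \<otimes> s \<oplus> r \<otimes> j)"
      using car by (simp add: a_assoc del: word_sum.simps)
    then show ?case using r' by blast
  next
    case (sum s1 s2)
    then obtain c r c' r' where
      "r \<in> ideal_power R I (Suc (Suc n))" "s1 = ws (Suc n) c \<oplus> r"
      "r' \<in> ideal_power R I (Suc (Suc n))" "s2 = ws (Suc n) c' \<oplus> r'" by blast
    moreover from this have "r \<in> carrier R" "r' \<in> carrier R" using closed by blast+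
    ultimately have "s1 \<oplus> s2 = ws (Suc n) (\<lambda>v. c v + c' v) \<oplus> (r \<oplus> r')"
      "r \<oplus> r' \<in> ideal_power R I (Suc (Suc n))"
      using word_sum_add[of "Suc n" c c'] ideal_add[OF ideal_power_ideal[OF I], of r "Suc (Suc n)" r']
      by (simp_all add: a_ac del: word_sum.simps)
    then show ?case by blast
  qed
qed

lemma ring_expansion:
  assumes I: "ideal I R" and x: "\<And>i. i < k \<Longrightarrow> x i \<in> I"
    and unit: "\<And>y. y \<in> carrier R \<Longrightarrow> \<exists>m. \<exists>r\<in>I. y = zmul R m \<one> \<oplus> r"
    and gen: "\<And>y. y \<in> I \<Longrightarrow> \<exists>c. \<exists>r\<in>ideal_power R I 2. y = ws (Suc 0) c \<oplus> r"
    and y: "y \<in> carrier R"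
  shows "\<exists>c. \<exists>r\<in>ideal_power R I n. y = wsb n c \<oplus> r"
proof (induction n)
  case 0 then show ?case using y by auto
next
  case (Suc n)
  then obtain c r where r: "r \<in> ideal_power R I n" "y = wsb n c \<oplus> r" by blast
  obtain c' r' where r': "r' \<in> ideal_power R I (Suc n)" "r = ws n c' \<oplus> r'"
    using ideal_power_expansion[OF I x unit gen r(1)] by blast
  let ?c = "\<lambda>v. if length v = n then c' v else c v"
  have "wsb n ?c = wsb n c" "ws n ?c = ws n c'"
    by (auto intro!: word_sum_below_cong word_sum_cong)
  then have "y = wsb (Suc n) ?c \<oplus> r'"
    using r r' ideal_power_closed[OF I r'(1)] by (simp add: a_assoc)
  then show ?case using r'(1) by blast
qed

text \<open>Independence of the monomials in each degree separately suffices, as one may remove the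
  homogeneous parts of a combination starting with the lowest degree.\<close>

lemma dvd_coeffs_if_word_sum_below_in_power:
  assumes I: "ideal I R" and x: "\<And>i. i < k \<Longrightarrow> x i \<in> I"
    and p: "zmul R p \<one> = \<zero>"
    and indep: "\<And>n c v. ws n c \<in> ideal_power R I (Suc n) \<Longrightarrow> length v = n \<Longrightarrow> set v \<subseteq> {..<k} \<Longrightarrow> p dvd c v"
    and c: "wsb m c \<in> ideal_power R I m" and v: "length v < m" "set v \<subseteq> {..<k}"
  shows "p dvd c v"
  using c v
proof (induction m arbitrary: v)
  case (Suc m)
  have sum: "wsb m c \<oplus> ws m c \<in> ideal_power R I (Suc m)" using Suc.prems(1) by simp
  then have "wsb m c \<oplus> ws m c \<in> ideal_power R I m"
    using ideal_power_Suc_subset[OF I] by blast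
  moreover have "ws m c \<in> ideal_power R I m" by (rule word_sum_in_ideal_power[OF I x])
  ultimately have "wsb m c \<in> ideal_power R I m"
    using ideal_add_cancel[OF ideal_power_ideal[OF I] word_sum_below_closed] by blast
  then have below: "\<And>v. length v < m \<Longrightarrow> set v \<subseteq> {..<k} \<Longrightarrow> p dvd c v"
    using Suc.IH by blast
  have "wsb m c = \<zero>" by (rule word_sum_below_eq_zero_if_dvd[OF p below])
  then have "ws m c \<in> ideal_power R I (Suc m)" using sum by simp
  then show ?case using below indep Suc.prems(2,3) by (cases "length v = m") auto
qed simp

end

section \<open>The Magnus expansion\<close>

primrec letter_product :: "('m, 'b) monoid_scheme \<Rightarrow> ('l \<Rightarrow> 'm) \<Rightarrow> 'l list \<Rightarrow> 'm"
  where
    "letter_product M f [] = \<one>\<^bsub>M\<^esub>"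
  | "letter_product M f (l # w) = f l \<otimes>\<^bsub>M\<^esub> letter_product M f w"

text \<open>Multiplication by \<open>1 + X\<^sub>i\<close> or its inverse acts on coefficients independently of the ring, up to
  products of \<open>X\<^sub>i\<close> with words of the maximal length; these are absorbed by the ideal \<open>J\<close>. The
  inverse letter is handled by multiplying the expansion for the solution of
  \<open>(1 + X\<^sub>i) f' = f\<close> with \<open>f (i, False)\<close>.\<close>

lemma (in ring_family) magnus_expansion:
  assumes J: "ideal J R"
    and overflow: "\<And>i c. i < k \<Longrightarrow> x i \<otimes> ws m c \<in> J"
    and f: "\<And>i b. i < k \<Longrightarrow> f (i, b) \<in> carrier R"
    and f_True: "\<And>i. i < k \<Longrightarrow> f (i, True) = \<one> \<oplus> x i"
    and f_inv: "\<And>i. i < k \<Longrightarrow> f (i, False) \<otimes> f (i, True) = \<one>"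
    and w: "w \<in> lists ({..<k} \<times> UNIV)"
  shows "\<exists>r\<in>J. letter_product R f w = wsb (Suc m) (magnus_coeff w) \<oplus> r"
  using w
proof (induction w)
  case Nil
  have "wsb (Suc m) (\<lambda>v. if v = [] then 1 else 0) = \<one>"
    using word_sum_below_unit[of m 1] by (simp add: int_smult_one)
  then show ?case using ideal_zero[OF J] by (intro bexI[of _ \<zero>]) auto
next
  case (Cons l w)
  obtain i b where l: "l = (i, b)" "i < k" using Cons.hyps by auto
  obtain r where r: "r \<in> J" "letter_product R f w = wsb (Suc m) (magnus_coeff w) \<oplus> r"
    using Cons by blast
  have car: "x i \<in> carrier R" "r \<in> carrier R" "\<And>b. f (i, b) \<in> carrier R"
    using l family_closed f ideal.Icarr[OF J r(1)] by auto
  have g_mult: "f (i, True) \<otimes> wsb (Suc m) c = wsb (Suc m) (cons_coeff i c) \<oplus> x i \<otimes> ws m c" for c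
    unfolding word_sum_below_cons_coeff[OF l(2)] f_True[OF l(2)]
    using car by (simp add: l_distr r_distr a_ac)
  show ?case
  proof (cases b)
    case True
    let ?r = "x i \<otimes> ws m (magnus_coeff w) \<oplus> f (i, True) \<otimes> r"
    have "letter_product R f (l # w) = f (i, True) \<otimes> (wsb (Suc m) (magnus_coeff w) \<oplus> r)"
      using l True r by simp
    also have "\<dots> = f (i, True) \<otimes> wsb (Suc m) (magnus_coeff w) \<oplus> f (i, True) \<otimes> r"
      using car by (intro r_distr) auto
    also have "\<dots> = wsb (Suc m) (magnus_coeff (l # w)) \<oplus> ?r"
      using l True car by (subst g_mult) (simp add: a_assoc del: word_sum_below.simps)
    finally show ?thesis
      using overflow[OF l(2)] ideal.I_l_closed[OF J r(1) car(3)] ideal_add[OF J] by blast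
  next
    case False
    let ?c = "magnus_coeff w" and ?c' = "inv_cons_coeff i (magnus_coeff w)"
    let ?h = "f (i, False)"
    let ?s = "x i \<otimes> ws m ?c'"
    have "wsb (Suc m) ?c' = (?h \<otimes> f (i, True)) \<otimes> wsb (Suc m) ?c'"
      using f_inv[OF l(2)] by (simp del: word_sum_below.simps)
    also have "\<dots> = ?h \<otimes> (wsb (Suc m) ?c \<oplus> ?s)"
      using car g_mult[of ?c'] by (simp add: m_assoc cons_coeff_inv_cons_coeff del: word_sum_below.simps)
    also have "\<dots> = ?h \<otimes> wsb (Suc m) ?c \<oplus> ?h \<otimes> ?s"
      using car by (intro r_distr) auto
    finally have eq: "wsb (Suc m) ?c' = ?h \<otimes> wsb (Suc m) ?c \<oplus> ?h \<otimes> ?s" .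
    have "letter_product R f (l # w) = ?h \<otimes> (wsb (Suc m) ?c \<oplus> r)"
      using l False r by simp
    also have "\<dots> = ?h \<otimes> wsb (Suc m) ?c \<oplus> ?h \<otimes> r"
      using car by (intro r_distr) auto
    also have "\<dots> = wsb (Suc m) ?c' \<oplus> (?h \<otimes> r \<ominus> ?h \<otimes> ?s)"
      unfolding eq using car by (simp add: a_minus_def a_ac r_neg r_neg1 r_neg2 del: word_sum_below.simps)
    also have "wsb (Suc m) ?c' = wsb (Suc m) (magnus_coeff (l # w))"
      using l False by simp
    finally show ?thesis
      using overflow[OF l(2)] ideal.I_l_closed[OF J r(1) car(3)]
        ideal.I_l_closed[OF J overflow[OF l(2)] car(3)] ideal_diff[OF J] by blast
  qed
qed

section \<open>Group algebras of finite groups over the prime field\<close>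

definition pairing :: "('q, 'b) monoid_scheme \<Rightarrow> ('q \<Rightarrow> int) \<Rightarrow> ('q \<Rightarrow> int) \<Rightarrow> int"
  where "pairing Q f t = (\<Sum>x\<in>carrier Q. f x * t x)"

definition delta :: "('q, 'b) monoid_scheme \<Rightarrow> 'q \<Rightarrow> 'q \<Rightarrow> int"
  where "delta Q g = (\<lambda>x\<in>carrier Q. if x = g then 1 else 0)"

definition aug_ideal :: "nat \<Rightarrow> ('q, 'b) monoid_scheme \<Rightarrow> ('q \<Rightarrow> int) set"
  where "aug_ideal p Q = {f \<in> carrier (group_algebra (Fp p) Q). int p dvd sum f (carrier Q)}"

lemma residue_ring_simps [simp]:
  "carrier (residue_ring m) = {0..m - 1}"
  "x \<otimes>\<^bsub>residue_ring m\<^esub> y = (x * y) mod m"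
  "x \<oplus>\<^bsub>residue_ring m\<^esub> y = (x + y) mod m"
  "\<one>\<^bsub>residue_ring m\<^esub> = 1"
  "\<zero>\<^bsub>residue_ring m\<^esub> = 0"
  by (simp_all add: residue_ring_def)

lemma finsum_residue_ring:
  assumes "m > 1" "finite A" "\<And>i. i \<in> A \<Longrightarrow> f i \<in> {0..m - 1}"
  shows "finsum (residue_ring m) f A = (\<Sum>i\<in>A. f i) mod m"
proof -
  interpret residues m "residue_ring m" by unfold_locales (use assms in simp)
  have "finsum (residue_ring m) f A = finsum (residue_ring m) (\<lambda>i. f i mod m) A"
    by (rule finsum_cong') (use assms(1,3) in auto)
  then show ?thesis using sum_cong[OF assms(2), of f] by simp
qed

lemma pairing_cong:
  assumes "\<And>x. x \<in> carrier Q \<Longrightarrow> [t x = s x] (mod m)"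
  shows "[pairing Q f t = pairing Q f s] (mod m)"
  unfolding pairing_def by (intro cong_sum cong_mult cong_refl assms)

lemma pairing_add_right: "pairing Q f (\<lambda>x. t x + s x) = pairing Q f t + pairing Q f s"
  by (simp add: pairing_def distrib_left sum.distrib)

locale finite_group_algebra = Q: group Q for Q :: "('q, 'b) monoid_scheme" +
  fixes p :: nat
  assumes prime_p: "Factorial_Ring.prime p" and finite_Q: "finite (carrier Q)"
begin

abbreviation A where "A \<equiv> group_algebra (Fp p) Q"

lemma p_gt_1: "int p > 1"
  using prime_gt_1_nat[OF prime_p] by simp

lemma carrier_A_iff:
  "f \<in> carrier A \<longleftrightarrow> f \<in> extensional (carrier Q) \<and> (\<forall>x\<in>carrier Q. 0 \<le> f x \<and> f x < int p)"
  by (auto simp: group_algebra_def PiE_def Pi_def)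

lemma A_zero: "\<zero>\<^bsub>A\<^esub> = (\<lambda>x\<in>carrier Q. 0)"
  by (simp add: group_algebra_def)

lemma A_one: "\<one>\<^bsub>A\<^esub> = delta Q \<one>\<^bsub>Q\<^esub>"
  by (simp add: group_algebra_def delta_def cong: if_cong)

lemma A_add: "f \<oplus>\<^bsub>A\<^esub> h = (\<lambda>x\<in>carrier Q. (f x + h x) mod int p)"
  by (simp add: group_algebra_def)

lemma A_mult:
  "f \<otimes>\<^bsub>A\<^esub> h
     = (\<lambda>x\<in>carrier Q. (\<Sum>y\<in>carrier Q. f y * h (inv\<^bsub>Q\<^esub> y \<otimes>\<^bsub>Q\<^esub> x)) mod int p)"
proof -
  have "finsum (Fp p) (\<lambda>y. f y * h (inv\<^bsub>Q\<^esub> y \<otimes>\<^bsub>Q\<^esub> x) mod int p) (carrier Q)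
      = (\<Sum>y\<in>carrier Q. f y * h (inv\<^bsub>Q\<^esub> y \<otimes>\<^bsub>Q\<^esub> x)) mod int p" for x
    using p_gt_1 by (subst finsum_residue_ring) (auto simp: finite_Q mod_sum_eq)
  then show ?thesis by (simp add: group_algebra_def)
qed

lemma finite_carrier_A: "finite (carrier A)"
  by (auto simp: group_algebra_def finite_Q intro: finite_PiE)

lemma delta_closed: "g \<in> carrier Q \<Longrightarrow> delta Q g \<in> carrier A"
  using p_gt_1 by (auto simp: carrier_A_iff delta_def)

lemma A_eqI:
  assumes "f \<in> carrier A" "h \<in> carrier A" "\<And>t. [pairing Q f t = pairing Q h t] (mod int p)"
  shows "f = h"
proof (rule extensionalityI)
  fix x assume x: "x \<in> carrier Q"
  have "pairing Q u (\<lambda>y. if y = x then 1 else 0) = u x" for u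
    unfolding pairing_def using x finite_Q by (simp add: if_distrib[of "(*) _"] sum.delta cong: if_cong)
  then have "[f x = h x] (mod int p)" using assms(3)[of "\<lambda>y. if y = x then 1 else 0"] by simp
  then show "f x = h x" using assms(1,2) x by (simp add: unique_euclidean_semiring_class.cong_def carrier_A_iff)
qed (use assms in \<open>auto simp: carrier_A_iff\<close>)

lemma add_closed_A: "f \<oplus>\<^bsub>A\<^esub> h \<in> carrier A"
  using p_gt_1 by (auto simp: carrier_A_iff A_add)

lemma mult_closed_A: "f \<otimes>\<^bsub>A\<^esub> h \<in> carrier A"
  using p_gt_1 by (auto simp: carrier_A_iff A_mult)

lemma pairing_add: "[pairing Q (f \<oplus>\<^bsub>A\<^esub> h) t = pairing Q f t + pairing Q h t] (mod int p)"
proof -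
  have "[pairing Q (f \<oplus>\<^bsub>A\<^esub> h) t = (\<Sum>x\<in>carrier Q. (f x + h x) * t x)] (mod int p)"
    unfolding pairing_def A_add by (intro cong_sum cong_mult cong_refl) (simp add: unique_euclidean_semiring_class.cong_def)
  then show ?thesis by (simp add: pairing_def distrib_right sum.distrib)
qed

lemma pairing_zero: "pairing Q \<zero>\<^bsub>A\<^esub> t = 0"
  by (simp add: pairing_def A_zero)

lemma pairing_delta: "g \<in> carrier Q \<Longrightarrow> pairing Q (delta Q g) t = t g"
proof -
  assume g: "g \<in> carrier Q"
  have "pairing Q (delta Q g) t = (\<Sum>x\<in>carrier Q. if x = g then t x else 0)"
    unfolding pairing_def by (rule sum.cong) (auto simp: delta_def)
  then show ?thesis using g finite_Q by simp
qed

text \<open>Convolution is characterised by its pairing with test functions; this form makes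
  associativity and the compatibility with push-forwards immediate.\<close>

lemma pairing_mult:
  "[pairing Q (f \<otimes>\<^bsub>A\<^esub> h) t = pairing Q f (\<lambda>y. pairing Q h (\<lambda>z. t (y \<otimes>\<^bsub>Q\<^esub> z)))] (mod int p)"
proof -
  have "[pairing Q (f \<otimes>\<^bsub>A\<^esub> h) t
      = (\<Sum>x\<in>carrier Q. (\<Sum>y\<in>carrier Q. f y * h (inv\<^bsub>Q\<^esub> y \<otimes>\<^bsub>Q\<^esub> x)) * t x)] (mod int p)"
    unfolding pairing_def A_mult by (intro cong_sum cong_mult cong_refl) (simp add: unique_euclidean_semiring_class.cong_def)
  also have "(\<Sum>x\<in>carrier Q. (\<Sum>y\<in>carrier Q. f y * h (inv\<^bsub>Q\<^esub> y \<otimes>\<^bsub>Q\<^esub> x)) * t x)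
      = (\<Sum>y\<in>carrier Q. \<Sum>x\<in>carrier Q. f y * (h (inv\<^bsub>Q\<^esub> y \<otimes>\<^bsub>Q\<^esub> x) * t x))"
    by (subst sum.swap) (simp add: sum_distrib_right mult.assoc)
  also have "\<dots> = (\<Sum>y\<in>carrier Q. \<Sum>z\<in>carrier Q. f y * (h z * t (y \<otimes>\<^bsub>Q\<^esub> z)))"
  proof (rule sum.cong[OF refl])
    fix y assume y: "y \<in> carrier Q"
    show "(\<Sum>x\<in>carrier Q. f y * (h (inv\<^bsub>Q\<^esub> y \<otimes>\<^bsub>Q\<^esub> x) * t x))
        = (\<Sum>z\<in>carrier Q. f y * (h z * t (y \<otimes>\<^bsub>Q\<^esub> z)))"
      by (rule sum.reindex_bij_witness[of _ "\<lambda>z. y \<otimes>\<^bsub>Q\<^esub> z" "\<lambda>x. inv\<^bsub>Q\<^esub> y \<otimes>\<^bsub>Q\<^esub> x"])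
        (use y in \<open>auto simp: Q.m_assoc[symmetric]\<close>)
  qed
  finally show ?thesis by (simp add: pairing_def sum_distrib_left mult.assoc)
qed

lemma pairing_mult2:
  "[pairing Q (f \<otimes>\<^bsub>A\<^esub> h) t = s] (mod int p) \<longleftrightarrow>
   [pairing Q f (\<lambda>y. pairing Q h (\<lambda>z. t (y \<otimes>\<^bsub>Q\<^esub> z))) = s] (mod int p)"
  using pairing_mult[of f h t] by (simp add: unique_euclidean_semiring_class.cong_def)

lemma ring_A: "ring A"
proof (rule ringI)
  show "abelian_group A"
  proof (rule abelian_groupI)
    fix f assume f: "f \<in> carrier A"
    show "\<zero>\<^bsub>A\<^esub> \<oplus>\<^bsub>A\<^esub> f = f"
      by (rule extensionalityI[of _ "carrier Q"])
        (use f in \<open>auto simp: A_add A_zero carrier_A_iff\<close>)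
    show "\<exists>h\<in>carrier A. h \<oplus>\<^bsub>A\<^esub> f = \<zero>\<^bsub>A\<^esub>"
      using p_gt_1
      by (intro bexI[of _ "\<lambda>x\<in>carrier Q. (- f x) mod int p"])
        (auto simp: A_add A_zero carrier_A_iff mod_simps intro!: restrict_ext)
  qed (use p_gt_1 in \<open>auto simp: A_add A_zero carrier_A_iff mod_simps add_ac intro!: restrict_ext\<close>)
  show "monoid A"
  proof (rule monoidI)
    show "\<one>\<^bsub>A\<^esub> \<in> carrier A" by (simp add: A_one delta_closed)
  next
    fix f h k assume f: "f \<in> carrier A" "h \<in> carrier A" "k \<in> carrier A"
    show "f \<otimes>\<^bsub>A\<^esub> h \<otimes>\<^bsub>A\<^esub> k = f \<otimes>\<^bsub>A\<^esub> (h \<otimes>\<^bsub>A\<^esub> k)"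
    proof (rule A_eqI)
      fix t
      let ?m = "pairing Q f (\<lambda>u. pairing Q h (\<lambda>v. pairing Q k (\<lambda>w. t (u \<otimes>\<^bsub>Q\<^esub> (v \<otimes>\<^bsub>Q\<^esub> w)))))"
      have "[pairing Q (f \<otimes>\<^bsub>A\<^esub> h \<otimes>\<^bsub>A\<^esub> k) t = ?m] (mod int p)"
        unfolding pairing_mult2
        by (intro pairing_cong) (simp add: Q.m_assoc unique_euclidean_semiring_class.cong_def pairing_def)
      moreover have "[pairing Q (f \<otimes>\<^bsub>A\<^esub> (h \<otimes>\<^bsub>A\<^esub> k)) t = ?m] (mod int p)"
        unfolding pairing_mult2
        by (intro pairing_cong pairing_mult)
      ultimately show "[pairing Q (f \<otimes>\<^bsub>A\<^esub> h \<otimes>\<^bsub>A\<^esub> k) t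
          = pairing Q (f \<otimes>\<^bsub>A\<^esub> (h \<otimes>\<^bsub>A\<^esub> k)) t] (mod int p)"
        by (meson cong_sym cong_trans)
    qed (auto simp: mult_closed_A)
  next
    fix f assume f: "f \<in> carrier A"
    show "\<one>\<^bsub>A\<^esub> \<otimes>\<^bsub>A\<^esub> f = f"
    proof (rule A_eqI)
      fix t
      show "[pairing Q (\<one>\<^bsub>A\<^esub> \<otimes>\<^bsub>A\<^esub> f) t = pairing Q f t] (mod int p)"
        unfolding pairing_mult2 A_one by (simp add: pairing_delta) (simp add: pairing_def)
    qed (auto simp: mult_closed_A f)
    show "f \<otimes>\<^bsub>A\<^esub> \<one>\<^bsub>A\<^esub> = f"
    proof (rule A_eqI)
      fix t
      show "[pairing Q (f \<otimes>\<^bsub>A\<^esub> \<one>\<^bsub>A\<^esub>) t = pairing Q f t] (mod int p)"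
        unfolding pairing_mult2 A_one by (simp add: pairing_delta) (simp add: pairing_def)
    qed (auto simp: mult_closed_A f)
  qed (auto simp: mult_closed_A)
next
  fix f h k assume f: "f \<in> carrier A" "h \<in> carrier A" "k \<in> carrier A"
  have add: "[pairing Q (u \<otimes>\<^bsub>A\<^esub> v \<oplus>\<^bsub>A\<^esub> u' \<otimes>\<^bsub>A\<^esub> v') t
      = pairing Q u (\<lambda>y. pairing Q v (\<lambda>z. t (y \<otimes>\<^bsub>Q\<^esub> z)))
        + pairing Q u' (\<lambda>y. pairing Q v' (\<lambda>z. t (y \<otimes>\<^bsub>Q\<^esub> z)))] (mod int p)" for u v u' v' t
    by (rule cong_trans[OF pairing_add cong_add]) (rule pairing_mult)+
  show "(f \<oplus>\<^bsub>A\<^esub> h) \<otimes>\<^bsub>A\<^esub> k = f \<otimes>\<^bsub>A\<^esub> k \<oplus>\<^bsub>A\<^esub> h \<otimes>\<^bsub>A\<^esub> k"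
  proof (rule A_eqI)
    fix t
    show "[pairing Q ((f \<oplus>\<^bsub>A\<^esub> h) \<otimes>\<^bsub>A\<^esub> k) t
        = pairing Q (f \<otimes>\<^bsub>A\<^esub> k \<oplus>\<^bsub>A\<^esub> h \<otimes>\<^bsub>A\<^esub> k) t] (mod int p)"
      unfolding pairing_mult2 by (rule cong_trans[OF pairing_add cong_sym[OF add]])
  qed (auto simp: mult_closed_A add_closed_A)
  show "k \<otimes>\<^bsub>A\<^esub> (f \<oplus>\<^bsub>A\<^esub> h) = k \<otimes>\<^bsub>A\<^esub> f \<oplus>\<^bsub>A\<^esub> k \<otimes>\<^bsub>A\<^esub> h"
  proof (rule A_eqI)
    fix t
    have "[pairing Q (k \<otimes>\<^bsub>A\<^esub> (f \<oplus>\<^bsub>A\<^esub> h)) t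
        = pairing Q k (\<lambda>y. pairing Q f (\<lambda>z. t (y \<otimes>\<^bsub>Q\<^esub> z)) + pairing Q h (\<lambda>z. t (y \<otimes>\<^bsub>Q\<^esub> z)))] (mod int p)"
      unfolding pairing_mult2 by (intro pairing_cong pairing_add)
    then show "[pairing Q (k \<otimes>\<^bsub>A\<^esub> (f \<oplus>\<^bsub>A\<^esub> h)) t
        = pairing Q (k \<otimes>\<^bsub>A\<^esub> f \<oplus>\<^bsub>A\<^esub> k \<otimes>\<^bsub>A\<^esub> h) t] (mod int p)"
      unfolding pairing_add_right using add[THEN cong_sym] by (rule cong_trans)
  qed (auto simp: mult_closed_A add_closed_A)
qed

sublocale A: ring A by (rule ring_A)

lemma A_zmul:
  assumes "f \<in> carrier A"
  shows "zmul A m f = (\<lambda>x\<in>carrier Q. (m * f x) mod int p)"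
proof (induction m rule: int_induct[where k = 0])
  case base then show ?case by (simp add: A.int_smult_zero A_zero)
next
  case (step1 i)
  have "zmul A (i + 1) f = zmul A i f \<oplus>\<^bsub>A\<^esub> f"
    using assms by (simp add: A.int_smult_add A.int_smult_one)
  then show ?case unfolding step1(2) A_add by (auto simp: algebra_simps mod_simps intro!: restrict_ext)
next
  case (step2 i)
  have "zmul A (i - 1) f = zmul A (i + (- 1)) f" by simp
  also have "\<dots> = zmul A i f \<oplus>\<^bsub>A\<^esub> (\<ominus>\<^bsub>A\<^esub> f)"
    using assms by (simp only: A.int_smult_add A.int_smult_minus A.int_smult_one)
  also have "\<ominus>\<^bsub>A\<^esub> f = (\<lambda>x\<in>carrier Q. (- f x) mod int p)"
    by (rule A.minus_equality)
      (use assms p_gt_1 in \<open>auto simp: A_add A_zero carrier_A_iff mod_simps intro!: restrict_ext\<close>)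
  finally show ?case
    unfolding step2(2) A_add by (auto simp: algebra_simps mod_simps intro!: restrict_ext)
qed

lemma A_char: "zmul A (int p) \<one>\<^bsub>A\<^esub> = \<zero>\<^bsub>A\<^esub>"
  by (subst A_zmul) (auto simp: A_zero)

lemma pairing_zmul:
  assumes "f \<in> carrier A"
  shows "[pairing Q (zmul A m f) t = m * pairing Q f t] (mod int p)"
proof -
  have "[pairing Q (zmul A m f) t = (\<Sum>x\<in>carrier Q. (m * f x) * t x)] (mod int p)"
    unfolding pairing_def A_zmul[OF assms] by (intro cong_sum cong_mult cong_refl) (simp add: unique_euclidean_semiring_class.cong_def)
  then show ?thesis by (simp add: pairing_def sum_distrib_left mult.assoc)
qed

lemma pairing_finsum:
  assumes "finite B" "\<And>i. i \<in> B \<Longrightarrow> F i \<in> carrier A"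
  shows "[pairing Q (finsum A (\<lambda>i. F i) B) t = (\<Sum>i\<in>B. pairing Q (F i) t)] (mod int p)"
  using assms
proof (induction B rule: finite_induct)
  case empty then show ?case by (simp add: pairing_zero)
next
  case (insert i B)
  have "(finsum A (\<lambda>i. F i) (insert i B)) = F i \<oplus>\<^bsub>A\<^esub> (finsum A (\<lambda>i. F i) B)"
    using insert by (intro A.finsum_insert) auto
  then show ?case
    using insert cong_trans[OF pairing_add cong_add[OF cong_refl insert.IH]] by simp
qed

lemma delta_mult:
  assumes "g \<in> carrier Q" "h \<in> carrier Q"
  shows "delta Q g \<otimes>\<^bsub>A\<^esub> delta Q h = delta Q (g \<otimes>\<^bsub>Q\<^esub> h)"
  by (rule A_eqI)
    (use assms in \<open>auto simp: mult_closed_A delta_closed pairing_mult2 pairing_delta\<close>)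

lemma eq_sum_delta:
  assumes "f \<in> carrier A"
  shows "f = (finsum A (\<lambda>g. zmul A (f g) (delta Q g)) (carrier Q))"
proof (rule A_eqI[OF assms])
  fix t
  have "[pairing Q (finsum A (\<lambda>g. zmul A (f g) (delta Q g)) (carrier Q)) t
      = (\<Sum>g\<in>carrier Q. pairing Q (zmul A (f g) (delta Q g)) t)] (mod int p)"
    by (rule pairing_finsum) (auto simp: finite_Q delta_closed)
  moreover have "[(\<Sum>g\<in>carrier Q. pairing Q (zmul A (f g) (delta Q g)) t)
      = (\<Sum>g\<in>carrier Q. f g * t g)] (mod int p)"
    using pairing_zmul[OF delta_closed] by (intro cong_sum) (metis pairing_delta)
  ultimately show "[pairing Q f t
      = pairing Q (finsum A (\<lambda>g. zmul A (f g) (delta Q g)) (carrier Q)) t] (mod int p)"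
    unfolding pairing_def[of Q f] by (meson cong_sym cong_trans)
qed (auto simp: delta_closed)

lemma pairing_one_right: "pairing Q f (\<lambda>_. 1) = sum f (carrier Q)"
  by (simp add: pairing_def)

lemma sum_hom: "(\<lambda>f. sum f (carrier Q) mod int p) \<in> ring_hom A (Fp p)"
proof (rule ring_hom_memI)
  fix f h assume "f \<in> carrier A" "h \<in> carrier A"
  show "sum (f \<otimes>\<^bsub>A\<^esub> h) (carrier Q) mod int p
      = (sum f (carrier Q) mod int p) \<otimes>\<^bsub>Fp p\<^esub> (sum h (carrier Q) mod int p)"
    using pairing_mult[of f h "\<lambda>_. 1"] unfolding pairing_one_right
    by (simp add: unique_euclidean_semiring_class.cong_def pairing_def sum_distrib_right[symmetric] mod_simps)
  show "sum (f \<oplus>\<^bsub>A\<^esub> h) (carrier Q) mod int p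
      = (sum f (carrier Q) mod int p) \<oplus>\<^bsub>Fp p\<^esub> (sum h (carrier Q) mod int p)"
    using pairing_add[of f h "\<lambda>_. 1"] unfolding pairing_one_right by (simp add: unique_euclidean_semiring_class.cong_def mod_simps)
next
  show "sum \<one>\<^bsub>A\<^esub> (carrier Q) mod int p = \<one>\<^bsub>Fp p\<^esub>"
    using pairing_delta[of "\<one>\<^bsub>Q\<^esub>" "\<lambda>_. 1"] p_gt_1 unfolding pairing_one_right A_one by simp
qed (use p_gt_1 in auto)

lemma ring_Fp: "ring (Fp p)"
proof -
  interpret residues "int p" "Fp p" by unfold_locales (rule p_gt_1)
  show ?thesis by (rule ring_axioms)
qed

lemma aug_ideal_ideal: "ideal (aug_ideal p Q) A"
proof -
  interpret h: ring_hom_ring A "Fp p" "\<lambda>f. sum f (carrier Q) mod int p"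
    by (rule ring_hom_ringI2[OF ring_A ring_Fp sum_hom])
  have "a_kernel A (Fp p) (\<lambda>f. sum f (carrier Q) mod int p) = aug_ideal p Q"
    unfolding a_kernel_def' aug_ideal_def by (simp only: residue_ring_simps mod_eq_0_iff_dvd)
  then show ?thesis using h.kernel_is_ideal by simp
qed

lemma delta_minus_one_in_aug_ideal:
  assumes "g \<in> carrier Q"
  shows "delta Q g \<ominus>\<^bsub>A\<^esub> \<one>\<^bsub>A\<^esub> \<in> aug_ideal p Q"
proof -
  let ?f = "delta Q g \<ominus>\<^bsub>A\<^esub> \<one>\<^bsub>A\<^esub>"
  have car: "delta Q g \<in> carrier A" "?f \<in> carrier A"
    using assms by (auto simp: delta_closed)
  have "?f \<oplus>\<^bsub>A\<^esub> \<one>\<^bsub>A\<^esub> = delta Q g"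
    using car by (simp add: A.minus_eq A.a_assoc A.l_neg)
  moreover have "pairing Q (delta Q g) (\<lambda>_. 1) = 1" "pairing Q \<one>\<^bsub>A\<^esub> (\<lambda>_. 1) = 1"
    using assms unfolding A_one by (simp_all only: pairing_delta Q.one_closed)
  ultimately have "[1 = pairing Q ?f (\<lambda>_. 1) + 1] (mod int p)"
    using pairing_add[of ?f "\<one>\<^bsub>A\<^esub>" "\<lambda>_. 1"] by (simp only:)
  then have "[pairing Q ?f (\<lambda>_. 1) + 1 = 1] (mod int p)" by (rule cong_sym)
  then have "[pairing Q ?f (\<lambda>_. 1) + 1 = 0 + 1] (mod int p)" by simp
  then have "[pairing Q ?f (\<lambda>_. 1) = 0] (mod int p)" by (simp only: cong_add_rcancel)
  then show ?thesis
    using car unfolding pairing_one_right by (simp add: aug_ideal_def cong_0_iff)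
qed

text \<open>Subtracting the sum of the coefficients, which is divisible by \<open>p\<close>, from the expansion in the
  basis of group elements.\<close>

lemma aug_ideal_eq_sum:
  assumes "f \<in> aug_ideal p Q"
  shows "f = (finsum A (\<lambda>g. zmul A (f g) (delta Q g \<ominus>\<^bsub>A\<^esub> \<one>\<^bsub>A\<^esub>)) (carrier Q))"
proof -
  have f: "f \<in> carrier A" and dvd: "int p dvd sum f (carrier Q)"
    using assms by (auto simp: aug_ideal_def)
  have one: "(finsum A (\<lambda>g. zmul A (f g) \<one>\<^bsub>A\<^esub>) B) = zmul A (sum f B) \<one>\<^bsub>A\<^esub>"
    if "finite B" for B
    using that by (induction B rule: finite_induct) (auto simp: A.int_smult_add A.int_smult_zero)
  have "f = (finsum A (\<lambda>g. zmul A (f g) (delta Q g \<ominus>\<^bsub>A\<^esub> \<one>\<^bsub>A\<^esub>) \<oplus>\<^bsub>A\<^esub> zmul A (f g) \<one>\<^bsub>A\<^esub>) (carrier Q))"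
    unfolding A.int_smult_distrib[symmetric]
    by (subst eq_sum_delta[OF f], rule A.finsum_cong')
      (auto simp: delta_closed A.int_smult_distrib[symmetric] A.minus_eq A.a_assoc A.l_neg)
  also have "\<dots> = (finsum A (\<lambda>g. zmul A (f g) (delta Q g \<ominus>\<^bsub>A\<^esub> \<one>\<^bsub>A\<^esub>)) (carrier Q))
      \<oplus>\<^bsub>A\<^esub> (finsum A (\<lambda>g. zmul A (f g) \<one>\<^bsub>A\<^esub>) (carrier Q))"
    by (rule A.finsum_addf) (auto simp: delta_closed)
  also have "(finsum A (\<lambda>g. zmul A (f g) \<one>\<^bsub>A\<^esub>) (carrier Q)) = \<zero>\<^bsub>A\<^esub>"
    unfolding one[OF finite_Q] by (rule A.int_smult_eq_zero_if_dvd[OF A_char dvd]) simp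
  also have "(finsum A (\<lambda>g. zmul A (f g) (delta Q g \<ominus>\<^bsub>A\<^esub> \<one>\<^bsub>A\<^esub>)) (carrier Q)) \<oplus>\<^bsub>A\<^esub> \<zero>\<^bsub>A\<^esub>
      = (finsum A (\<lambda>g. zmul A (f g) (delta Q g \<ominus>\<^bsub>A\<^esub> \<one>\<^bsub>A\<^esub>)) (carrier Q))"
    by (rule A.r_zero) (auto simp: delta_closed)
  finally show ?thesis .
qed

end

section \<open>Nilpotency of the augmentation ideal of a finite p-group\<close>

text \<open>Orbits have p-power length, so the number of fixed points is congruent to the number of points
  modulo \<^term>\<open>p\<close>.\<close>

lemma (in group) exists_other_fixed_point:
  assumes p: "Factorial_Ring.prime p" and order: "card (carrier G) = p ^ k"
    and E: "finite E" "p dvd card E"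
    and act_closed: "\<And>g e. g \<in> carrier G \<Longrightarrow> e \<in> E \<Longrightarrow> act g e \<in> E"
    and act_one: "\<And>e. e \<in> E \<Longrightarrow> act \<one> e = e"
    and act_mult: "\<And>g h e. g \<in> carrier G \<Longrightarrow> h \<in> carrier G \<Longrightarrow> e \<in> E \<Longrightarrow>
      act (g \<otimes> h) e = act g (act h e)"
    and e0: "e0 \<in> E" "\<And>g. g \<in> carrier G \<Longrightarrow> act g e0 = e0"
  shows "\<exists>e\<in>E. e \<noteq> e0 \<and> (\<forall>g\<in>carrier G. act g e = e)"
proof (rule ccontr)
  assume no_other: "\<not> ?thesis"
  let ?act = "\<lambda>g. restrict (act g) E"
  have inv_act: "act (inv g) (act g e) = e" "act g (act (inv g) e) = e"
    if "g \<in> carrier G" "e \<in> E" for g e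
    using act_mult[of "inv g" g e] act_mult[of g "inv g" e] act_one that by auto
  have bij: "?act g \<in> carrier (BijGroup E)" if "g \<in> carrier G" for g
  proof -
    have "bij_betw (act g) E E"
      by (rule bij_betwI[of _ _ _ "act (inv g)"]) (use that act_closed inv_act in auto)
    then show ?thesis by (auto simp: BijGroup_def Bij_def cong: bij_betw_cong)
  qed
  have "?act \<in> hom G (BijGroup E)"
  proof (rule homI)
    fix g h assume gh: "g \<in> carrier G" "h \<in> carrier G"
    show "?act (g \<otimes> h) = ?act g \<otimes>\<^bsub>BijGroup E\<^esub> ?act h"
      using bij[OF gh(1)] bij[OF gh(2)] act_mult[OF gh] act_closed gh
      by (auto simp: BijGroup_def compose_def intro!: restrict_ext)
  qed (rule bij)
  then interpret action: group_action G E ?act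
    by (intro group_action.intro group_hom.intro group_hom_axioms.intro is_group group_BijGroup)
  interpret part: partition E "orbits G E ?act" by (rule action.orbit_partition)
  have orb_sub: "B \<subseteq> E" "finite B" if "B \<in> orbits G E ?act" for B
  proof -
    show "B \<subseteq> E" using that act_closed by (auto simp: orbits_def orbit_def)
    then show "finite B" using E(1) finite_subset by blast
  qed
  have orb_e0: "orbit G ?act e0 = {e0}"
    using e0 by (auto simp: orbit_def intro: exI[of _ \<one>])
  have p_dvd: "p dvd card B" if B: "B \<in> orbits G E ?act" "B \<noteq> {e0}" for B
  proof -
    obtain e where e: "e \<in> E" "B = orbit G ?act e" using B(1) by (auto simp: orbits_def)
    have "card B dvd p ^ k"
      using action.orbit_stabilizer_theorem[OF e(1)] e(2) order
      by (metis dvd_triv_left Coset.order_def)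
    then obtain j where j: "card B = p ^ j" using p by (auto simp: divides_primepow_nat)
    have "e \<noteq> e0" using e orb_e0 B(2) by auto
    then obtain g where g: "g \<in> carrier G" "act g e \<noteq> e" using no_other e(1) by blast
    have "{e, act g e} \<subseteq> B"
      using e g(1) action.orbit_refl[OF e(1)] by (auto simp: orbit_def)
    then have "card {e, act g e} \<le> card B" by (rule card_mono[OF orb_sub(2)[OF B(1)]])
    then have "j \<noteq> 0" using g(2) j by (intro notI) auto
    then show ?thesis using j by simp
  qed
  have "pairwise disjnt (orbits G E ?act)"
    using part.disjoint_union unfolding pairwise_def disjnt_def by blast
  then have "card E = sum card (orbits G E ?act)"
    using card_Union_disjoint[of "orbits G E ?act"] orb_sub part.partition_coverture by simp
  moreover have fin: "finite (orbits G E ?act)"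
    using E(1) by (simp add: orbits_def)
  moreover have in_orb: "{e0} \<in> orbits G E ?act" using orb_e0 e0(1) by (auto simp: orbits_def)
  ultimately have "card E = 1 + sum card (orbits G E ?act - {{e0}})"
    using sum.remove[OF fin in_orb, of card] by simp
  moreover have "p dvd sum card (orbits G E ?act - {{e0}})"
    by (rule dvd_sum) (use p_dvd in auto)
  ultimately have "p dvd 1" using E(2) by (metis dvd_add_left_iff)
  then show False using p by simp
qed

locale p_group_algebra = finite_group_algebra +
  fixes k :: nat
  assumes order_Q: "card (carrier Q) = p ^ k"
begin

text \<open>The ascending chain in which each step consists of the elements fixed by \<open>Q\<close> modulo the previous
  step. It is the counterpart of the descending chain of powers of the augmentation ideal, and its
  strictness is a statement about fixed points.\<close>

primrec upper :: "nat \<Rightarrow> ('a \<Rightarrow> int) set"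
  where
    "upper 0 = {\<zero>\<^bsub>A\<^esub>}"
  | "upper (Suc n) = {a \<in> carrier A. \<forall>g\<in>carrier Q. delta Q g \<otimes>\<^bsub>A\<^esub> a \<ominus>\<^bsub>A\<^esub> a \<in> upper n}"

lemma upper_closed: "a \<in> upper n \<Longrightarrow> a \<in> carrier A"
  by (cases n) auto

lemma upper_minus: "a \<in> upper n \<Longrightarrow> b \<in> upper n \<Longrightarrow> a \<ominus>\<^bsub>A\<^esub> b \<in> upper n"
proof (induction n arbitrary: a b)
  case (Suc n)
  have car: "a \<in> carrier A" "b \<in> carrier A" using Suc.prems by auto
  have "delta Q g \<otimes>\<^bsub>A\<^esub> (a \<ominus>\<^bsub>A\<^esub> b) \<ominus>\<^bsub>A\<^esub> (a \<ominus>\<^bsub>A\<^esub> b)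
      = (delta Q g \<otimes>\<^bsub>A\<^esub> a \<ominus>\<^bsub>A\<^esub> a) \<ominus>\<^bsub>A\<^esub> (delta Q g \<otimes>\<^bsub>A\<^esub> b \<ominus>\<^bsub>A\<^esub> b)" if "g \<in> carrier Q" for g
    using car delta_closed[OF that]
    by (simp add: A.minus_eq A.r_distr A.minus_add A.a_ac A.r_minus)
  then show ?case using Suc.prems Suc.IH car by auto
qed (simp add: A.minus_eq)

lemma upper_zero: "\<zero>\<^bsub>A\<^esub> \<in> upper n"
  by (induction n) (auto simp: A.minus_eq delta_closed)

lemma upper_subgroup: "subgroup (upper n) (add_monoid A)"
proof (rule A.add.subgroupI)
  show "upper n \<noteq> {}" using upper_zero by auto
  show uminus: "\<ominus>\<^bsub>A\<^esub> a \<in> upper n" if "a \<in> upper n" for a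
    using upper_minus[OF upper_zero that] upper_closed[OF that] by (simp add: A.minus_eq)
  show "a \<oplus>\<^bsub>A\<^esub> b \<in> upper n" if "a \<in> upper n" "b \<in> upper n" for a b
    using upper_minus[OF that(1) uminus[OF that(2)]] upper_closed[OF that(2)]
    by (simp add: A.minus_eq)
qed (auto dest: upper_closed)

lemma upper_stable: "a \<in> upper n \<Longrightarrow> h \<in> carrier Q \<Longrightarrow> delta Q h \<otimes>\<^bsub>A\<^esub> a \<in> upper n"
proof (induction n arbitrary: a h)
  case 0 then show ?case by (simp add: delta_closed)
next
  case (Suc n)
  have a: "a \<in> carrier A" using Suc.prems by auto
  have "delta Q g \<otimes>\<^bsub>A\<^esub> (delta Q h \<otimes>\<^bsub>A\<^esub> a) \<ominus>\<^bsub>A\<^esub> delta Q h \<otimes>\<^bsub>A\<^esub> a \<in> upper n"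
    if g: "g \<in> carrier Q" for g
  proof -
    let ?c = "inv\<^bsub>Q\<^esub> h \<otimes>\<^bsub>Q\<^esub> g \<otimes>\<^bsub>Q\<^esub> h"
    have c: "?c \<in> carrier Q" using g Suc.prems(2) by simp
    have "h \<otimes>\<^bsub>Q\<^esub> ?c = g \<otimes>\<^bsub>Q\<^esub> h" using g Suc.prems(2) by (simp add: Q.m_assoc[symmetric])
    then have "delta Q g \<otimes>\<^bsub>A\<^esub> (delta Q h \<otimes>\<^bsub>A\<^esub> a) = delta Q h \<otimes>\<^bsub>A\<^esub> (delta Q ?c \<otimes>\<^bsub>A\<^esub> a)"
      using a g Suc.prems(2) c by (simp add: A.m_assoc[symmetric] delta_closed delta_mult)
    then have "delta Q g \<otimes>\<^bsub>A\<^esub> (delta Q h \<otimes>\<^bsub>A\<^esub> a) \<ominus>\<^bsub>A\<^esub> delta Q h \<otimes>\<^bsub>A\<^esub> a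
        = delta Q h \<otimes>\<^bsub>A\<^esub> (delta Q ?c \<otimes>\<^bsub>A\<^esub> a \<ominus>\<^bsub>A\<^esub> a)"
      using a c Suc.prems(2) by (simp add: A.minus_eq A.r_distr A.r_minus delta_closed)
    moreover have "delta Q ?c \<otimes>\<^bsub>A\<^esub> a \<ominus>\<^bsub>A\<^esub> a \<in> upper n" using Suc.prems(1) c by simp
    ultimately show ?thesis using Suc.IH Suc.prems(2) by simp
  qed
  then show ?case using a Suc.prems(2) by (simp add: delta_closed)
qed

text \<open>The group acts on the cosets of a proper step of the chain. Their number is a power of \<open>p\<close>
  greater than 1, so besides the step itself there is another fixed coset.\<close>

lemma upper_strict:
  assumes "upper n \<noteq> carrier A"
  shows "upper n \<subset> upper (Suc n)"
proof -
  let ?W = "upper n" and ?M = "add_monoid A"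
  have sub: "upper n \<subseteq> upper (Suc n)"
    using upper_minus upper_stable upper_closed by auto
  interpret W: subgroup ?W ?M by (rule upper_subgroup)
  let ?E = "rcosets\<^bsub>?M\<^esub> ?W"
  let ?act = "\<lambda>g C. (\<lambda>a. delta Q g \<otimes>\<^bsub>A\<^esub> a) ` C"
  have finM: "finite (carrier ?M)" using finite_carrier_A by simp
  have finE: "finite ?E" using finM by (simp add: RCOSETS_def)
  have E_mem: "C \<in> ?E \<Longrightarrow> C \<subseteq> carrier A" for C
    using W.rcosets_carrier[OF A.add.group_axioms] by auto
  have coset: "?act g (?W #>\<^bsub>?M\<^esub> a) = ?W #>\<^bsub>?M\<^esub> (delta Q g \<otimes>\<^bsub>A\<^esub> a)"
    if g: "g \<in> carrier Q" and a: "a \<in> carrier A" for g a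
  proof
    show "?act g (?W #>\<^bsub>?M\<^esub> a) \<subseteq> ?W #>\<^bsub>?M\<^esub> (delta Q g \<otimes>\<^bsub>A\<^esub> a)"
    proof
      fix u assume "u \<in> ?act g (?W #>\<^bsub>?M\<^esub> a)"
      then obtain w where w: "w \<in> ?W" "u = delta Q g \<otimes>\<^bsub>A\<^esub> (w \<oplus>\<^bsub>A\<^esub> a)" by (auto simp: r_coset_def)
      then have "u = delta Q g \<otimes>\<^bsub>A\<^esub> w \<oplus>\<^bsub>A\<^esub> delta Q g \<otimes>\<^bsub>A\<^esub> a"
        using a delta_closed[OF g] upper_closed by (simp add: A.r_distr)
      then show "u \<in> ?W #>\<^bsub>?M\<^esub> (delta Q g \<otimes>\<^bsub>A\<^esub> a)"
        using upper_stable[OF w(1) g] by (auto simp: r_coset_def)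
    qed
    show "?W #>\<^bsub>?M\<^esub> (delta Q g \<otimes>\<^bsub>A\<^esub> a) \<subseteq> ?act g (?W #>\<^bsub>?M\<^esub> a)"
    proof
      fix u assume "u \<in> ?W #>\<^bsub>?M\<^esub> (delta Q g \<otimes>\<^bsub>A\<^esub> a)"
      then obtain w where w: "w \<in> ?W" "u = w \<oplus>\<^bsub>A\<^esub> delta Q g \<otimes>\<^bsub>A\<^esub> a" by (auto simp: r_coset_def)
      let ?w = "delta Q (inv\<^bsub>Q\<^esub> g) \<otimes>\<^bsub>A\<^esub> w"
      have w': "?w \<in> ?W" using upper_stable[OF w(1), of "inv\<^bsub>Q\<^esub> g"] g by simp
      have "delta Q g \<otimes>\<^bsub>A\<^esub> ?w = w"
        using g upper_closed[OF w(1)]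
        by (simp add: A.m_assoc[symmetric] delta_closed delta_mult A_one[symmetric])
      then have "u = delta Q g \<otimes>\<^bsub>A\<^esub> (?w \<oplus>\<^bsub>A\<^esub> a)"
        using w(2) a delta_closed[OF g] upper_closed[OF w'] by (simp add: A.r_distr)
      then show "u \<in> ?act g (?W #>\<^bsub>?M\<^esub> a)" using w' by (auto simp: r_coset_def)
    qed
  qed
  have E_iff: "C \<in> ?E \<longleftrightarrow> (\<exists>a\<in>carrier A. C = ?W #>\<^bsub>?M\<^esub> a)" for C
    by (auto simp: RCOSETS_def)
  have "card ?E * card ?W = p ^ card (carrier Q)"
  proof -
    have "card ?E * card ?W = card (carrier A)"
      using A.add.lagrange_finite[OF finite_carrier_A upper_subgroup[of n]] by (simp add: Coset.order_def)
    also have "\<dots> = card (carrier Q \<rightarrow>\<^sub>E {0..int p - 1})" by (simp add: group_algebra_def)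
    also have "\<dots> = p ^ card (carrier Q)" by (simp add: card_PiE finite_Q)
    finally show ?thesis .
  qed
  then have "card ?E dvd p ^ card (carrier Q)" by (metis dvd_triv_left)
  then obtain j where j: "card ?E = p ^ j" using prime_p by (auto simp: divides_primepow_nat)
  have W_E: "?W \<in> ?E" by (rule W.subgroup_in_rcosets[OF A.add.group_axioms])
  have "j \<noteq> 0"
  proof
    assume "j = 0"
    then have "card ?E = 1" using j by simp
    then have "?E = {?W}" using W_E by (metis card_1_singletonE singletonD)
    moreover have "\<Union> ?E = carrier A"
      using A.add.rcosets_part_G[OF upper_subgroup[of n]] by simp
    ultimately show False using assms by simp
  qed
  then have "p dvd card ?E" using j by simp
  have act_one: "?act \<one>\<^bsub>Q\<^esub> C = C" if "C \<in> ?E" for C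
  proof -
    have "(\<lambda>a. delta Q \<one>\<^bsub>Q\<^esub> \<otimes>\<^bsub>A\<^esub> a) ` C = (\<lambda>a. a) ` C"
      using E_mem[OF that] by (intro image_cong) (auto simp: A_one[symmetric])
    then show ?thesis by simp
  qed
  have act_mult: "?act (g \<otimes>\<^bsub>Q\<^esub> h) C = ?act g (?act h C)"
    if g: "g \<in> carrier Q" and h: "h \<in> carrier Q" and C: "C \<in> ?E" for g h C
  proof -
    have "delta Q (g \<otimes>\<^bsub>Q\<^esub> h) \<otimes>\<^bsub>A\<^esub> a = delta Q g \<otimes>\<^bsub>A\<^esub> (delta Q h \<otimes>\<^bsub>A\<^esub> a)" if "a \<in> C" for a
      using E_mem[OF C] that g h by (auto simp: delta_mult[symmetric] A.m_assoc delta_closed)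
    then show ?thesis unfolding image_image by (rule image_cong[OF refl])
  qed
  have act_closed: "?act g C \<in> ?E" if g: "g \<in> carrier Q" and C: "C \<in> ?E" for g C
  proof -
    obtain a where a: "a \<in> carrier A" "C = ?W #>\<^bsub>?M\<^esub> a" 
      using C unfolding E_iff by blast
    have "?act g C = ?W #>\<^bsub>?M\<^esub> (delta Q g \<otimes>\<^bsub>A\<^esub> a)" unfolding a(2) by (rule coset[OF g a(1)])
    then show ?thesis
      unfolding E_iff by (intro bexI[of _ "delta Q g \<otimes>\<^bsub>A\<^esub> a"] A.m_closed delta_closed g a)
  qed
  have "\<one>\<^bsub>?M\<^esub> = \<zero>\<^bsub>A\<^esub>" by simp
  then have W_coset: "?W #>\<^bsub>?M\<^esub> \<zero>\<^bsub>A\<^esub> = ?W"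
    using A.add.coset_mult_one[of ?W] upper_closed by blast
  have fix_W: "?act g ?W = ?W" if "g \<in> carrier Q" for g
    using coset[OF that A.zero_closed] delta_closed[OF that] W_coset by simp
  have "\<exists>C\<in>?E. C \<noteq> ?W \<and> (\<forall>g\<in>carrier Q. ?act g C = C)"
    by (rule Q.exists_other_fixed_point[OF prime_p order_Q finE \<open>p dvd card ?E\<close> act_closed
          act_one act_mult W_E fix_W])
  then obtain C where C: "C \<in> ?E" "C \<noteq> ?W" "\<And>g. g \<in> carrier Q \<Longrightarrow> ?act g C = C"
    by blast
  obtain a where a': "a \<in> carrier A" "C = ?W #>\<^bsub>?M\<^esub> a"
    using iffD1[OF E_iff C(1)] by blast
  note a = a'(1) C(2,3)[unfolded a'(2)]
  have "a \<notin> ?W" using a(2) A.add.coset_join2[OF _ upper_subgroup, of a n] a(1) by auto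
  moreover have "a \<in> upper (Suc n)"
  proof -
    have "delta Q g \<otimes>\<^bsub>A\<^esub> a \<ominus>\<^bsub>A\<^esub> a \<in> ?W" if g: "g \<in> carrier Q" for g
    proof -
      have car: "delta Q g \<otimes>\<^bsub>A\<^esub> a \<in> carrier A" using a(1) delta_closed[OF g] by simp
      have "?W #>\<^bsub>?M\<^esub> (delta Q g \<otimes>\<^bsub>A\<^esub> a) = ?W #>\<^bsub>?M\<^esub> a" 
        using a(3)[OF g] unfolding coset[OF g a(1)] .
      then have "delta Q g \<otimes>\<^bsub>A\<^esub> a \<in> ?W #>\<^bsub>?M\<^esub> a"
        using A.add.rcos_self[OF _ upper_subgroup[of n]] car by auto
      then obtain w where "w \<in> ?W" "delta Q g \<otimes>\<^bsub>A\<^esub> a = w \<oplus>\<^bsub>A\<^esub> a" by (auto simp: r_coset_def)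
      then show ?thesis using a(1) upper_closed by (simp add: A.minus_eq A.a_assoc A.r_neg)
    qed
    then show ?thesis using a(1) by simp
  qed
  ultimately show ?thesis using sub by blast
qed

lemma upper_exhausts: "\<exists>m. upper m = carrier A"
proof (rule ccontr)
  assume neq: "\<not> ?thesis"
  have fin: "finite (upper n)" for n
    using finite_carrier_A upper_closed by (metis finite_subset subsetI)
  have "card (upper n) \<ge> n" for n
  proof (induction n)
    case (Suc n)
    have "card (upper n) < card (upper (Suc n))"
      using upper_strict[of n] neq fin[of "Suc n"] by (intro psubset_card_mono) auto
    then show ?case using Suc by simp
  qed simp
  then have "card (upper (Suc (card (carrier A)))) \<ge> Suc (card (carrier A))" .
  moreover have "card (upper (Suc (card (carrier A)))) \<le> card (carrier A)"
    by (rule card_mono[OF finite_carrier_A]) (auto dest: upper_closed)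
  ultimately show False by simp
qed

lemma upper_combination:
  assumes "finite B" "\<And>g. g \<in> B \<Longrightarrow> u g \<in> upper n"
  shows "finsum A (\<lambda>g. zmul A (c g) (u g)) B \<in> upper n"
  using assms
proof (induction B rule: finite_induct)
  case empty then show ?case using upper_zero by simp
next
  case (insert g B)
  interpret W: subgroup "upper n" "add_monoid A" by (rule upper_subgroup)
  have z: "zmul A (c h) (u h) \<in> upper n" if "h \<in> insert g B" for h
    using A.add.subgroup_int_pow_closed[OF upper_subgroup[of n]] insert.prems that by auto
  then have "(\<lambda>g. zmul A (c g) (u g)) \<in> B \<rightarrow> carrier A" "zmul A (c g) (u g) \<in> carrier A"
    using upper_closed by blast+
  then show ?case using insert W.m_closed z by simp
qed

lemma mult_upper:
  assumes f: "f \<in> carrier A" and a: "a \<in> upper n"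
  shows "f \<otimes>\<^bsub>A\<^esub> a \<in> upper n"
proof -
  have car: "a \<in> carrier A" using a by (rule upper_closed)
  have "f \<otimes>\<^bsub>A\<^esub> a = finsum A (\<lambda>g. zmul A (f g) (delta Q g)) (carrier Q) \<otimes>\<^bsub>A\<^esub> a"
    using eq_sum_delta[OF f] by simp
  also have "\<dots> = finsum A (\<lambda>g. zmul A (f g) (delta Q g) \<otimes>\<^bsub>A\<^esub> a) (carrier Q)"
    by (rule A.finsum_ldistr) (auto simp: finite_Q delta_closed car)
  also have "\<dots> = finsum A (\<lambda>g. zmul A (f g) (delta Q g \<otimes>\<^bsub>A\<^esub> a)) (carrier Q)"
    by (rule A.finsum_cong') (auto simp: delta_closed car A.add_pow_ldistr_int)
  also have "\<dots> \<in> upper n"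
    by (rule upper_combination[OF finite_Q]) (use a upper_stable in auto)
  finally show ?thesis .
qed

lemma aug_ideal_mult_upper:
  assumes f: "f \<in> aug_ideal p Q" and a: "a \<in> upper (Suc n)"
  shows "f \<otimes>\<^bsub>A\<^esub> a \<in> upper n"
proof -
  have car: "a \<in> carrier A" using a by simp
  have "f \<otimes>\<^bsub>A\<^esub> a = finsum A (\<lambda>g. zmul A (f g) (delta Q g \<ominus>\<^bsub>A\<^esub> \<one>\<^bsub>A\<^esub>)) (carrier Q) \<otimes>\<^bsub>A\<^esub> a"
    using aug_ideal_eq_sum[OF f] by simp
  also have "\<dots> = finsum A (\<lambda>g. zmul A (f g) (delta Q g \<ominus>\<^bsub>A\<^esub> \<one>\<^bsub>A\<^esub>) \<otimes>\<^bsub>A\<^esub> a) (carrier Q)"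
    by (rule A.finsum_ldistr) (auto simp: finite_Q delta_closed car)
  also have "\<dots> = finsum A (\<lambda>g. zmul A (f g) (delta Q g \<otimes>\<^bsub>A\<^esub> a \<ominus>\<^bsub>A\<^esub> a)) (carrier Q)"
    by (rule A.finsum_cong')
      (auto simp: delta_closed car A.add_pow_ldistr_int A.minus_eq A.l_distr A.l_minus)
  also have "\<dots> \<in> upper n"
    by (rule upper_combination[OF finite_Q]) (use a in auto)
  finally show ?thesis .
qed

lemma aug_ideal_power_mult_upper:
  "f \<in> ideal_power A (aug_ideal p Q) j \<Longrightarrow> a \<in> upper (j + n) \<Longrightarrow> f \<otimes>\<^bsub>A\<^esub> a \<in> upper n"
proof (induction j arbitrary: f a n)
  case 0 then show ?case using mult_upper by simp
next
  case (Suc j)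
  interpret W: subgroup "upper n" "add_monoid A" by (rule upper_subgroup)
  have a: "a \<in> carrier A" using upper_closed[OF Suc.prems(2)] .
  note I = aug_ideal_ideal
  have "f \<in> ideal_prod A (ideal_power A (aug_ideal p Q) j) (aug_ideal p Q)" using Suc.prems(1) by simp
  then have "f \<in> carrier A \<and> f \<otimes>\<^bsub>A\<^esub> a \<in> upper n"
  proof (induction f rule: ideal_prod.induct)
    case (prod i i')
    have car: "i \<in> carrier A" "i' \<in> carrier A"
      using A.ideal_power_closed[OF I prod(1)] ideal.Icarr[OF I prod(2)] by auto
    have "i' \<otimes>\<^bsub>A\<^esub> a \<in> upper (j + n)" using aug_ideal_mult_upper[OF prod(2)] Suc.prems(2) by simp
    then have "i \<otimes>\<^bsub>A\<^esub> (i' \<otimes>\<^bsub>A\<^esub> a) \<in> upper n" using Suc.IH[OF prod(1)] by blast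
    then show ?case using car a by (auto simp: A.m_assoc)
  next
    case (sum s1 s2)
    then show ?case using a W.m_closed by (auto simp: A.l_distr)
  qed
  then show ?case by simp
qed

theorem aug_ideal_nilpotent: "\<exists>m. \<forall>f\<in>ideal_power A (aug_ideal p Q) m. f = \<zero>\<^bsub>A\<^esub>"
proof -
  obtain m where m: "upper m = carrier A" using upper_exhausts by blast
  have "f = \<zero>\<^bsub>A\<^esub>" if "f \<in> ideal_power A (aug_ideal p Q) m" for f
    using aug_ideal_power_mult_upper[OF that, of "\<one>\<^bsub>A\<^esub>" 0] m
      A.ideal_power_closed[OF aug_ideal_ideal that] by simp
  then show ?thesis by blast
qed

end

section \<open>Push-forward along homomorphisms\<close>

locale group_algebra_hom = Dom: finite_group_algebra Q p + Cod: finite_group_algebra Q' p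
  for Q :: "('q, 'b) monoid_scheme" and p and Q' :: "('s, 'd) monoid_scheme" +
  fixes \<phi>
  assumes hom: "\<phi> \<in> hom Q Q'"
begin

abbreviation push where "push \<equiv> group_algebra_map (Fp p) Q Q' \<phi>"

lemma push_eq:
  assumes "f \<in> carrier Dom.A"
  shows "push f = (\<lambda>c\<in>carrier Q'. (\<Sum>x\<in>{x \<in> carrier Q. \<phi> x = c}. f x) mod int p)"
proof -
  have "finsum (Fp p) f {x \<in> carrier Q. \<phi> x = c} = (\<Sum>x\<in>{x \<in> carrier Q. \<phi> x = c}. f x) mod int p" for c
    using assms
    by (intro finsum_residue_ring Dom.p_gt_1) (auto simp: Dom.finite_Q Dom.carrier_A_iff)
  then show ?thesis by (simp add: group_algebra_map_def)
qed

lemma push_closed: "f \<in> carrier Dom.A \<Longrightarrow> push f \<in> carrier Cod.A"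
  using Dom.p_gt_1 by (auto simp: Cod.carrier_A_iff push_eq)

lemma pairing_push:
  assumes f: "f \<in> carrier Dom.A"
  shows "[pairing Q' (push f) t = pairing Q f (\<lambda>x. t (\<phi> x))] (mod int p)"
proof -
  have "[pairing Q' (push f) t
      = (\<Sum>c\<in>carrier Q'. (\<Sum>x\<in>{x \<in> carrier Q. \<phi> x = c}. f x) * t c)] (mod int p)"
    unfolding pairing_def push_eq[OF f]
    by (intro cong_sum cong_mult cong_refl) (simp add: unique_euclidean_semiring_class.cong_def)
  also have "(\<Sum>c\<in>carrier Q'. (\<Sum>x\<in>{x \<in> carrier Q. \<phi> x = c}. f x) * t c)
      = (\<Sum>c\<in>carrier Q'. \<Sum>x\<in>{x \<in> carrier Q. \<phi> x = c}. f x * t (\<phi> x))"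
    by (auto simp: sum_distrib_right intro!: sum.cong)
  also have "\<dots> = (\<Sum>x\<in>carrier Q. f x * t (\<phi> x))"
    by (rule sum.group) (use hom in \<open>auto simp: Dom.finite_Q Cod.finite_Q hom_def\<close>)
  finally show ?thesis by (simp add: pairing_def)
qed

lemma push_ring_hom: "push \<in> ring_hom Dom.A Cod.A"
proof (rule ring_hom_memI)
  fix f h assume f: "f \<in> carrier Dom.A" "h \<in> carrier Dom.A"
  show "push (f \<otimes>\<^bsub>Dom.A\<^esub> h) = push f \<otimes>\<^bsub>Cod.A\<^esub> push h"
  proof (rule Cod.A_eqI)
    fix t
    let ?m = "pairing Q f (\<lambda>y. pairing Q h (\<lambda>z. t (\<phi> y \<otimes>\<^bsub>Q'\<^esub> \<phi> z)))"
    have "[pairing Q' (push (f \<otimes>\<^bsub>Dom.A\<^esub> h)) t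
        = pairing Q f (\<lambda>y. pairing Q h (\<lambda>z. t (\<phi> (y \<otimes>\<^bsub>Q\<^esub> z))))] (mod int p)"
      using f by (rule cong_trans[OF pairing_push[OF Dom.A.m_closed] Dom.pairing_mult])
    also have "pairing Q f (\<lambda>y. pairing Q h (\<lambda>z. t (\<phi> (y \<otimes>\<^bsub>Q\<^esub> z)))) = ?m"
      unfolding pairing_def using hom by (auto simp: hom_mult intro!: sum.cong)
    finally have 1: "[pairing Q' (push (f \<otimes>\<^bsub>Dom.A\<^esub> h)) t = ?m] (mod int p)" .
    have "[pairing Q' (push f) (\<lambda>y. pairing Q' (push h) (\<lambda>z. t (y \<otimes>\<^bsub>Q'\<^esub> z))) = ?m] (mod int p)"
      by (rule cong_trans[OF pairing_push[OF f(1)]]) (intro pairing_cong pairing_push f)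
    then have 2: "[pairing Q' (push f \<otimes>\<^bsub>Cod.A\<^esub> push h) t = ?m] (mod int p)"
      unfolding Cod.pairing_mult2 .
    show "[pairing Q' (push (f \<otimes>\<^bsub>Dom.A\<^esub> h)) t = pairing Q' (push f \<otimes>\<^bsub>Cod.A\<^esub> push h) t] (mod int p)"
      by (rule cong_trans[OF 1 cong_sym[OF 2]])
  qed (use f in \<open>auto simp: push_closed\<close>)
  show "push (f \<oplus>\<^bsub>Dom.A\<^esub> h) = push f \<oplus>\<^bsub>Cod.A\<^esub> push h"
  proof (rule Cod.A_eqI)
    fix t
    have 1: "[pairing Q' (push (f \<oplus>\<^bsub>Dom.A\<^esub> h)) t
        = pairing Q f (\<lambda>x. t (\<phi> x)) + pairing Q h (\<lambda>x. t (\<phi> x))] (mod int p)"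
      using f by (rule cong_trans[OF pairing_push[OF Dom.A.a_closed] Dom.pairing_add])
    have 2: "[pairing Q' (push f \<oplus>\<^bsub>Cod.A\<^esub> push h) t
        = pairing Q f (\<lambda>x. t (\<phi> x)) + pairing Q h (\<lambda>x. t (\<phi> x))] (mod int p)"
      by (rule cong_trans[OF Cod.pairing_add cong_add]) (intro pairing_push f)+
    show "[pairing Q' (push (f \<oplus>\<^bsub>Dom.A\<^esub> h)) t = pairing Q' (push f \<oplus>\<^bsub>Cod.A\<^esub> push h) t] (mod int p)"
      by (rule cong_trans[OF 1 cong_sym[OF 2]])
  qed (use f in \<open>auto simp: push_closed\<close>)
next
  show "push \<one>\<^bsub>Dom.A\<^esub> = \<one>\<^bsub>Cod.A\<^esub>"
  proof (rule Cod.A_eqI)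
    fix t
    have "\<phi> \<one>\<^bsub>Q\<^esub> = \<one>\<^bsub>Q'\<^esub>" by (rule hom_one[OF hom Dom.Q.is_group Cod.Q.is_group])
    then show "[pairing Q' (push \<one>\<^bsub>Dom.A\<^esub>) t = pairing Q' \<one>\<^bsub>Cod.A\<^esub> t] (mod int p)"
      using pairing_push[OF Dom.A.one_closed, of t]
      by (simp add: Dom.A_one Cod.A_one Dom.pairing_delta Cod.pairing_delta)
  qed (auto simp: push_closed)
qed (rule push_closed)

lemma push_delta: "g \<in> carrier Q \<Longrightarrow> push (delta Q g) = delta Q' (\<phi> g)"
proof (rule Cod.A_eqI)
  fix t assume g: "g \<in> carrier Q"
  then have "\<phi> g \<in> carrier Q'" using hom by (auto simp: hom_def)
  then show "[pairing Q' (push (delta Q g)) t = pairing Q' (delta Q' (\<phi> g)) t] (mod int p)"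
    using pairing_push[OF Dom.delta_closed[OF g], of t] g
    by (simp add: Dom.pairing_delta Cod.pairing_delta)
qed (use hom in \<open>auto simp: push_closed Dom.delta_closed hom_def intro!: Cod.delta_closed\<close>)

lemma push_aug_ideal: "f \<in> aug_ideal p Q \<Longrightarrow> push f \<in> aug_ideal p Q'"
  using pairing_push[of f "\<lambda>_. 1"] push_closed[of f] cong_dvd_iff
  unfolding Dom.pairing_one_right Cod.pairing_one_right aug_ideal_def by blast

end

section \<open>Compactness: lifting solutions to an inverse limit\<close>

text \<open>The compatible families form an intersection of closed subsets of a compact product. Finitely
  many compatibility conditions involve finitely many levels and are satisfied by the images of one
  element of a common lower level.\<close>

lemma inverse_limit_nonempty:
  fixes S :: "'i set \<Rightarrow> 'c set"
  assumes directed: "\<NN> \<noteq> {}" "\<And>N M. N \<in> \<NN> \<Longrightarrow> M \<in> \<NN> \<Longrightarrow> N \<inter> M \<in> \<NN>"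
    and fin: "\<And>N. N \<in> \<NN> \<Longrightarrow> finite (S N)"
    and nonempty: "\<And>N. N \<in> \<NN> \<Longrightarrow> S N \<noteq> {}"
    and tr: "\<And>N M s. N \<in> \<NN> \<Longrightarrow> M \<in> \<NN> \<Longrightarrow> N \<subseteq> M \<Longrightarrow> s \<in> S N \<Longrightarrow> tr N M s \<in> S M"
    and tr_tr: "\<And>L N M s. L \<in> \<NN> \<Longrightarrow> N \<in> \<NN> \<Longrightarrow> M \<in> \<NN> \<Longrightarrow> L \<subseteq> N \<Longrightarrow> N \<subseteq> M \<Longrightarrow> s \<in> S L \<Longrightarrow>
      tr N M (tr L N s) = tr L M s"
  shows "\<exists>s. \<forall>N\<in>\<NN>. s N \<in> S N \<and> (\<forall>M\<in>\<NN>. N \<subseteq> M \<longrightarrow> tr N M (s N) = s M)"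
proof -
  let ?T = "product_topology (\<lambda>N. discrete_topology (S N)) \<NN>"
  let ?P = "{(N, M). N \<in> \<NN> \<and> M \<in> \<NN> \<and> N \<subseteq> M}"
  let ?C = "\<lambda>(N, M). {s \<in> topspace ?T. tr N M (s N) = s M}"
  have compact: "compact_space ?T"
    by (auto simp: compact_space_product_topology compact_space_discrete_topology fin)
  have closed: "closedin ?T (?C P)" if P: "P \<in> ?P" for P
  proof -
    obtain N M where NM: "P = (N, M)" "N \<in> \<NN>" "M \<in> \<NN>" "N \<subseteq> M" using P by auto
    have point: "closedin ?T {s \<in> topspace ?T. s L = a}" if L: "L \<in> \<NN>" for L a
    proof -
      have "continuous_map ?T (discrete_topology (S L)) (\<lambda>s. s L)"
        using continuous_map_product_projection[OF L] .
      moreover have "closedin (discrete_topology (S L)) ({a} \<inter> S L)" by simp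
      ultimately have "closedin ?T {s \<in> topspace ?T. s L \<in> {a} \<inter> S L}"
        by (rule closedin_continuous_map_preimage)
      moreover have "{s \<in> topspace ?T. s L \<in> {a} \<inter> S L} = {s \<in> topspace ?T. s L = a}"
        using L by (auto simp: PiE_def)
      ultimately show ?thesis by simp
    qed
    have "?C P = (\<Union>a\<in>S N. {s \<in> topspace ?T. s N = a} \<inter> {s \<in> topspace ?T. s M = tr N M a})"
      using NM by (auto simp: PiE_def)
    also have "closedin ?T \<dots>"
      by (rule closedin_Union)
        (use fin NM in \<open>auto simp del: topspace_product_topology intro!: closedin_Int point\<close>)
    finally show ?thesis .
  qed
  have fip: "\<Inter> \<F> \<noteq> {}" if \<F>: "finite \<F>" "\<F> \<subseteq> ?C ` ?P \<union> {topspace ?T}" for \<F>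
  proof -
    obtain F where F: "finite F" "F \<subseteq> ?P" "\<F> \<subseteq> ?C ` F \<union> {topspace ?T}"
    proof -
      have "finite (\<F> - {topspace ?T})" "\<F> - {topspace ?T} \<subseteq> ?C ` ?P" using \<F> by auto
      then obtain F where "F \<subseteq> ?P" "finite F" "\<F> - {topspace ?T} = ?C ` F"
        using finite_subset_image by (metis (no_types, lifting))
      then show thesis using that[of F] by blast
    qed
    have "\<exists>L\<in>\<NN>. \<forall>P\<in>F. L \<subseteq> fst P"
      using F(1,2)
    proof (induction F rule: finite_induct)
      case empty then show ?case using directed(1) by auto
    next
      case (insert P F)
      then obtain L where "L \<in> \<NN>" "\<forall>P\<in>F. L \<subseteq> fst P" by auto
      moreover have "fst P \<in> \<NN>" using insert.prems by auto
      ultimately show ?case using directed(2) by (intro bexI[of _ "L \<inter> fst P"]) auto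
    qed
    then obtain L where L: "L \<in> \<NN>" "\<And>P. P \<in> F \<Longrightarrow> L \<subseteq> fst P" by blast
    obtain t where t: "t \<in> S L" using nonempty[OF L(1)] by blast
    let ?s = "\<lambda>N\<in>\<NN>. if L \<subseteq> N then tr L N t else (SOME u. u \<in> S N)"
    have some: "(SOME u. u \<in> S N) \<in> S N" if "N \<in> \<NN>" for N
      using nonempty[OF that] by (simp add: some_in_eq)
    have top: "?s \<in> topspace ?T"
      using tr[OF L(1) _ _ t] some by auto
    have "?s \<in> ?C P" if P: "P \<in> F" for P
    proof -
      obtain N M where NM: "P = (N, M)" "N \<in> \<NN>" "M \<in> \<NN>" "N \<subseteq> M" using P F(2) by auto
      moreover have "L \<subseteq> N" "L \<subseteq> M" using L(2)[OF P] NM by auto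
      ultimately show ?thesis using top tr_tr[OF L(1) NM(2,3) _ NM(4) t] by auto
    qed
    then have "?s \<in> \<Inter> \<F>" using F(3) top by blast
    then show ?thesis by blast
  qed
  define \<U> where "\<U> = ?C ` ?P \<union> {topspace ?T}"
  have closed': "closedin ?T D" if "D \<in> \<U>" for D
    using that closed closedin_topspace unfolding \<U>_def by blast
  have "(\<forall>D\<in>\<U>. closedin ?T D) \<and> (\<forall>\<F>. finite \<F> \<and> \<F> \<subseteq> \<U> \<longrightarrow> \<Inter> \<F> \<noteq> {}) \<longrightarrow> \<Inter> \<U> \<noteq> {}"
    using compact unfolding compact_space_fip by (rule spec)
  then have "\<Inter> \<U> \<noteq> {}"
  proof (rule mp, intro conjI ballI allI impI)
    fix \<F> assume "finite \<F> \<and> \<F> \<subseteq> \<U>"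
    then show "\<Inter> \<F> \<noteq> {}" using fip[folded \<U>_def, of \<F>] by (elim conjE)
  qed (rule closed')
  then have "\<Inter> (?C ` ?P \<union> {topspace ?T}) \<noteq> {}" unfolding \<U>_def .
  then obtain s where s: "s \<in> \<Inter> (?C ` ?P \<union> {topspace ?T})" by blast
  have "s N \<in> S N" if "N \<in> \<NN>" for N using s that by (auto simp: PiE_def)
  moreover have "tr N M (s N) = s M" if "N \<in> \<NN>" "M \<in> \<NN>" "N \<subseteq> M" for N M
  proof -
    have "s \<in> ?C (N, M)" using s that by blast
    then show ?thesis by simp
  qed
  ultimately show ?thesis by blast
qed

section \<open>Left ideals generated by a finite family\<close>

context ring_family
begin

abbreviation left_comb :: "(nat \<Rightarrow> 'a) \<Rightarrow> 'a"
  where "left_comb b \<equiv> finsum R (\<lambda>i. b i \<otimes> x i) {..<k}"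

definition left_span :: "'a set"
  where "left_span = {left_comb b |b. \<forall>i<k. b i \<in> carrier R}"

lemma left_span_closed: "a \<in> left_span \<Longrightarrow> a \<in> carrier R"
  by (auto simp: left_span_def intro!: finsum_closed family_closed)

lemma left_comb_add:
  assumes "\<And>i. i < k \<Longrightarrow> b i \<in> carrier R" "\<And>i. i < k \<Longrightarrow> b' i \<in> carrier R"
  shows "left_comb (\<lambda>i. b i \<oplus> b' i) = left_comb b \<oplus> left_comb b'"
proof -
  have "left_comb (\<lambda>i. b i \<oplus> b' i) = finsum R (\<lambda>i. b i \<otimes> x i \<oplus> b' i \<otimes> x i) {..<k}"
    by (rule finsum_cong') (auto simp: assms family_closed l_distr)
  also have "\<dots> = left_comb b \<oplus> left_comb b'"
    by (rule finsum_addf) (auto simp: assms family_closed)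
  finally show ?thesis .
qed

lemma left_comb_mult:
  assumes "a \<in> carrier R" "\<And>i. i < k \<Longrightarrow> b i \<in> carrier R"
  shows "left_comb (\<lambda>i. a \<otimes> b i) = a \<otimes> left_comb b"
proof -
  have "a \<otimes> left_comb b = finsum R (\<lambda>i. a \<otimes> (b i \<otimes> x i)) {..<k}"
    by (rule finsum_rdistr) (auto simp: assms family_closed)
  also have "\<dots> = left_comb (\<lambda>i. a \<otimes> b i)"
    by (rule finsum_cong') (auto simp: assms family_closed m_assoc)
  finally show ?thesis by simp
qed

lemma left_span_add: "a \<in> left_span \<Longrightarrow> a' \<in> left_span \<Longrightarrow> a \<oplus> a' \<in> left_span"
  unfolding left_span_def
proof clarify
  fix b b' assume b: "\<forall>i<k. b i \<in> carrier R" "\<forall>i<k. b' i \<in> carrier R"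
  then show "\<exists>c. left_comb b \<oplus> left_comb b' = left_comb c \<and> (\<forall>i<k. c i \<in> carrier R)"
    by (intro exI[of _ "\<lambda>i. b i \<oplus> b' i"]) (auto simp: left_comb_add)
qed

lemma left_span_mult: "c \<in> carrier R \<Longrightarrow> a \<in> left_span \<Longrightarrow> c \<otimes> a \<in> left_span"
  unfolding left_span_def
proof clarify
  fix b assume b: "c \<in> carrier R" "\<forall>i<k. b i \<in> carrier R"
  then show "\<exists>b'. c \<otimes> left_comb b = left_comb b' \<and> (\<forall>i<k. b' i \<in> carrier R)"
    by (intro exI[of _ "\<lambda>i. c \<otimes> b i"]) (auto simp: left_comb_mult)
qed

lemma left_span_zero: "\<zero> \<in> left_span"
proof -
  have "left_comb (\<lambda>_. \<zero>) = finsum R (\<lambda>i. \<zero>) {..<k}"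
    by (rule finsum_cong') (auto simp: family_closed)
  then have "\<zero> = left_comb (\<lambda>_. \<zero>)" by simp
  then show ?thesis unfolding left_span_def by (intro CollectI exI[of _ "\<lambda>_. \<zero>"] conjI) auto
qed

lemma left_span_minus: "a \<in> left_span \<Longrightarrow> \<ominus> a \<in> left_span"
  using left_span_mult[of "\<ominus> \<one>" a] left_span_closed[of a] by (simp add: l_minus)

lemma left_span_base: "i < k \<Longrightarrow> x i \<in> left_span"
proof -
  assume i: "i < k"
  have "left_comb (\<lambda>j. if i = j then \<one> else \<zero>) = finsum R (\<lambda>j. if i = j then x i else \<zero>) {..<k}"
    by (rule finsum_cong') (auto simp: family_closed)
  also have "\<dots> = x i" by (rule finsum_single) (auto simp: i family_closed)
  finally have "x i = left_comb (\<lambda>j. if i = j then \<one> else \<zero>)" by simp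
  then show ?thesis
    unfolding left_span_def
    by (intro CollectI exI[of _ "\<lambda>j. if i = j then \<one> else \<zero>"] conjI) auto
qed

lemma left_span_finsum:
  assumes "finite B" "\<And>i. i \<in> B \<Longrightarrow> f i \<in> left_span"
  shows "finsum R f B \<in> left_span"
  using assms
proof (induction B rule: finite_induct)
  case empty then show ?case using left_span_zero by simp
next
  case (insert i B)
  have "f \<in> B \<rightarrow> carrier R" "f i \<in> carrier R" using insert.prems left_span_closed by blast+
  then show ?case using insert left_span_add by simp
qed

lemma left_span_zmul: "a \<in> left_span \<Longrightarrow> zmul R m a \<in> left_span"
  using left_span_mult[of "zmul R m \<one>" a] left_span_closed[of a] int_smult_eq_mult_one[of a m] by simp

text \<open>As the powers are two-sided ideals, the left coefficients of a product of \<open>i\<close> in the \<open>n\<close>-th power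
  with a left combination can be multiplied by \<open>i\<close> without leaving that power.\<close>

lemma ideal_power_Suc_left_comb:
  assumes I: "ideal I R" and gen: "I \<subseteq> left_span" and y: "y \<in> ideal_power R I (Suc n)"
  shows "\<exists>b. (\<forall>i<k. b i \<in> ideal_power R I n) \<and> y = left_comb b"
proof -
  have "y \<in> ideal_prod R (ideal_power R I n) I" using y by simp
  then show ?thesis
  proof (induction y rule: ideal_prod.induct)
    case (prod i j)
    obtain b where b: "\<forall>i<k. b i \<in> carrier R" "j = left_comb b"
      using gen prod(2) by (auto simp: left_span_def)
    have "i \<otimes> b l \<in> ideal_power R I n" if "l < k" for l
      using ideal.I_r_closed[OF ideal_power_ideal[OF I] prod(1)] b(1) that by blast
    moreover have "i \<otimes> j = left_comb (\<lambda>l. i \<otimes> b l)"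
      using b left_comb_mult ideal_power_closed[OF I prod(1)] by simp
    ultimately show ?case by (intro exI[of _ "\<lambda>l. i \<otimes> b l"] conjI) auto
  next
    case (sum s1 s2)
    then obtain b b' where b: "\<forall>i<k. b i \<in> ideal_power R I n" "s1 = left_comb b"
      "\<forall>i<k. b' i \<in> ideal_power R I n" "s2 = left_comb b'" by blast
    then have "s1 \<oplus> s2 = left_comb (\<lambda>i. b i \<oplus> b' i)"
      by (simp only:) (rule left_comb_add[symmetric]; use b ideal_power_closed[OF I] in blast)
    moreover have "\<forall>i<k. b i \<oplus> b' i \<in> ideal_power R I n"
      using b ideal_add[OF ideal_power_ideal[OF I]] by blast
    ultimately show ?case by (intro exI[of _ "\<lambda>i. b i \<oplus> b' i"] conjI)
  qed
qed

end

lemma (in ring_hom_ring) hom_left_comb: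
  assumes "\<And>i. i < k \<Longrightarrow> b i \<in> carrier R" "\<And>i. i < k \<Longrightarrow> x i \<in> carrier R"
  shows "h (finsum R (\<lambda>i. b i \<otimes>\<^bsub>R\<^esub> x i) {..<k}) = finsum S (\<lambda>i. h (b i) \<otimes>\<^bsub>S\<^esub> h (x i)) {..<k}"
proof -
  have "h (finsum R (\<lambda>i. b i \<otimes>\<^bsub>R\<^esub> x i) {..<k}) = finsum S (\<lambda>i. h (b i \<otimes>\<^bsub>R\<^esub> x i)) {..<k}"
    by (rule hom_finsum') (use assms in auto)
  also have "\<dots> = finsum S (\<lambda>i. h (b i) \<otimes>\<^bsub>S\<^esub> h (x i)) {..<k}"
    by (rule S.finsum_cong') (use assms in auto)
  finally show ?thesis .
qed

section \<open>Quotients of a pro-p group\<close>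

lemma (in group) coset_mult_normal:
  assumes N: "N \<lhd> G" and M: "M \<lhd> G" and "N \<subseteq> M" and g: "g \<in> carrier G"
  shows "(N #> g) <#> M = M #> g"
proof
  interpret M: normal M G by (rule M)
  interpret N: normal N G by (rule N)
  show "(N #> g) <#> M \<subseteq> M #> g"
  proof
    fix u assume "u \<in> (N #> g) <#> M"
    then obtain n m where nm: "n \<in> N" "m \<in> M" "u = n \<otimes> g \<otimes> m"
      by (auto simp: set_mult_def r_coset_def)
    have car: "n \<in> carrier G" "m \<in> carrier G" using nm by auto
    have "n \<otimes> (g \<otimes> m \<otimes> inv g) \<in> M"
      using nm M.inv_op_closed2[OF g] \<open>N \<subseteq> M\<close> M.m_closed by blast
    moreover have "u = n \<otimes> (g \<otimes> m \<otimes> inv g) \<otimes> g" using nm car g by (simp add: m_assoc)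
    ultimately show "u \<in> M #> g" by (auto simp: r_coset_def)
  qed
  show "M #> g \<subseteq> (N #> g) <#> M"
  proof
    fix u assume "u \<in> M #> g"
    then obtain m where m: "m \<in> M" "u = m \<otimes> g" by (auto simp: r_coset_def)
    have car: "m \<in> carrier G" using m by auto
    have "inv g \<otimes> m \<otimes> g \<in> M" using M.inv_op_closed1[OF g m(1)] .
    moreover have "u = \<one> \<otimes> g \<otimes> (inv g \<otimes> m \<otimes> g)"
      using m car g by (simp add: m_assoc[symmetric])
    ultimately show "u \<in> (N #> g) <#> M"
      using N.one_closed unfolding set_mult_def r_coset_def by blast
  qed
qed

locale pro_p = group G for G :: "('a, 'b) monoid_scheme" (structure) +
  fixes p :: nat and T :: "'a topology"
  assumes prime_p: "Factorial_Ring.prime p" and pro_p: "pro_p_group p G T"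
begin

abbreviation ons where "ons \<equiv> open_normal_subgroups G T"

lemma topological_group: "topological_group G T"
  and compact: "compact_space T" and Hausdorff: "Hausdorff_space T"
  using pro_p by (auto simp: pro_p_group_def profinite_group_def)

lemma topspace_T [simp]: "topspace T = carrier G"
  using topological_group by (auto simp: topological_group_def)

lemma onsD: "N \<in> ons \<Longrightarrow> N \<lhd> G" "N \<in> ons \<Longrightarrow> openin T N"
  by (auto simp: open_normal_subgroups_def)

lemma ons_subgroup: "N \<in> ons \<Longrightarrow> subgroup N G"
  using onsD(1) normal_imp_subgroup by blast

lemma continuous_mult_right: "a \<in> carrier G \<Longrightarrow> continuous_map T T (\<lambda>x. x \<otimes> a)"
proof -
  assume a: "a \<in> carrier G"
  have "continuous_map T (prod_topology T T) (\<lambda>x. (x, a))"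
    using a by (intro continuous_map_pairedI) auto
  then have "continuous_map T T ((\<lambda>(x, y). x \<otimes> y) \<circ> (\<lambda>x. (x, a)))"
    using topological_group unfolding topological_group_def by (intro continuous_map_compose) auto
  then show ?thesis by (simp add: o_def)
qed

lemma continuous_mult_left: "a \<in> carrier G \<Longrightarrow> continuous_map T T (\<lambda>x. a \<otimes> x)"
proof -
  assume a: "a \<in> carrier G"
  have "continuous_map T (prod_topology T T) (\<lambda>x. (a, x))"
    using a by (intro continuous_map_pairedI) auto
  then have "continuous_map T T ((\<lambda>(x, y). x \<otimes> y) \<circ> (\<lambda>x. (a, x)))"
    using topological_group unfolding topological_group_def by (intro continuous_map_compose) auto
  then show ?thesis by (simp add: o_def)
qed

lemma openin_coset:
  assumes "openin T U" "g \<in> carrier G"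
  shows "openin T (U #> g)"
proof -
  have sub: "U \<subseteq> carrier G" using openin_subset[OF assms(1)] by simp
  have "openin T {x \<in> topspace T. x \<otimes> inv g \<in> U}"
    using continuous_mult_right[of "inv g"] assms openin_continuous_map_preimage by blast
  moreover have "{x \<in> topspace T. x \<otimes> inv g \<in> U} = U #> g"
  proof
    show "{x \<in> topspace T. x \<otimes> inv g \<in> U} \<subseteq> U #> g"
      using assms(2) by (force simp: r_coset_def m_assoc)
    show "U #> g \<subseteq> {x \<in> topspace T. x \<otimes> inv g \<in> U}"
      using assms(2) sub by (auto simp: r_coset_def m_assoc)
  qed
  ultimately show ?thesis by simp
qed

lemma carrier_ons: "carrier G \<in> ons"
  using normal_invI[of "carrier G"] subgroup_self openin_topspace[of T]
  by (auto simp: open_normal_subgroups_def)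

lemma Int_ons: "N \<in> ons \<Longrightarrow> M \<in> ons \<Longrightarrow> N \<inter> M \<in> ons"
proof -
  assume NM: "N \<in> ons" "M \<in> ons"
  interpret N: normal N G using NM onsD by auto
  interpret M: normal M G using NM onsD by auto
  have "N \<inter> M \<lhd> G"
  proof (rule normal_invI)
    show "subgroup (N \<inter> M) G" by (rule subgroups_Inter_pair[OF N.is_subgroup M.is_subgroup])
    show "x \<otimes> h \<otimes> inv x \<in> N \<inter> M" if "x \<in> carrier G" "h \<in> N \<inter> M" for x h
      using that N.inv_op_closed2[of x h] M.inv_op_closed2[of x h] by simp
  qed
  then show ?thesis
    using openin_Int[OF onsD(2)[OF NM(1)] onsD(2)[OF NM(2)]]
    by (simp add: open_normal_subgroups_def)
qed

lemma finite_Inter_ons: "finite F \<Longrightarrow> F \<subseteq> ons \<Longrightarrow> \<exists>L\<in>ons. \<forall>N\<in>F. L \<subseteq> N"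
proof (induction F rule: finite_induct)
  case empty then show ?case using carrier_ons by auto
next
  case (insert N F)
  then obtain L where "L \<in> ons" "\<forall>N\<in>F. L \<subseteq> N" by auto
  then show ?case using Int_ons[of L N] insert.prems by (intro bexI[of _ "L \<inter> N"]) auto
qed

lemma quotient_p_group_algebra:
  assumes "N \<in> ons"
  shows "\<exists>k. p_group_algebra (G Mod N) p k"
proof -
  obtain k where k: "card (rcosets N) = p ^ k"
    using pro_p assms by (auto simp: pro_p_group_def)
  have "finite (carrier (G Mod N))"
    using k prime_gt_0_nat[OF prime_p] by (intro card_ge_0_finite) (simp add: FactGroup_def)
  then have "p_group_algebra (G Mod N) p k"
    by (intro p_group_algebra.intro finite_group_algebra.intro finite_group_algebra_axioms.intro
        p_group_algebra_axioms.intro normal.factorgroup_is_group onsD assms prime_p)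
      (use k in \<open>simp_all add: FactGroup_def\<close>)
  then show ?thesis by blast
qed

lemma quotient_group_algebra: "N \<in> ons \<Longrightarrow> finite_group_algebra (G Mod N) p"
  using quotient_p_group_algebra p_group_algebra.axioms(1) by blast

end

section \<open>The completed group algebra\<close>

context pro_p
begin

abbreviation QA where "QA N \<equiv> group_algebra (Fp p) (G Mod N)"
abbreviation tr where "tr N M \<equiv> group_algebra_map (Fp p) (G Mod N) (G Mod M) (\<lambda>C. C <#>\<^bsub>G\<^esub> M)"
abbreviation CA where "CA \<equiv> completed_group_algebra p G T"
abbreviation CI where "CI \<equiv> augmentation_ideal p G T"
abbreviation QI where "QI N \<equiv> aug_ideal p (G Mod N)"

definition group_element :: "'a \<Rightarrow> 'a completed_element"
  where "group_element g = (\<lambda>N\<in>ons. delta (G Mod N) (N #> g))"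

lemma coset_in_quotient: "g \<in> carrier G \<Longrightarrow> N #> g \<in> carrier (G Mod N)"
  by (auto simp: carrier_FactGroup)

lemma quotient_mult:
  "N \<in> ons \<Longrightarrow> g \<in> carrier G \<Longrightarrow> h \<in> carrier G \<Longrightarrow>
    (N #> g) \<otimes>\<^bsub>G Mod N\<^esub> (N #> h) = N #> (g \<otimes> h)"
  using normal.rcos_sum[OF onsD(1)] by simp

lemma QA_ring: "N \<in> ons \<Longrightarrow> ring (QA N)"
  using finite_group_algebra.ring_A[OF quotient_group_algebra] .

lemma tr_group_algebra_hom:
  assumes "N \<in> ons" "M \<in> ons" "N \<subseteq> M"
  shows "group_algebra_hom (G Mod N) p (G Mod M) (\<lambda>C. C <#>\<^bsub>G\<^esub> M)"
proof -
  note coset = coset_mult_normal[OF onsD(1)[OF assms(1)] onsD(1)[OF assms(2)] assms(3)]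
  have "(\<lambda>C. C <#>\<^bsub>G\<^esub> M) \<in> hom (G Mod N) (G Mod M)"
  proof (rule homI)
    fix C assume "C \<in> carrier (G Mod N)"
    then obtain g where "g \<in> carrier G" "C = N #> g" by (auto simp: carrier_FactGroup)
    then show "C <#> M \<in> carrier (G Mod M)" by (simp add: coset coset_in_quotient)
  next
    fix C D assume "C \<in> carrier (G Mod N)" "D \<in> carrier (G Mod N)"
    then obtain g h where gh: "g \<in> carrier G" "C = N #> g" "h \<in> carrier G" "D = N #> h"
      by (auto simp: carrier_FactGroup)
    have "(C \<otimes>\<^bsub>G Mod N\<^esub> D) <#> M = M #> (g \<otimes> h)"
      unfolding gh(2,4) quotient_mult[OF assms(1) gh(1,3)] using gh by (simp add: coset)
    also have "\<dots> = (C <#> M) \<otimes>\<^bsub>G Mod M\<^esub> (D <#> M)"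
      unfolding gh(2,4) coset[OF gh(1)] coset[OF gh(3)] by (rule quotient_mult[OF assms(2) gh(1,3), symmetric])
    finally show "(C \<otimes>\<^bsub>G Mod N\<^esub> D) <#> M = (C <#> M) \<otimes>\<^bsub>G Mod M\<^esub> (D <#> M)" .
  qed
  then show ?thesis
    by (intro group_algebra_hom.intro group_algebra_hom_axioms.intro quotient_group_algebra assms)
qed

lemma tr_ring_hom_ring:
  "N \<in> ons \<Longrightarrow> M \<in> ons \<Longrightarrow> N \<subseteq> M \<Longrightarrow> ring_hom_ring (QA N) (QA M) (tr N M)"
  by (rule ring_hom_ringI2[OF QA_ring QA_ring group_algebra_hom.push_ring_hom[OF tr_group_algebra_hom]])

lemma tr_closed:
  "N \<in> ons \<Longrightarrow> M \<in> ons \<Longrightarrow> N \<subseteq> M \<Longrightarrow> f \<in> carrier (QA N) \<Longrightarrow> tr N M f \<in> carrier (QA M)"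
  using group_algebra_hom.push_closed[OF tr_group_algebra_hom] .

lemma tr_QI: "N \<in> ons \<Longrightarrow> M \<in> ons \<Longrightarrow> N \<subseteq> M \<Longrightarrow> f \<in> QI N \<Longrightarrow> tr N M f \<in> QI M"
  using group_algebra_hom.push_aug_ideal[OF tr_group_algebra_hom] .

lemma tr_QI_power:
  assumes "N \<in> ons" "M \<in> ons" "N \<subseteq> M" "f \<in> ideal_power (QA N) (QI N) n"
  shows "tr N M f \<in> ideal_power (QA M) (QI M) n"
  using ring_hom_ring.hom_ideal_power[OF tr_ring_hom_ring[OF assms(1-3)]
      finite_group_algebra.aug_ideal_ideal[OF quotient_group_algebra[OF assms(1)]] _ assms(4)]
    tr_QI[OF assms(1-3)] by blast

lemma tr_delta:
  assumes "N \<in> ons" "M \<in> ons" "N \<subseteq> M" "g \<in> carrier G"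
  shows "tr N M (delta (G Mod N) (N #> g)) = delta (G Mod M) (M #> g)"
  using group_algebra_hom.push_delta[OF tr_group_algebra_hom[OF assms(1-3)] coset_in_quotient[OF assms(4)]]
    coset_mult_normal[OF onsD(1)[OF assms(1)] onsD(1)[OF assms(2)] assms(3,4)] by simp

lemma tr_tr:
  assumes "L \<in> ons" "N \<in> ons" "M \<in> ons" "L \<subseteq> N" "N \<subseteq> M" "f \<in> carrier (QA L)"
  shows "tr N M (tr L N f) = tr L M f"
proof -
  have LM: "L \<subseteq> M" using assms by auto
  interpret LN: group_algebra_hom "G Mod L" p "G Mod N" "\<lambda>C. C <#>\<^bsub>G\<^esub> N"
    by (rule tr_group_algebra_hom[OF assms(1,2,4)])
  interpret NM: group_algebra_hom "G Mod N" p "G Mod M" "\<lambda>C. C <#>\<^bsub>G\<^esub> M"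
    by (rule tr_group_algebra_hom[OF assms(2,3,5)])
  interpret LM: group_algebra_hom "G Mod L" p "G Mod M" "\<lambda>C. C <#>\<^bsub>G\<^esub> M"
    by (rule tr_group_algebra_hom[OF assms(1,3) LM])
  have comp: "(C <#>\<^bsub>G\<^esub> N) <#>\<^bsub>G\<^esub> M = C <#>\<^bsub>G\<^esub> M" if C: "C \<in> carrier (G Mod L)" for C
  proof -
    obtain g where g: "g \<in> carrier G" "C = L #> g" using C by (auto simp: carrier_FactGroup)
    then show ?thesis using assms LM by (simp add: coset_mult_normal onsD)
  qed
  show ?thesis
  proof (rule NM.Cod.A_eqI)
    fix t
    have "[pairing (G Mod M) (tr N M (tr L N f)) t
        = pairing (G Mod L) f (\<lambda>C. t ((C <#>\<^bsub>G\<^esub> N) <#>\<^bsub>G\<^esub> M))] (mod int p)"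
      by (rule cong_trans[OF NM.pairing_push[OF LN.push_closed[OF assms(6)]] LN.pairing_push[OF assms(6)]])
    also have "pairing (G Mod L) f (\<lambda>C. t ((C <#>\<^bsub>G\<^esub> N) <#>\<^bsub>G\<^esub> M))
        = pairing (G Mod L) f (\<lambda>C. t (C <#>\<^bsub>G\<^esub> M))"
      unfolding pairing_def by (intro sum.cong refl) (simp add: comp)
    finally show "[pairing (G Mod M) (tr N M (tr L N f)) t = pairing (G Mod M) (tr L M f) t] (mod int p)"
      using LM.pairing_push[OF assms(6), of t] cong_sym cong_trans by blast
  qed (use assms LM in \<open>auto intro!: tr_closed\<close>)
qed

lemma CA_mult: "y \<otimes>\<^bsub>CA\<^esub> z = (\<lambda>N\<in>ons. y N \<otimes>\<^bsub>QA N\<^esub> z N)"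
  and CA_add: "y \<oplus>\<^bsub>CA\<^esub> z = (\<lambda>N\<in>ons. y N \<oplus>\<^bsub>QA N\<^esub> z N)"
  and CA_one: "\<one>\<^bsub>CA\<^esub> = (\<lambda>N\<in>ons. \<one>\<^bsub>QA N\<^esub>)"
  and CA_zero: "\<zero>\<^bsub>CA\<^esub> = (\<lambda>N\<in>ons. \<zero>\<^bsub>QA N\<^esub>)"
  by (simp_all add: completed_group_algebra_def)

lemma CA_carrier_iff:
  "y \<in> carrier CA \<longleftrightarrow> y \<in> extensional ons \<and> (\<forall>N\<in>ons. y N \<in> carrier (QA N)) \<and>
    (\<forall>N\<in>ons. \<forall>M\<in>ons. N \<subseteq> M \<longrightarrow> tr N M (y N) = y M)"
  by (auto simp: completed_group_algebra_def PiE_def)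

lemma CA_component: "y \<in> carrier CA \<Longrightarrow> N \<in> ons \<Longrightarrow> y N \<in> carrier (QA N)"
  by (simp add: CA_carrier_iff)

lemma CA_compatible: "y \<in> carrier CA \<Longrightarrow> N \<in> ons \<Longrightarrow> M \<in> ons \<Longrightarrow> N \<subseteq> M \<Longrightarrow> tr N M (y N) = y M"
  by (simp add: CA_carrier_iff)

lemma CA_closedI:
  assumes "\<And>N. N \<in> ons \<Longrightarrow> f N \<in> carrier (QA N)"
    and "\<And>N M. N \<in> ons \<Longrightarrow> M \<in> ons \<Longrightarrow> N \<subseteq> M \<Longrightarrow> tr N M (f N) = f M"
  shows "restrict f ons \<in> carrier CA"
  using assms by (simp add: CA_carrier_iff)

lemma CA_eqI:
  "y \<in> carrier CA \<Longrightarrow> z \<in> carrier CA \<Longrightarrow> (\<And>N. N \<in> ons \<Longrightarrow> y N = z N) \<Longrightarrow> y = z"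
  by (rule extensionalityI[of _ ons]) (auto simp: CA_carrier_iff)

lemma CA_mult_closed: "y \<in> carrier CA \<Longrightarrow> z \<in> carrier CA \<Longrightarrow> y \<otimes>\<^bsub>CA\<^esub> z \<in> carrier CA"
  unfolding CA_mult
proof (rule CA_closedI)
  fix N assume y: "y \<in> carrier CA" and z: "z \<in> carrier CA" and N: "N \<in> ons"
  interpret N: ring "QA N" by (rule QA_ring[OF N])
  show "y N \<otimes>\<^bsub>QA N\<^esub> z N \<in> carrier (QA N)" using CA_component y z N by simp
  fix M assume M: "M \<in> ons" "N \<subseteq> M"
  interpret ring_hom_ring "QA N" "QA M" "tr N M" by (rule tr_ring_hom_ring[OF N M])
  show "tr N M (y N \<otimes>\<^bsub>QA N\<^esub> z N) = y M \<otimes>\<^bsub>QA M\<^esub> z M"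
    using CA_component y z N CA_compatible M by simp
qed

lemma CA_add_closed: "y \<in> carrier CA \<Longrightarrow> z \<in> carrier CA \<Longrightarrow> y \<oplus>\<^bsub>CA\<^esub> z \<in> carrier CA"
  unfolding CA_add
proof (rule CA_closedI)
  fix N assume y: "y \<in> carrier CA" and z: "z \<in> carrier CA" and N: "N \<in> ons"
  interpret N: ring "QA N" by (rule QA_ring[OF N])
  show "y N \<oplus>\<^bsub>QA N\<^esub> z N \<in> carrier (QA N)" using CA_component y z N by simp
  fix M assume M: "M \<in> ons" "N \<subseteq> M"
  interpret ring_hom_ring "QA N" "QA M" "tr N M" by (rule tr_ring_hom_ring[OF N M])
  show "tr N M (y N \<oplus>\<^bsub>QA N\<^esub> z N) = y M \<oplus>\<^bsub>QA M\<^esub> z M"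
    using CA_component y z N CA_compatible M by simp
qed

lemma CA_minus_closed:
  "y \<in> carrier CA \<Longrightarrow> (\<lambda>N\<in>ons. \<ominus>\<^bsub>QA N\<^esub> y N) \<in> carrier CA"
proof (rule CA_closedI)
  fix N assume y: "y \<in> carrier CA" and N: "N \<in> ons"
  interpret N: ring "QA N" by (rule QA_ring[OF N])
  show "\<ominus>\<^bsub>QA N\<^esub> y N \<in> carrier (QA N)" using CA_component y N by simp
  fix M assume M: "M \<in> ons" "N \<subseteq> M"
  interpret ring_hom_ring "QA N" "QA M" "tr N M" by (rule tr_ring_hom_ring[OF N M])
  show "tr N M (\<ominus>\<^bsub>QA N\<^esub> y N) = \<ominus>\<^bsub>QA M\<^esub> y M"
    using CA_component y N CA_compatible M by simp
qed

lemma CA_zero_closed: "\<zero>\<^bsub>CA\<^esub> \<in> carrier CA"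
  unfolding CA_zero
proof (rule CA_closedI)
  fix N assume N: "N \<in> ons"
  interpret N: ring "QA N" by (rule QA_ring[OF N])
  show "\<zero>\<^bsub>QA N\<^esub> \<in> carrier (QA N)" by simp
  fix M assume M: "M \<in> ons" "N \<subseteq> M"
  interpret ring_hom_ring "QA N" "QA M" "tr N M" by (rule tr_ring_hom_ring[OF N M])
  show "tr N M \<zero>\<^bsub>QA N\<^esub> = \<zero>\<^bsub>QA M\<^esub>" by simp
qed

lemma CA_one_closed: "\<one>\<^bsub>CA\<^esub> \<in> carrier CA"
  unfolding CA_one
proof (rule CA_closedI)
  fix N assume N: "N \<in> ons"
  interpret N: ring "QA N" by (rule QA_ring[OF N])
  show "\<one>\<^bsub>QA N\<^esub> \<in> carrier (QA N)" by simp
  fix M assume M: "M \<in> ons" "N \<subseteq> M"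
  interpret ring_hom_ring "QA N" "QA M" "tr N M" by (rule tr_ring_hom_ring[OF N M])
  show "tr N M \<one>\<^bsub>QA N\<^esub> = \<one>\<^bsub>QA M\<^esub>" by simp
qed

lemma CA_ring: "ring CA"
proof -
  note closed = CA_add_closed CA_mult_closed CA_zero_closed CA_one_closed
  note QA_rules = ring.ring_simprules[OF QA_ring] CA_component
  show ?thesis
  proof (rule ringI)
    show "abelian_group CA"
    proof (rule abelian_groupI)
      fix x y z assume xyz: "x \<in> carrier CA" "y \<in> carrier CA" "z \<in> carrier CA"
      show "x \<oplus>\<^bsub>CA\<^esub> y \<oplus>\<^bsub>CA\<^esub> z = x \<oplus>\<^bsub>CA\<^esub> (y \<oplus>\<^bsub>CA\<^esub> z)"
        by (rule CA_eqI; (intro closed CA_minus_closed xyz)?; simp add: CA_add QA_rules xyz)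
    next
      fix x y assume xy: "x \<in> carrier CA" "y \<in> carrier CA"
      show "x \<oplus>\<^bsub>CA\<^esub> y = y \<oplus>\<^bsub>CA\<^esub> x"
        by (rule CA_eqI; (intro closed CA_minus_closed xy)?; simp add: CA_add QA_rules xy)
    next
      fix x assume x: "x \<in> carrier CA"
      show "\<zero>\<^bsub>CA\<^esub> \<oplus>\<^bsub>CA\<^esub> x = x"
        by (rule CA_eqI; (intro closed CA_minus_closed x)?; simp add: CA_add CA_zero QA_rules x)
      show "\<exists>y\<in>carrier CA. y \<oplus>\<^bsub>CA\<^esub> x = \<zero>\<^bsub>CA\<^esub>"
      proof (rule bexI[OF _ CA_minus_closed[OF x]])
        show "(\<lambda>N\<in>ons. \<ominus>\<^bsub>QA N\<^esub> x N) \<oplus>\<^bsub>CA\<^esub> x = \<zero>\<^bsub>CA\<^esub>"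
          by (rule CA_eqI; (intro closed CA_minus_closed x)?; simp add: CA_add CA_zero QA_rules x)
      qed
    qed (rule closed; assumption)+
    show "monoid CA"
    proof (rule monoidI)
      fix x y z assume xyz: "x \<in> carrier CA" "y \<in> carrier CA" "z \<in> carrier CA"
      show "x \<otimes>\<^bsub>CA\<^esub> y \<otimes>\<^bsub>CA\<^esub> z = x \<otimes>\<^bsub>CA\<^esub> (y \<otimes>\<^bsub>CA\<^esub> z)"
        by (rule CA_eqI; (intro closed CA_minus_closed xyz)?; simp add: CA_mult QA_rules xyz)
    next
      fix x assume x: "x \<in> carrier CA"
      show "\<one>\<^bsub>CA\<^esub> \<otimes>\<^bsub>CA\<^esub> x = x"
        by (rule CA_eqI; (intro closed CA_minus_closed x)?; simp add: CA_mult CA_one QA_rules x)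
      show "x \<otimes>\<^bsub>CA\<^esub> \<one>\<^bsub>CA\<^esub> = x"
      proof (rule CA_eqI)
        fix N assume N: "N \<in> ons"
        interpret N: ring "QA N" by (rule QA_ring[OF N])
        show "(x \<otimes>\<^bsub>CA\<^esub> \<one>\<^bsub>CA\<^esub>) N = x N" using N x by (simp add: CA_mult CA_one CA_component)
      qed (use x in \<open>auto simp: closed\<close>)
    qed (rule closed; assumption?)+
  next
    fix x y z assume xyz: "x \<in> carrier CA" "y \<in> carrier CA" "z \<in> carrier CA"
    show "(x \<oplus>\<^bsub>CA\<^esub> y) \<otimes>\<^bsub>CA\<^esub> z = x \<otimes>\<^bsub>CA\<^esub> z \<oplus>\<^bsub>CA\<^esub> y \<otimes>\<^bsub>CA\<^esub> z"
    proof (rule CA_eqI)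
      fix N assume N: "N \<in> ons"
      interpret N: ring "QA N" by (rule QA_ring[OF N])
      show "((x \<oplus>\<^bsub>CA\<^esub> y) \<otimes>\<^bsub>CA\<^esub> z) N = (x \<otimes>\<^bsub>CA\<^esub> z \<oplus>\<^bsub>CA\<^esub> y \<otimes>\<^bsub>CA\<^esub> z) N"
        using N xyz by (simp add: CA_mult CA_add CA_component N.l_distr)
    qed (use xyz in \<open>auto simp: closed\<close>)
    show "z \<otimes>\<^bsub>CA\<^esub> (x \<oplus>\<^bsub>CA\<^esub> y) = z \<otimes>\<^bsub>CA\<^esub> x \<oplus>\<^bsub>CA\<^esub> z \<otimes>\<^bsub>CA\<^esub> y"
    proof (rule CA_eqI)
      fix N assume N: "N \<in> ons"
      interpret N: ring "QA N" by (rule QA_ring[OF N])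
      show "(z \<otimes>\<^bsub>CA\<^esub> (x \<oplus>\<^bsub>CA\<^esub> y)) N = (z \<otimes>\<^bsub>CA\<^esub> x \<oplus>\<^bsub>CA\<^esub> z \<otimes>\<^bsub>CA\<^esub> y) N"
        using N xyz by (simp add: CA_mult CA_add CA_component N.r_distr)
    qed (use xyz in \<open>auto simp: closed\<close>)
  qed
qed

sublocale CA: ring CA by (rule CA_ring)

lemma component_ring_hom_ring: "N \<in> ons \<Longrightarrow> ring_hom_ring CA (QA N) (\<lambda>y. y N)"
  by (intro ring_hom_ringI2[OF CA_ring QA_ring] ring_hom_memI)
    (auto simp: CA_mult CA_add CA_one CA_component)

lemma CA_char: "zmul CA (int p) \<one>\<^bsub>CA\<^esub> = \<zero>\<^bsub>CA\<^esub>"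
proof (rule CA_eqI)
  fix N assume N: "N \<in> ons"
  interpret ring_hom_ring CA "QA N" "\<lambda>y. y N" by (rule component_ring_hom_ring[OF N])
  show "zmul CA (int p) \<one>\<^bsub>CA\<^esub> N = \<zero>\<^bsub>CA\<^esub> N"
    using hom_int_smult[OF CA.one_closed, of "int p"]
      finite_group_algebra.A_char[OF quotient_group_algebra[OF N]] by simp
qed auto

lemma completed_scalar_eq:
  assumes "c \<in> carrier (Fp p)"
  shows "completed_scalar G T c = zmul CA c \<one>\<^bsub>CA\<^esub>"
proof (rule extensionalityI[of _ ons])
  fix N assume N: "N \<in> ons"
  interpret ring_hom_ring CA "QA N" "\<lambda>y. y N" by (rule component_ring_hom_ring[OF N])
  interpret N: finite_group_algebra "G Mod N" p by (rule quotient_group_algebra[OF N])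
  have "zmul CA c \<one>\<^bsub>CA\<^esub> N = zmul (QA N) c \<one>\<^bsub>QA N\<^esub>"
    using hom_int_smult[OF CA.one_closed, of c] by simp
  also have "\<dots> = (\<lambda>C\<in>carrier (G Mod N). (c * \<one>\<^bsub>QA N\<^esub> C) mod int p)"
    by (rule N.A_zmul) simp
  also have "\<dots> = completed_scalar G T c N"
    using N assms unfolding completed_scalar_def N.A_one delta_def
    by (auto intro!: restrict_ext)
  finally show "completed_scalar G T c N = zmul CA c \<one>\<^bsub>CA\<^esub> N" by simp
next
  show "zmul CA c \<one>\<^bsub>CA\<^esub> \<in> extensional ons"
    using CA.int_smult_closed[OF CA.one_closed, of c] by (simp add: CA_carrier_iff)
qed (simp add: completed_scalar_def)

lemma group_element_component: "N \<in> ons \<Longrightarrow> group_element g N = delta (G Mod N) (N #> g)"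
  by (simp add: group_element_def)

lemma group_element_closed: "g \<in> carrier G \<Longrightarrow> group_element g \<in> carrier CA"
  unfolding group_element_def
  by (rule CA_closedI)
    (auto simp: tr_delta coset_in_quotient
      intro!: finite_group_algebra.delta_closed quotient_group_algebra)

lemma group_element_mult:
  assumes "g \<in> carrier G" "h \<in> carrier G"
  shows "group_element g \<otimes>\<^bsub>CA\<^esub> group_element h = group_element (g \<otimes> h)"
proof (rule CA_eqI)
  fix N assume N: "N \<in> ons"
  interpret N: finite_group_algebra "G Mod N" p by (rule quotient_group_algebra[OF N])
  show "(group_element g \<otimes>\<^bsub>CA\<^esub> group_element h) N = group_element (g \<otimes> h) N"
    using N.delta_mult[OF coset_in_quotient[OF assms(1)] coset_in_quotient[OF assms(2)]]
      quotient_mult[OF N assms] N by (simp add: CA_mult group_element_component)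
qed (use assms in \<open>auto simp: group_element_closed\<close>)

lemma group_element_one: "group_element \<one> = \<one>\<^bsub>CA\<^esub>"
proof (rule CA_eqI)
  fix N assume N: "N \<in> ons"
  interpret N: finite_group_algebra "G Mod N" p by (rule quotient_group_algebra[OF N])
  have "N #> \<one> = N" using subgroup.subset[OF ons_subgroup[OF N]] by simp
  then show "group_element \<one> N = \<one>\<^bsub>CA\<^esub> N"
    using N by (simp add: CA_one group_element_component N.A_one)
qed (auto simp: group_element_closed)

lemma augmentation_eq:
  assumes "y \<in> carrier CA"
  shows "augmentation p G y = sum (y (carrier G)) (carrier (G Mod carrier G)) mod int p"
proof -
  interpret C: finite_group_algebra "G Mod carrier G" p
    by (rule quotient_group_algebra[OF carrier_ons])
  show ?thesis
    unfolding augmentation_def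
    using CA_component[OF assms carrier_ons] C.finite_Q C.p_gt_1
    by (intro finsum_residue_ring) (auto simp: C.carrier_A_iff)
qed

lemma augmentation_ring_hom_ring: "ring_hom_ring CA (Fp p) (augmentation p G)"
proof -
  interpret C: finite_group_algebra "G Mod carrier G" p
    by (rule quotient_group_algebra[OF carrier_ons])
  interpret component: ring_hom_ring CA "QA (carrier G)" "\<lambda>y. y (carrier G)"
    by (rule component_ring_hom_ring[OF carrier_ons])
  interpret sum: ring_hom_ring "QA (carrier G)" "Fp p" "\<lambda>f. sum f (carrier (G Mod carrier G)) mod int p"
    by (rule ring_hom_ringI2[OF C.ring_A C.ring_Fp C.sum_hom])
  show ?thesis
  proof (intro ring_hom_ringI2[OF CA_ring C.ring_Fp] ring_hom_memI)
    fix y assume y: "y \<in> carrier CA"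
    show "augmentation p G y \<in> carrier (Fp p)"
      unfolding augmentation_eq[OF y] using sum.hom_closed component.hom_closed y by blast
    fix z assume z: "z \<in> carrier CA"
    show "augmentation p G (y \<otimes>\<^bsub>CA\<^esub> z) = augmentation p G y \<otimes>\<^bsub>Fp p\<^esub> augmentation p G z"
      unfolding augmentation_eq[OF y] augmentation_eq[OF z] augmentation_eq[OF CA.m_closed[OF y z]]
      using component.hom_mult[OF y z] sum.hom_mult[OF component.hom_closed[OF y] component.hom_closed[OF z]]
      by (simp only:)
    show "augmentation p G (y \<oplus>\<^bsub>CA\<^esub> z) = augmentation p G y \<oplus>\<^bsub>Fp p\<^esub> augmentation p G z"
      unfolding augmentation_eq[OF y] augmentation_eq[OF z] augmentation_eq[OF CA.a_closed[OF y z]]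
      using component.hom_add[OF y z] sum.hom_add[OF component.hom_closed[OF y] component.hom_closed[OF z]]
      by (simp only:)
  next
    show "augmentation p G \<one>\<^bsub>CA\<^esub> = \<one>\<^bsub>Fp p\<^esub>"
      unfolding augmentation_eq[OF CA.one_closed] using component.hom_one sum.hom_one by (simp only:)
  qed
qed

lemma CI_ideal: "ideal CI CA"
  unfolding augmentation_ideal_def
  by (rule ring_hom_ring.kernel_is_ideal[OF augmentation_ring_hom_ring])

lemma CI_iff_carrier: "y \<in> CI \<longleftrightarrow> y \<in> carrier CA \<and> y (carrier G) \<in> QI (carrier G)"
proof -
  have "y \<in> CI \<longleftrightarrow> y \<in> carrier CA \<and> augmentation p G y = 0"
    by (auto simp: augmentation_ideal_def a_kernel_def')
  also have "\<dots> \<longleftrightarrow> y \<in> carrier CA \<and> int p dvd sum (y (carrier G)) (carrier (G Mod carrier G))"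
    using augmentation_eq by (auto simp only: mod_eq_0_iff_dvd)
  also have "\<dots> \<longleftrightarrow> y \<in> carrier CA \<and> y (carrier G) \<in> QI (carrier G)"
    using CA_component[OF _ carrier_ons] by (auto simp only: aug_ideal_def mem_Collect_eq)
  finally show ?thesis .
qed

text \<open>Transition maps preserve the sum of the coefficients, so the level at which it is taken does not
  matter.\<close>

lemma CI_iff: "y \<in> CI \<longleftrightarrow> y \<in> carrier CA \<and> (\<forall>N\<in>ons. y N \<in> QI N)"
proof
  assume "y \<in> carrier CA \<and> (\<forall>N\<in>ons. y N \<in> QI N)"
  then show "y \<in> CI" using CI_iff_carrier carrier_ons by blast
next
  assume "y \<in> CI"
  then have y: "y \<in> carrier CA" "y (carrier G) \<in> QI (carrier G)" using CI_iff_carrier by auto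
  have "y N \<in> QI N" if N: "N \<in> ons" for N
  proof -
    have sub: "N \<subseteq> carrier G" using subgroup.subset[OF ons_subgroup[OF N]] .
    interpret h: group_algebra_hom "G Mod N" p "G Mod carrier G" "\<lambda>C. C <#>\<^bsub>G\<^esub> carrier G"
      by (rule tr_group_algebra_hom[OF N carrier_ons sub])
    have "[sum (y (carrier G)) (carrier (G Mod carrier G)) = sum (y N) (carrier (G Mod N))] (mod int p)"
      using h.pairing_push[OF CA_component[OF y(1) N], of "\<lambda>_. 1"]
      unfolding CA_compatible[OF y(1) N carrier_ons sub] by (simp add: pairing_def)
    then show ?thesis
      using y(2) CA_component[OF y(1) N] cong_dvd_iff unfolding aug_ideal_def by blast
  qed
  then show "y \<in> carrier CA \<and> (\<forall>N\<in>ons. y N \<in> QI N)" using y by blast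
qed

lemma group_element_minus_one_in_CI:
  assumes "g \<in> carrier G"
  shows "group_element g \<ominus>\<^bsub>CA\<^esub> \<one>\<^bsub>CA\<^esub> \<in> CI"
proof -
  have "(group_element g \<ominus>\<^bsub>CA\<^esub> \<one>\<^bsub>CA\<^esub>) N \<in> QI N" if N: "N \<in> ons" for N
  proof -
    interpret N: finite_group_algebra "G Mod N" p by (rule quotient_group_algebra[OF N])
    interpret h: ring_hom_ring CA "QA N" "\<lambda>y. y N" by (rule component_ring_hom_ring[OF N])
    show ?thesis
      using N.delta_minus_one_in_aug_ideal[OF coset_in_quotient[OF assms]] group_element_closed[OF assms] N
      by (simp add: CA.minus_eq N.A.minus_eq group_element_component[symmetric])
  qed
  then show ?thesis using group_element_closed[OF assms] by (simp add: CI_iff)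
qed

lemma CA_eq_scalar_plus_CI:
  assumes "y \<in> carrier CA"
  shows "\<exists>m. \<exists>r\<in>CI. y = zmul CA m \<one>\<^bsub>CA\<^esub> \<oplus>\<^bsub>CA\<^esub> r"
proof -
  interpret aug: ring_hom_ring CA "Fp p" "augmentation p G" by (rule augmentation_ring_hom_ring)
  let ?m = "augmentation p G y"
  interpret C: finite_group_algebra "G Mod carrier G" p
    by (rule quotient_group_algebra[OF carrier_ons])
  let ?s = "zmul CA ?m \<one>\<^bsub>CA\<^esub>"
  have "sum (?s (carrier G)) (carrier (G Mod carrier G)) mod int p = ?m"
  proof -
    interpret h: ring_hom_ring CA "QA (carrier G)" "\<lambda>y. y (carrier G)"
      by (rule component_ring_hom_ring[OF carrier_ons])
    have "?s (carrier G) = zmul (QA (carrier G)) ?m \<one>\<^bsub>QA (carrier G)\<^esub>"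
      using h.hom_int_smult[OF CA.one_closed] by simp
    moreover have "[pairing (G Mod carrier G) (zmul (QA (carrier G)) ?m \<one>\<^bsub>QA (carrier G)\<^esub>) (\<lambda>_. 1)
        = ?m * pairing (G Mod carrier G) \<one>\<^bsub>QA (carrier G)\<^esub> (\<lambda>_. 1)] (mod int p)"
      by (rule C.pairing_zmul) simp
    moreover have "pairing (G Mod carrier G) \<one>\<^bsub>QA (carrier G)\<^esub> (\<lambda>_. 1) = 1"
      unfolding C.A_one by (rule C.pairing_delta) (rule C.Q.one_closed)
    ultimately have "[sum (?s (carrier G)) (carrier (G Mod carrier G)) = ?m] (mod int p)"
      by (simp add: C.pairing_one_right)
    moreover have "?m mod int p = ?m" using aug.hom_closed[OF assms] by simp
    ultimately show ?thesis by (simp add: unique_euclidean_semiring_class.cong_def)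
  qed
  then have "augmentation p G ?s = ?m" using augmentation_eq[of ?s] by simp
  then have "augmentation p G (y \<ominus>\<^bsub>CA\<^esub> ?s) = \<zero>\<^bsub>Fp p\<^esub>"
    using assms aug.S.r_neg[OF aug.hom_closed[OF assms]] by (simp add: CA.minus_eq del: residue_ring_simps)
  then have "y \<ominus>\<^bsub>CA\<^esub> ?s \<in> CI"
    using assms unfolding augmentation_ideal_def a_kernel_def' by blast
  moreover have "y = ?s \<oplus>\<^bsub>CA\<^esub> (y \<ominus>\<^bsub>CA\<^esub> ?s)"
    by (rule CA.add_diff_cancel[OF assms CA.int_smult_closed[OF CA.one_closed]])
  ultimately show ?thesis by blast
qed

end

section \<open>Powers of the augmentation ideal of a finitely generated group\<close>

text \<open>A linear equation over the completed group algebra is solvable as soon as it is solvable at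
  every finite level: the finite sets of solutions form an inverse system.\<close>

lemma (in pro_p) lift_left_comb:
  fixes k :: nat
  assumes y: "y \<in> carrier CA" and \<sigma>: "\<And>i. i < k \<Longrightarrow> \<sigma> i \<in> carrier CA"
    and B: "\<And>N. N \<in> ons \<Longrightarrow> B N \<subseteq> carrier (QA N)"
    and tr_B: "\<And>N M f. N \<in> ons \<Longrightarrow> M \<in> ons \<Longrightarrow> N \<subseteq> M \<Longrightarrow> f \<in> B N \<Longrightarrow> tr N M f \<in> B M"
    and solvable: "\<And>N. N \<in> ons \<Longrightarrow> \<exists>b. (\<forall>i<k. b i \<in> B N) \<and>
      y N = finsum (QA N) (\<lambda>i. b i \<otimes>\<^bsub>QA N\<^esub> \<sigma> i N) {..<k}"
  shows "\<exists>b. (\<forall>i<k. b i \<in> carrier CA \<and> (\<forall>N\<in>ons. b i N \<in> B N)) \<and>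
    y = finsum CA (\<lambda>i. b i \<otimes>\<^bsub>CA\<^esub> \<sigma> i) {..<k}"
proof -
  let ?S = "\<lambda>N. {b \<in> {..<k} \<rightarrow>\<^sub>E B N. y N = finsum (QA N) (\<lambda>i. b i \<otimes>\<^bsub>QA N\<^esub> \<sigma> i N) {..<k}}"
  let ?tr = "\<lambda>N M b. \<lambda>i\<in>{..<k}. tr N M (b i)"
  have "\<exists>s. \<forall>N\<in>ons. s N \<in> ?S N \<and> (\<forall>M\<in>ons. N \<subseteq> M \<longrightarrow> ?tr N M (s N) = s M)"
  proof (rule inverse_limit_nonempty)
    show "ons \<noteq> {}" using carrier_ons by auto
    show "N \<inter> M \<in> ons" if "N \<in> ons" "M \<in> ons" for N M by (rule Int_ons[OF that])
  next
    fix N assume N: "N \<in> ons"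
    have "finite (B N)"
      using finite_subset[OF B[OF N]] finite_group_algebra.finite_carrier_A[OF quotient_group_algebra[OF N]]
      by blast
    then show "finite (?S N)"
      by (intro finite_subset[of "?S N" "{..<k} \<rightarrow>\<^sub>E B N"] finite_PiE Collect_restrict finite_lessThan)
    interpret N: ring "QA N" by (rule QA_ring[OF N])
    obtain b where b: "\<forall>i<k. b i \<in> B N" "y N = finsum (QA N) (\<lambda>i. b i \<otimes>\<^bsub>QA N\<^esub> \<sigma> i N) {..<k}"
      using solvable[OF N] by blast
    have "finsum (QA N) (\<lambda>i. restrict b {..<k} i \<otimes>\<^bsub>QA N\<^esub> \<sigma> i N) {..<k}
        = finsum (QA N) (\<lambda>i. b i \<otimes>\<^bsub>QA N\<^esub> \<sigma> i N) {..<k}"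
      using B[OF N] b(1) CA_component[OF \<sigma> N] by (intro N.finsum_cong') auto
    then have "restrict b {..<k} \<in> ?S N" using b by auto
    then show "?S N \<noteq> {}" by blast
  next
    fix N M b assume NM: "N \<in> ons" "M \<in> ons" "N \<subseteq> M" and b: "b \<in> ?S N"
    interpret ring_hom_ring "QA N" "QA M" "tr N M" by (rule tr_ring_hom_ring[OF NM])
    have car: "b i \<in> carrier (QA N)" if "i < k" for i using b that B[OF NM(1)] by auto
    have "y M = tr N M (y N)" using CA_compatible[OF y NM] by simp
    also have "\<dots> = tr N M (finsum (QA N) (\<lambda>i. b i \<otimes>\<^bsub>QA N\<^esub> \<sigma> i N) {..<k})" using b by simp
    also have "\<dots> = finsum (QA M) (\<lambda>i. tr N M (b i) \<otimes>\<^bsub>QA M\<^esub> tr N M (\<sigma> i N)) {..<k}"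
      by (rule hom_left_comb) (use car CA_component[OF \<sigma> NM(1)] in auto)
    also have "\<dots> = finsum (QA M) (\<lambda>i. ?tr N M b i \<otimes>\<^bsub>QA M\<^esub> \<sigma> i M) {..<k}"
      using car CA_component[OF \<sigma> NM(2)] CA_compatible[OF \<sigma> NM]
      by (intro S.finsum_cong') auto
    finally show "?tr N M b \<in> ?S M" using b tr_B[OF NM] by auto
  next
    fix L N M b assume LNM: "L \<in> ons" "N \<in> ons" "M \<in> ons" "L \<subseteq> N" "N \<subseteq> M" and b: "b \<in> ?S L"
    have "b i \<in> carrier (QA L)" if "i < k" for i using b that B[OF LNM(1)] by auto
    then show "?tr N M (?tr L N b) = ?tr L M b" using tr_tr[OF LNM] by auto
  qed
  then obtain s where "\<forall>N\<in>ons. s N \<in> ?S N \<and> (\<forall>M\<in>ons. N \<subseteq> M \<longrightarrow> ?tr N M (s N) = s M)"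
    by (rule exE)
  note s = bspec[OF this, THEN conjunct1]
    bspec[OF this, THEN conjunct2, THEN bspec, THEN mp]
  define b where "b = (\<lambda>i. \<lambda>N\<in>ons. s N i)"
  have sB: "s N i \<in> B N" if "i < k" "N \<in> ons" for i N using s(1)[OF that(2)] that(1) by auto
  have b: "b i \<in> carrier CA" if i: "i < k" for i
    unfolding b_def
  proof (rule CA_closedI)
    show "s N i \<in> carrier (QA N)" if "N \<in> ons" for N using sB[OF i that] B[OF that] by blast
    show "tr N M (s N i) = s M i" if "N \<in> ons" "M \<in> ons" "N \<subseteq> M" for N M
      using fun_cong[OF s(2)[OF that], of i] i by simp
  qed
  have "y = finsum CA (\<lambda>i. b i \<otimes>\<^bsub>CA\<^esub> \<sigma> i) {..<k}"
  proof (rule CA_eqI[OF y])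
    show "finsum CA (\<lambda>i. b i \<otimes>\<^bsub>CA\<^esub> \<sigma> i) {..<k} \<in> carrier CA"
      by (rule CA.finsum_closed) (use b \<sigma> in auto)
    fix N assume N: "N \<in> ons"
    interpret ring_hom_ring CA "QA N" "\<lambda>y. y N" by (rule component_ring_hom_ring[OF N])
    have "finsum CA (\<lambda>i. b i \<otimes>\<^bsub>CA\<^esub> \<sigma> i) {..<k} N = finsum (QA N) (\<lambda>i. b i N \<otimes>\<^bsub>QA N\<^esub> \<sigma> i N) {..<k}"
      by (rule hom_left_comb) (use b \<sigma> in auto)
    also have "\<dots> = finsum (QA N) (\<lambda>i. s N i \<otimes>\<^bsub>QA N\<^esub> \<sigma> i N) {..<k}" using N by (simp add: b_def)
    also have "\<dots> = y N" using s(1)[OF N] by simp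
    finally show "y N = finsum CA (\<lambda>i. b i \<otimes>\<^bsub>CA\<^esub> \<sigma> i) {..<k} N" by simp
  qed
  moreover have "\<forall>i<k. b i \<in> carrier CA \<and> (\<forall>N\<in>ons. b i N \<in> B N)"
    using b sB by (auto simp: b_def)
  ultimately show ?thesis by blast
qed

lemma (in pro_p) dense_meets_coset:
  assumes "D \<subseteq> carrier G" "T closure_of D = carrier G" "N \<in> ons" "g \<in> carrier G"
  shows "\<exists>h\<in>D. N #> h = N #> g"
proof -
  have "openin T (N #> g)" by (rule openin_coset[OF onsD(2)[OF assms(3)] assms(4)])
  moreover have "g \<in> N #> g" by (rule rcos_self[OF assms(4) ons_subgroup[OF assms(3)]])
  moreover have "g \<in> T closure_of D" using assms by simp
  ultimately obtain h where h: "h \<in> D" "h \<in> N #> g" unfolding in_closure_of by blast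
  then show ?thesis
    using repr_independence[OF h(2) assms(4) ons_subgroup[OF assms(3)]] by auto
qed

locale generated_pro_p = pro_p +
  fixes k :: nat and s :: "nat \<Rightarrow> 'a"
  assumes s_closed: "\<And>i. i < k \<Longrightarrow> s i \<in> carrier G"
    and s_dense: "T closure_of (generate G (s ` {..<k})) = carrier G"
begin

abbreviation gen_diff where "gen_diff i \<equiv> group_element (s i) \<ominus>\<^bsub>CA\<^esub> \<one>\<^bsub>CA\<^esub>"

lemma gen_diff_closed: "i < k \<Longrightarrow> gen_diff i \<in> carrier CA"
  by (auto simp: group_element_closed s_closed)

lemma gen_diff_CI: "i < k \<Longrightarrow> gen_diff i \<in> CI"
  by (rule group_element_minus_one_in_CI[OF s_closed])

sublocale ring_family CA k gen_diff
  by unfold_locales (rule gen_diff_closed)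

lemma group_element_minus_one_component:
  assumes "g \<in> carrier G" "N \<in> ons"
  shows "(group_element g \<ominus>\<^bsub>CA\<^esub> \<one>\<^bsub>CA\<^esub>) N = delta (G Mod N) (N #> g) \<ominus>\<^bsub>QA N\<^esub> \<one>\<^bsub>QA N\<^esub>"
proof -
  interpret N: ring "QA N" by (rule QA_ring[OF assms(2)])
  interpret h: ring_hom_ring CA "QA N" "\<lambda>y. y N" by (rule component_ring_hom_ring[OF assms(2)])
  show ?thesis
    using group_element_closed[OF assms(1)] assms(2)
    by (simp add: CA.minus_eq N.minus_eq group_element_component[symmetric])
qed

text \<open>The group elements \<open>g\<close> for which \<open>g - 1\<close> lies in the left ideal generated by the differences
  \<open>s - 1\<close> form a subgroup, by \<open>g h - 1 = g (h - 1) + (g - 1)\<close>. At a finite level a topologically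
  generating set generates.\<close>

lemma QI_generated:
  assumes N: "N \<in> ons"
  shows "QI N \<subseteq> ring_family.left_span (QA N) k (\<lambda>i. gen_diff i N)"
proof -
  interpret N: finite_group_algebra "G Mod N" p by (rule quotient_group_algebra[OF N])
  interpret F: ring_family "QA N" k "\<lambda>i. gen_diff i N"
    by unfold_locales (rule CA_component[OF gen_diff_closed N])
  let ?e = "\<lambda>g. delta (G Mod N) (N #> g)"
  have e_closed: "?e g \<in> carrier (QA N)" if "g \<in> carrier G" for g
    by (rule N.delta_closed[OF coset_in_quotient[OF that]])
  have e_mult: "?e g \<otimes>\<^bsub>QA N\<^esub> ?e h = ?e (g \<otimes> h)" if "g \<in> carrier G" "h \<in> carrier G" for g h
    using N.delta_mult[OF coset_in_quotient[OF that(1)] coset_in_quotient[OF that(2)]]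
      quotient_mult[OF N that] by simp
  have e_one: "?e \<one> = \<one>\<^bsub>QA N\<^esub>"
    using group_element_component[OF N, of \<one>] N by (simp add: group_element_one CA_one)
  have gen_diff_e: "gen_diff i N = ?e (s i) \<ominus>\<^bsub>QA N\<^esub> \<one>\<^bsub>QA N\<^esub>" if "i < k" for i
    by (rule group_element_minus_one_component[OF s_closed[OF that] N])
  have sub: "s ` {..<k} \<subseteq> carrier G" using s_closed by auto
  have diff_span: "?e g \<ominus>\<^bsub>QA N\<^esub> \<one>\<^bsub>QA N\<^esub> \<in> F.left_span \<and> g \<in> carrier G"
    if "g \<in> generate G (s ` {..<k})" for g
    using that
  proof (induction g rule: generate.induct)
    case one
    then show ?case using F.left_span_zero by (simp add: e_one N.A.minus_eq N.A.r_neg)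
  next
    case (incl g)
    then show ?case using F.left_span_base gen_diff_e s_closed by auto
  next
    case (inv g)
    then obtain i where i: "i < k" "g = s i" by auto
    have g: "g \<in> carrier G" "inv g \<in> carrier G" using i s_closed by auto
    have "?e (inv g) \<otimes>\<^bsub>QA N\<^esub> (?e g \<ominus>\<^bsub>QA N\<^esub> \<one>\<^bsub>QA N\<^esub>) = \<ominus>\<^bsub>QA N\<^esub> (?e (inv g) \<ominus>\<^bsub>QA N\<^esub> \<one>\<^bsub>QA N\<^esub>)"
      using g e_closed[OF g(1)] e_closed[OF g(2)]
      by (simp add: N.A.minus_eq N.A.r_distr N.A.r_minus e_mult e_one N.A.minus_add N.A.a_comm)
    moreover have "?e (inv g) \<otimes>\<^bsub>QA N\<^esub> (?e g \<ominus>\<^bsub>QA N\<^esub> \<one>\<^bsub>QA N\<^esub>) \<in> F.left_span"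
      using F.left_span_mult[OF e_closed[OF g(2)] F.left_span_base[OF i(1)]] gen_diff_e[OF i(1)] i(2)
      by simp
    ultimately have "\<ominus>\<^bsub>QA N\<^esub> (\<ominus>\<^bsub>QA N\<^esub> (?e (inv g) \<ominus>\<^bsub>QA N\<^esub> \<one>\<^bsub>QA N\<^esub>)) \<in> F.left_span"
      using F.left_span_minus by simp
    then show ?case using g e_closed[OF g(2)] by simp
  next
    case (eng g h)
    have g: "g \<in> carrier G" "h \<in> carrier G" using eng by auto
    have "?e g \<otimes>\<^bsub>QA N\<^esub> (?e h \<ominus>\<^bsub>QA N\<^esub> \<one>\<^bsub>QA N\<^esub>) \<oplus>\<^bsub>QA N\<^esub> (?e g \<ominus>\<^bsub>QA N\<^esub> \<one>\<^bsub>QA N\<^esub>)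
        = ?e (g \<otimes> h) \<ominus>\<^bsub>QA N\<^esub> \<one>\<^bsub>QA N\<^esub>"
    proof -
      have car: "?e g \<in> carrier (QA N)" "?e h \<in> carrier (QA N)" "?e (g \<otimes> h) \<in> carrier (QA N)"
        using g e_closed by auto
      have eq: "?e g \<otimes>\<^bsub>QA N\<^esub> (?e h \<ominus>\<^bsub>QA N\<^esub> \<one>\<^bsub>QA N\<^esub>) = ?e (g \<otimes> h) \<ominus>\<^bsub>QA N\<^esub> ?e g"
        using car g by (simp add: N.A.minus_eq N.A.r_distr N.A.r_minus e_mult)
      show ?thesis
        unfolding eq using car by (simp add: N.A.minus_eq N.A.a_assoc N.A.r_neg1)
    qed
    moreover have "?e g \<otimes>\<^bsub>QA N\<^esub> (?e h \<ominus>\<^bsub>QA N\<^esub> \<one>\<^bsub>QA N\<^esub>) \<oplus>\<^bsub>QA N\<^esub> (?e g \<ominus>\<^bsub>QA N\<^esub> \<one>\<^bsub>QA N\<^esub>) \<in> F.left_span"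
      using F.left_span_add[OF F.left_span_mult[OF e_closed[OF g(1)]]] eng.IH by blast
    ultimately show ?case using g by simp
  qed
  have all: "delta (G Mod N) C \<ominus>\<^bsub>QA N\<^esub> \<one>\<^bsub>QA N\<^esub> \<in> F.left_span" if C: "C \<in> carrier (G Mod N)" for C
  proof -
    obtain g where g: "g \<in> carrier G" "C = N #> g" using C by (auto simp: carrier_FactGroup)
    obtain h where "h \<in> generate G (s ` {..<k})" "N #> h = N #> g"
      using dense_meets_coset[OF generate_incl[OF sub] s_dense N g(1)] by blast
    then show ?thesis using diff_span[of h] g(2) by auto
  qed
  show ?thesis
  proof
    fix f assume f: "f \<in> QI N"
    have "finsum (QA N) (\<lambda>C. zmul (QA N) (f C) (delta (G Mod N) C \<ominus>\<^bsub>QA N\<^esub> \<one>\<^bsub>QA N\<^esub>)) (carrier (G Mod N))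
        \<in> F.left_span"
      by (rule F.left_span_finsum[OF N.finite_Q F.left_span_zmul[OF all]])
    then show "f \<in> F.left_span" using N.aug_ideal_eq_sum[OF f] by simp
  qed
qed

lemma CI_power_component:
  "y \<in> ideal_power CA CI n \<Longrightarrow> N \<in> ons \<Longrightarrow> y N \<in> ideal_power (QA N) (QI N) n"
  using ring_hom_ring.hom_ideal_power[OF component_ring_hom_ring CI_ideal] CI_iff
  by (metis (no_types, lifting) image_subsetI)

text \<open>Powers of the augmentation ideal are defined by finite sums of products, without taking
  closures; they are nevertheless closed because the coefficients of the generators can be lifted
  within the previous power.\<close>

lemma CI_powerI:
  assumes "y \<in> carrier CA" "\<And>N. N \<in> ons \<Longrightarrow> y N \<in> ideal_power (QA N) (QI N) n"
  shows "y \<in> ideal_power CA CI n"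
  using assms
proof (induction n arbitrary: y)
  case (Suc n)
  have "\<exists>b. (\<forall>i<k. b i \<in> carrier CA \<and> (\<forall>N\<in>ons. b i N \<in> ideal_power (QA N) (QI N) n)) \<and>
    y = finsum CA (\<lambda>i. b i \<otimes>\<^bsub>CA\<^esub> gen_diff i) {..<k}"
  proof (rule lift_left_comb[OF Suc.prems(1) gen_diff_closed])
    fix N assume N: "N \<in> ons"
    interpret N: finite_group_algebra "G Mod N" p by (rule quotient_group_algebra[OF N])
    interpret F: ring_family "QA N" k "\<lambda>i. gen_diff i N"
      by unfold_locales (rule CA_component[OF gen_diff_closed N])
    show "ideal_power (QA N) (QI N) n \<subseteq> carrier (QA N)"
      using N.A.ideal_power_closed[OF N.aug_ideal_ideal] by blast
    show "\<exists>b. (\<forall>i<k. b i \<in> ideal_power (QA N) (QI N) n) \<and>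
        y N = finsum (QA N) (\<lambda>i. b i \<otimes>\<^bsub>QA N\<^esub> gen_diff i N) {..<k}"
      by (rule F.ideal_power_Suc_left_comb[OF N.aug_ideal_ideal QI_generated[OF N] Suc.prems(2)[OF N]])
  qed (simp_all add: tr_QI_power)
  then obtain b where b: "\<And>i. i < k \<Longrightarrow> b i \<in> carrier CA"
    "\<And>i N. i < k \<Longrightarrow> N \<in> ons \<Longrightarrow> b i N \<in> ideal_power (QA N) (QI N) n"
    "y = finsum CA (\<lambda>i. b i \<otimes>\<^bsub>CA\<^esub> gen_diff i) {..<k}" by blast
  have "b i \<in> ideal_power CA CI n" if "i < k" for i
    by (rule Suc.IH[OF b(1)[OF that] b(2)[OF that]])
  then show ?case
    unfolding b(3)
    by (intro CA.ideal_finsum[OF CA.ideal_power_ideal[OF CI_ideal]])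
      (auto intro: ideal_prod.prod gen_diff_CI)
qed simp

lemma CI_generated: "CI \<subseteq> left_span"
proof
  fix y assume y: "y \<in> CI"
  have yc: "y \<in> carrier CA" using y CI_iff by blast
  have "\<exists>b. (\<forall>i<k. b i \<in> carrier CA \<and> (\<forall>N\<in>ons. b i N \<in> carrier (QA N))) \<and>
    y = finsum CA (\<lambda>i. b i \<otimes>\<^bsub>CA\<^esub> gen_diff i) {..<k}"
  proof (rule lift_left_comb[OF yc gen_diff_closed])
    fix N assume N: "N \<in> ons"
    interpret F: ring_family "QA N" k "\<lambda>i. gen_diff i N"
      by (intro ring_family.intro ring_family_axioms.intro QA_ring N CA_component[OF gen_diff_closed])
    show "\<exists>b. (\<forall>i<k. b i \<in> carrier (QA N)) \<and>
        y N = finsum (QA N) (\<lambda>i. b i \<otimes>\<^bsub>QA N\<^esub> gen_diff i N) {..<k}"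
      using QI_generated[OF N] y N CI_iff unfolding F.left_span_def by blast
  qed (auto intro: tr_closed)
  then show "y \<in> left_span" unfolding left_span_def by blast
qed

lemma CI_linear_part:
  assumes "y \<in> CI"
  shows "\<exists>c. \<exists>r\<in>ideal_power CA CI 2. y = word_sum CA k gen_diff (Suc 0) c \<oplus>\<^bsub>CA\<^esub> r"
proof -
  obtain b where b: "\<And>i. i < k \<Longrightarrow> b i \<in> carrier CA" "y = left_comb b"
    using CI_generated assms unfolding left_span_def by blast
  obtain m r where mr: "\<And>i. i < k \<Longrightarrow> r i \<in> CI" "\<And>i. i < k \<Longrightarrow> b i = zmul CA (m i) \<one>\<^bsub>CA\<^esub> \<oplus>\<^bsub>CA\<^esub> r i"
    using CA_eq_scalar_plus_CI[OF b(1)] by metis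
  have rc: "r i \<in> carrier CA" if "i < k" for i using mr(1)[OF that] CI_iff by blast
  have "y = left_comb (\<lambda>i. zmul CA (m i) \<one>\<^bsub>CA\<^esub> \<oplus>\<^bsub>CA\<^esub> r i)"
    unfolding b(2) by (rule CA.finsum_cong') (use mr rc gen_diff_closed in auto)
  also have "\<dots> = left_comb (\<lambda>i. zmul CA (m i) \<one>\<^bsub>CA\<^esub>) \<oplus>\<^bsub>CA\<^esub> left_comb r"
    by (rule left_comb_add) (use rc in auto)
  also have "left_comb (\<lambda>i. zmul CA (m i) \<one>\<^bsub>CA\<^esub>) = word_sum CA k gen_diff (Suc 0) (\<lambda>v. m (hd v))"
    unfolding word_sum.simps
    by (rule CA.finsum_cong')
      (auto simp: gen_diff_closed CA.add_pow_ldistr_int CA.add_pow_rdistr_int)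
  finally have "y = word_sum CA k gen_diff (Suc 0) (\<lambda>v. m (hd v)) \<oplus>\<^bsub>CA\<^esub> left_comb r" .
  moreover have "left_comb r \<in> ideal_power CA CI 2"
  proof -
    have "r i \<otimes>\<^bsub>CA\<^esub> gen_diff i \<in> ideal_power CA CI (Suc 0 + Suc 0)" if "i < k" for i
      using CA.ideal_power_mult[OF CI_ideal, of "r i" "Suc 0" "gen_diff i" "Suc 0"] mr(1)[OF that]
        gen_diff_CI[OF that] unfolding CA.ideal_power_one[OF CI_ideal] by blast
    then show ?thesis
      using CA.ideal_finsum[OF CA.ideal_power_ideal[OF CI_ideal, of "Suc (Suc 0)"], of "{..<k}"]
      by (simp add: numeral_2_eq_2)
  qed
  ultimately show ?thesis by blast
qed

lemma expansion:
  "y \<in> carrier CA \<Longrightarrow> \<exists>c. \<exists>r\<in>ideal_power CA CI n. y = word_sum_below CA k gen_diff n c \<oplus>\<^bsub>CA\<^esub> r"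
  using ring_expansion[OF CI_ideal gen_diff_CI CA_eq_scalar_plus_CI CI_linear_part] .

text \<open>Since the quotient by a power of the augmentation ideal is finite and that power is an
  intersection of preimages of ideals at finite levels, it is already detected at one level.\<close>

lemma CI_power_open:
  "\<exists>N\<in>ons. \<forall>y\<in>carrier CA. y N \<in> ideal_power (QA N) (QI N) n \<longrightarrow> y \<in> ideal_power CA CI n"
proof -
  let ?reps = "range (word_sum_below CA k gen_diff n)"
  have fin: "finite ?reps"
    by (rule finite_word_sums_below[OF CA_char]) (use prime_gt_0_nat[OF prime_p] in simp)
  let ?bad = "?reps - ideal_power CA CI n"
  have "\<exists>N\<in>ons. b N \<notin> ideal_power (QA N) (QI N) n" if "b \<in> ?bad" for b
    using that CI_powerI[of b n] by auto
  then obtain lev where lev: "\<And>b. b \<in> ?bad \<Longrightarrow> lev b \<in> ons"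
    "\<And>b. b \<in> ?bad \<Longrightarrow> b (lev b) \<notin> ideal_power (QA (lev b)) (QI (lev b)) n" by metis
  obtain L where L: "L \<in> ons" "\<And>b. b \<in> ?bad \<Longrightarrow> L \<subseteq> lev b"
  proof -
    have "finite (lev ` ?bad)" "lev ` ?bad \<subseteq> ons" using fin lev(1) by auto
    from finite_Inter_ons[OF this] obtain L where "L \<in> ons" "\<forall>N\<in>lev ` ?bad. L \<subseteq> N"
      by (elim bexE)
    then show thesis by (intro that[of L]) (simp_all only: ball_simps)
  qed
  interpret L: finite_group_algebra "G Mod L" p by (rule quotient_group_algebra[OF L(1)])
  interpret h: ring_hom_ring CA "QA L" "\<lambda>y. y L" by (rule component_ring_hom_ring[OF L(1)])
  have "y \<in> ideal_power CA CI n" if y: "y \<in> carrier CA" "y L \<in> ideal_power (QA L) (QI L) n" for y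
  proof -
    obtain c r where r: "r \<in> ideal_power CA CI n" "y = word_sum_below CA k gen_diff n c \<oplus>\<^bsub>CA\<^esub> r"
      using expansion[OF y(1)] by blast
    let ?b = "word_sum_below CA k gen_diff n c"
    have rc: "r \<in> carrier CA" by (rule CA.ideal_power_closed[OF CI_ideal r(1)])
    have "?b L \<oplus>\<^bsub>QA L\<^esub> r L \<in> ideal_power (QA L) (QI L) n"
      using y(2) r(2) rc by simp
    then have bL: "?b L \<in> ideal_power (QA L) (QI L) n"
      by (rule L.A.ideal_add_cancel[OF L.A.ideal_power_ideal[OF L.aug_ideal_ideal]
            CA_component[OF word_sum_below_closed L(1)] CI_power_component[OF r(1) L(1)]])
    have "?b \<in> ideal_power CA CI n"
    proof (rule ccontr)
      assume "?b \<notin> ideal_power CA CI n"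
      then have bad: "?b \<in> ?bad" by blast
      have "tr L (lev ?b) (?b L) \<in> ideal_power (QA (lev ?b)) (QI (lev ?b)) n"
        by (rule tr_QI_power[OF L(1) lev(1)[OF bad] L(2)[OF bad] bL])
      then show False
        using lev(2)[OF bad] CA_compatible[OF word_sum_below_closed L(1) lev(1)[OF bad] L(2)[OF bad]] by simp
    qed
    then show ?thesis
      unfolding r(2) by (rule CA.ideal_add[OF CA.ideal_power_ideal[OF CI_ideal] _ r(1)])
  qed
  then show ?thesis using L(1) by blast
qed

corollary dimension_subgroup_open:
  "\<exists>N\<in>ons. \<forall>g\<in>N. group_element g \<ominus>\<^bsub>CA\<^esub> \<one>\<^bsub>CA\<^esub> \<in> ideal_power CA CI n"
proof -
  obtain N where N: "N \<in> ons"
    "\<And>y. y \<in> carrier CA \<Longrightarrow> y N \<in> ideal_power (QA N) (QI N) n \<Longrightarrow> y \<in> ideal_power CA CI n"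
    using CI_power_open by blast
  interpret N: finite_group_algebra "G Mod N" p by (rule quotient_group_algebra[OF N(1)])
  have "group_element g \<ominus>\<^bsub>CA\<^esub> \<one>\<^bsub>CA\<^esub> \<in> ideal_power CA CI n" if g: "g \<in> N" for g
  proof (rule N(2))
    have gc: "g \<in> carrier G" using g subgroup.subset[OF ons_subgroup[OF N(1)]] by blast
    then show "group_element g \<ominus>\<^bsub>CA\<^esub> \<one>\<^bsub>CA\<^esub> \<in> carrier CA" by (auto simp: group_element_closed)
    have "N #> g = N" by (rule coset_join2[OF gc ons_subgroup[OF N(1)] g])
    then have "(group_element g \<ominus>\<^bsub>CA\<^esub> \<one>\<^bsub>CA\<^esub>) N = \<zero>\<^bsub>QA N\<^esub>"
      using group_element_minus_one_component[OF gc N(1)] N.A.r_neg[OF N.A.one_closed]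
      by (simp add: N.A.minus_eq N.A_one[symmetric, simplified])
    then show "(group_element g \<ominus>\<^bsub>CA\<^esub> \<one>\<^bsub>CA\<^esub>) N \<in> ideal_power (QA N) (QI N) n"
      using N.A.ideal_zero[OF N.A.ideal_power_ideal[OF N.aug_ideal_ideal]] by simp
  qed
  then show ?thesis using N(1) by blast
qed

end

section \<open>Dimensions of the graded pieces\<close>

(* Powers are kept folded from here on: the lemmas about their quotients match them as powers. *)
declare ideal_power.simps(2) [simp del]

primrec words :: "nat \<Rightarrow> nat \<Rightarrow> nat list list"
  where
    "words k 0 = [[]]"
  | "words k (Suc n) = concat (map (\<lambda>i. map ((#) i) (words k n)) [0..<k])"

lemma length_words: "length (words k n) = k ^ n"
  by (induction n) (auto simp: length_concat comp_def sum_list_triv)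

lemma set_words: "set (words k n) = {v. length v = n \<and> set v \<subseteq> {..<k}}"
proof (induction n)
  case (Suc n)
  show ?case
  proof (intro equalityI subsetI)
    fix v assume "v \<in> {v. length v = Suc n \<and> set v \<subseteq> {..<k}}"
    then show "v \<in> set (words k (Suc n))" using Suc by (cases v) auto
  qed (use Suc in auto)
qed auto

lemma distinct_words: "distinct (words k n)"
proof (induction n)
  case (Suc n)
  have "distinct (concat (map (\<lambda>i. map ((#) i) (words k n)) [0..<m]))" for m
    using Suc by (induction m) (auto simp: distinct_map inj_on_def)
  then show ?case by simp
qed simp

primrec monomial :: "('r, 'm) ring_scheme \<Rightarrow> (nat \<Rightarrow> 'r) \<Rightarrow> nat list \<Rightarrow> 'r"
  where
    "monomial R x [] = \<one>\<^bsub>R\<^esub>"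
  | "monomial R x (i # v) = x i \<otimes>\<^bsub>R\<^esub> monomial R x v"

definition (in ring) list_sum :: "'a list \<Rightarrow> 'a"
  where "list_sum us = foldr (\<oplus>) us \<zero>"

context ring
begin

lemma list_sum_closed: "set us \<subseteq> carrier R \<Longrightarrow> list_sum us \<in> carrier R"
  by (induction us) (auto simp: list_sum_def)

lemma list_sum_append:
  "set us \<subseteq> carrier R \<Longrightarrow> set vs \<subseteq> carrier R \<Longrightarrow> list_sum (us @ vs) = list_sum us \<oplus> list_sum vs"
proof (induction us)
  case Nil then show ?case using list_sum_closed[of vs] by (simp add: list_sum_def)
next
  case (Cons u us)
  then show ?case using list_sum_closed[of vs] list_sum_closed[of us]
    by (simp add: list_sum_def a_assoc)
qed

lemma list_sum_mult:
  "a \<in> carrier R \<Longrightarrow> set us \<subseteq> carrier R \<Longrightarrow> a \<otimes> list_sum us = list_sum (map ((\<otimes>) a) us)"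
proof (induction us)
  case (Cons u us)
  then show ?case using list_sum_closed[of us] by (simp add: list_sum_def r_distr)
qed (simp add: list_sum_def)

lemma finsum_eq_list_sum:
  assumes "\<And>i. i < k \<Longrightarrow> set (us i) \<subseteq> carrier R"
  shows "finsum R (\<lambda>i. list_sum (us i)) {..<k} = list_sum (concat (map us [0..<k]))"
  using assms
proof (induction k)
  case 0 then show ?case by (simp add: list_sum_def)
next
  case (Suc k)
  have "finsum R (\<lambda>i. list_sum (us i)) {..<Suc k}
      = list_sum (us k) \<oplus> finsum R (\<lambda>i. list_sum (us i)) {..<k}"
    unfolding lessThan_Suc using Suc.prems list_sum_closed by (intro finsum_insert) auto
  also have "\<dots> = list_sum (concat (map us [0..<Suc k]))"
  proof -
    have sub: "set (concat (map us [0..<k])) \<subseteq> carrier R"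
    proof
      fix u assume "u \<in> set (concat (map us [0..<k]))"
      then obtain i where "i < k" "u \<in> set (us i)" by auto
      then show "u \<in> carrier R" using Suc.prems[of i] by auto
    qed
    have "list_sum (concat (map us [0..<Suc k])) = list_sum (concat (map us [0..<k])) \<oplus> list_sum (us k)"
      using list_sum_append[OF sub Suc.prems[of k]] by simp
    then show ?thesis
      using Suc list_sum_closed[OF sub] list_sum_closed[OF Suc.prems[of k]] by (simp add: a_comm)
  qed
  finally show ?case .
qed

lemma combine_map:
  "combine (map f vs) (map u vs) = list_sum (map (\<lambda>v. f v \<otimes> u v) vs)"
  by (induction vs) (auto simp: list_sum_def)

text \<open>Discarding dependent vectors one at a time keeps the basis inside the given list.\<close>

lemma exists_base_in_list:
  assumes K: "subfield K R" and "set us \<subseteq> carrier R"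
  shows "\<exists>vs. set vs \<subseteq> set us \<and> independent K vs \<and> Span K vs = Span K us"
  using assms(2)
proof (induction us)
  case Nil then show ?case by (intro exI[of _ "[]"]) auto
next
  case (Cons u us)
  then obtain vs where vs: "set vs \<subseteq> set us" "independent K vs" "Span K vs = Span K us" by auto
  have car: "set vs \<subseteq> carrier R" "u \<in> carrier R" using vs Cons.prems by auto
  have Span_eq: "Span K (u # us) = Span K (u # vs)" using vs(3) by simp
  show ?case
  proof (cases "u \<in> Span K vs")
    case True
    have "Span K (u # vs) \<subseteq> Span K vs"
      by (rule mono_Span_subset[OF K _ car(1)]) (use True Span_base_incl[OF K car(1)] in auto)
    then have "Span K vs = Span K (u # us)"
      using mono_Span[OF K car] Span_eq by blast
    then show ?thesis using vs by (intro exI[of _ vs]) auto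
  next
    case False
    then have "independent K (u # vs)" using vs(2) car by (intro li_Cons) auto
    then show ?thesis using vs(1) Span_eq by (intro exI[of _ "u # vs"]) auto
  qed
qed

lemma independent_if_length_eq_dimension:
  assumes K: "subfield K R" and us: "set us \<subseteq> carrier R" and dim: "dimension (length us) K (Span K us)"
  shows "independent K us"
proof -
  obtain vs where vs: "set vs \<subseteq> set us" "independent K vs" "Span K vs = Span K us"
    using exists_base_in_list[OF K us] by blast
  have len: "length vs = length us"
    using dimension_is_inj[OF K dimension_independent[OF vs(2)]] dim vs(3) by simp
  have "card (set vs) = length us"
    using independent_distinct[OF K vs(2)] len by (simp add: distinct_card)
  then have "set vs = set us"
    using vs(1) card_length[of us] by (intro card_seteq) auto
  then show ?thesis using independent_same_set[OF K _ len vs(2)] by blast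
qed

end

context ring_family
begin

lemma monomial_closed: "set v \<subseteq> {..<k} \<Longrightarrow> monomial R x v \<in> carrier R"
  by (induction v) (auto simp: family_closed)

lemma word_sum_eq_list_sum: "ws n c = list_sum (map (\<lambda>v. zmul R (c v) (monomial R x v)) (words k n))"
proof (induction n arbitrary: c)
  case 0 then show ?case by (simp add: list_sum_def)
next
  case (Suc n)
  have closed: "zmul R (c v) (monomial R x v) \<in> carrier R" if "v \<in> set (words k m)" for c v m
    using that by (auto simp: set_words monomial_closed)
  have "ws (Suc n) c
      = finsum R (\<lambda>i. list_sum (map (\<lambda>v. zmul R (c (i # v)) (monomial R x (i # v))) (words k n))) {..<k}"
  proof (subst word_sum.simps, rule finsum_cong')
    fix i assume "i \<in> {..<k}"
    then have i: "x i \<in> carrier R" by (simp add: family_closed)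
    have "x i \<otimes> ws n (\<lambda>v. c (i # v))
        = list_sum (map (\<lambda>v. x i \<otimes> zmul R (c (i # v)) (monomial R x v)) (words k n))"
      unfolding Suc.IH using i closed by (subst list_sum_mult) (auto simp: comp_def)
    also have "map (\<lambda>v. x i \<otimes> zmul R (c (i # v)) (monomial R x v)) (words k n)
        = map (\<lambda>v. zmul R (c (i # v)) (monomial R x (i # v))) (words k n)"
      using i by (auto simp: set_words monomial_closed add_pow_rdistr_int)
    finally show "x i \<otimes> ws n (\<lambda>v. c (i # v))
        = list_sum (map (\<lambda>v. zmul R (c (i # v)) (monomial R x (i # v))) (words k n))" .
  next
    show "(\<lambda>i. list_sum (map (\<lambda>v. zmul R (c (i # v)) (monomial R x (i # v))) (words k n)))
        \<in> {..<k} \<rightarrow> carrier R"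
      by (auto intro!: list_sum_closed simp: set_words monomial_closed family_closed)
  qed simp
  also have "\<dots> = list_sum (concat (map (\<lambda>i.
      map (\<lambda>v. zmul R (c (i # v)) (monomial R x (i # v))) (words k n)) [0..<k]))"
    by (rule finsum_eq_list_sum) (auto simp: set_words monomial_closed family_closed)
  also have "\<dots> = list_sum (map (\<lambda>v. zmul R (c v) (monomial R x v)) (words k (Suc n)))"
    by (simp add: map_concat comp_def)
  finally show ?case .
qed

abbreviation monomials where "monomials n \<equiv> map (monomial R x) (words k n)"

lemma monomials_closed: "set (monomials n) \<subseteq> carrier R"
  by (auto simp: set_words monomial_closed)

lemma word_sum_eq_combine:
  "ws n c = combine (map (\<lambda>v. zmul R (c v) \<one>) (words k n)) (monomials n)"
proof -
  have eq: "map (\<lambda>v. zmul R (c v) (monomial R x v)) (words k n)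
      = map (\<lambda>v. zmul R (c v) \<one> \<otimes> monomial R x v) (words k n)"
    by (auto simp: set_words monomial_closed int_smult_eq_mult_one[symmetric])
  show ?thesis unfolding combine_map word_sum_eq_list_sum eq ..
qed

lemma Span_monomials:
  assumes K: "subfield K R" and K_eq: "K = range (\<lambda>m. zmul R m \<one>)"
  shows "Span K (monomials n) = range (ws n)"
proof
  show "range (ws n) \<subseteq> Span K (monomials n)"
  proof
    fix y assume "y \<in> range (ws n)"
    then obtain c where y: "y = ws n c" by blast
    have "set (map (\<lambda>v. zmul R (c v) \<one>) (words k n)) \<subseteq> K" using K_eq by auto
    then show "y \<in> Span K (monomials n)"
      unfolding y word_sum_eq_combine Span_eq_combine_set[OF K monomials_closed] by blast
  qed
  show "Span K (monomials n) \<subseteq> range (ws n)"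
  proof
    fix y assume "y \<in> Span K (monomials n)"
    then obtain ks where ks: "set ks \<subseteq> K" "length ks = length (words k n)" "y = combine ks (monomials n)"
      unfolding Span_mem_iff_length_version[OF K monomials_closed] by auto
    have "\<exists>m. ks ! i = zmul R m \<one>" if "i < length ks" for i
      using ks(1) nth_mem[OF that] K_eq by blast
    then obtain m where m: "\<And>i. i < length ks \<Longrightarrow> ks ! i = zmul R (m i) \<one>" by metis
    \<comment> \<open>The words are distinct, so a list of coefficients is a function of the word.\<close>
    define c where "c v = m (THE i. i < length ks \<and> words k n ! i = v)" for v
    have "ks = map (\<lambda>v. zmul R (c v) \<one>) (words k n)"
    proof (rule nth_equalityI)
      fix i assume i: "i < length ks"
      have "(THE j. j < length ks \<and> words k n ! j = words k n ! i) = i"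
        using i ks(2) distinct_words[of k n] by (auto simp: nth_eq_iff_index_eq)
      then show "ks ! i = map (\<lambda>v. zmul R (c v) \<one>) (words k n) ! i"
        using i ks(2) m by (simp add: c_def)
    qed (use ks in simp)
    then have "y = ws n c" using ks(3) word_sum_eq_combine by simp
    then show "y \<in> range (ws n)" by blast
  qed
qed

end

context pro_p
begin

abbreviation graded_ring where "graded_ring n \<equiv> CA Quot ideal_power CA CI (Suc n)"
abbreviation graded_class where "graded_class n y \<equiv> ideal_power CA CI (Suc n) +>\<^bsub>CA\<^esub> y"
abbreviation graded_scalars where
  "graded_scalars n \<equiv> (\<lambda>c. graded_class n (completed_scalar G T c)) ` carrier (Fp p)"
abbreviation graded_piece where "graded_piece n \<equiv> graded_class n ` ideal_power CA CI n"

lemma graded_dim_eq: "graded_dim p G T n = ring.dim (graded_ring n) (graded_scalars n) (graded_piece n)"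
  unfolding graded_dim_def Let_def ..

lemma graded_class_hom: "ring_hom_ring CA (graded_ring n) (graded_class n)"
  by (rule ideal.rcos_ring_hom_ring[OF CA.ideal_power_ideal[OF CI_ideal]])

lemma one_not_in_CI: "\<one>\<^bsub>CA\<^esub> \<notin> CI"
proof
  assume "\<one>\<^bsub>CA\<^esub> \<in> CI"
  then have "augmentation p G \<one>\<^bsub>CA\<^esub> = 0"
    by (auto simp: augmentation_ideal_def a_kernel_def')
  moreover interpret aug: ring_hom_ring CA "Fp p" "augmentation p G"
    by (rule augmentation_ring_hom_ring)
  have "augmentation p G \<one>\<^bsub>CA\<^esub> = 1" using aug.hom_one by simp
  ultimately show False by simp
qed

lemma graded_class_eq_iff:
  assumes "y \<in> carrier CA" "z \<in> carrier CA"
  shows "graded_class n y = graded_class n z \<longleftrightarrow> y \<ominus>\<^bsub>CA\<^esub> z \<in> ideal_power CA CI (Suc n)"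
  using CA.quotient_eq_iff_same_a_r_cos[OF CA.ideal_power_ideal[OF CI_ideal] assms] by simp

lemma graded_class_zero_iff:
  assumes "y \<in> carrier CA"
  shows "graded_class n y = \<zero>\<^bsub>graded_ring n\<^esub> \<longleftrightarrow> y \<in> ideal_power CA CI (Suc n)"
proof -
  interpret h: ring_hom_ring CA "graded_ring n" "graded_class n" by (rule graded_class_hom)
  have "graded_class n \<zero>\<^bsub>CA\<^esub> = \<zero>\<^bsub>graded_ring n\<^esub>" by (rule h.hom_zero)
  then show ?thesis
    using graded_class_eq_iff[OF assms CA.zero_closed, of n] assms by (simp add: CA.minus_eq)
qed

lemma field_Fp: "field (Fp p)"
proof -
  interpret residues_prime p "Fp p" by unfold_locales (use prime_p in simp_all)
  show ?thesis by (rule is_field)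
qed

lemma graded_scalars_eq: "graded_scalars n = range (\<lambda>m. zmul (graded_ring n) m \<one>\<^bsub>graded_ring n\<^esub>)"
proof -
  interpret h: ring_hom_ring CA "graded_ring n" "graded_class n" by (rule graded_class_hom)
  have eq: "graded_class n (completed_scalar G T c) = zmul (graded_ring n) c \<one>\<^bsub>graded_ring n\<^esub>"
    if "c \<in> carrier (Fp p)" for c
    using completed_scalar_eq[OF that] h.hom_int_smult[OF CA.one_closed] by simp
  have char: "zmul (graded_ring n) (int p) \<one>\<^bsub>graded_ring n\<^esub> = \<zero>\<^bsub>graded_ring n\<^esub>"
    using h.hom_int_smult[OF CA.one_closed, of "int p"] CA_char by simp
  show ?thesis
  proof
    show "graded_scalars n \<subseteq> range (\<lambda>m. zmul (graded_ring n) m \<one>\<^bsub>graded_ring n\<^esub>)" using eq by blast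
    show "range (\<lambda>m. zmul (graded_ring n) m \<one>\<^bsub>graded_ring n\<^esub>) \<subseteq> graded_scalars n"
    proof clarify
      fix m
      have "m mod int p \<in> carrier (Fp p)" using prime_gt_0_nat[OF prime_p] by simp
      moreover have "zmul (graded_ring n) m \<one>\<^bsub>graded_ring n\<^esub> = graded_class n (completed_scalar G T (m mod int p))"
        using eq[OF calculation] h.S.int_smult_mod[OF char h.S.one_closed, of m] by simp
      ultimately show "zmul (graded_ring n) m \<one>\<^bsub>graded_ring n\<^esub> \<in> graded_scalars n" by blast
    qed
  qed
qed

lemma graded_one_not_zero: "\<one>\<^bsub>graded_ring n\<^esub> \<noteq> \<zero>\<^bsub>graded_ring n\<^esub>"
proof -
  interpret h: ring_hom_ring CA "graded_ring n" "graded_class n" by (rule graded_class_hom)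
  have "\<one>\<^bsub>CA\<^esub> \<notin> ideal_power CA CI (Suc n)"
    using one_not_in_CI CA.ideal_power_antimono[OF CI_ideal, of "Suc 0" "Suc n"]
    unfolding CA.ideal_power_one[OF CI_ideal] by blast
  then show ?thesis using graded_class_zero_iff[OF CA.one_closed, of n] h.hom_one by simp
qed

lemma graded_scalar_hom:
  "ring_hom_ring (Fp p) (graded_ring n) (\<lambda>m. zmul (graded_ring n) m \<one>\<^bsub>graded_ring n\<^esub>)"
proof -
  interpret h: ring_hom_ring CA "graded_ring n" "graded_class n" by (rule graded_class_hom)
  have char: "zmul (graded_ring n) (int p) \<one>\<^bsub>graded_ring n\<^esub> = \<zero>\<^bsub>graded_ring n\<^esub>"
    using h.hom_int_smult[OF CA.one_closed, of "int p"] CA_char by simp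
  show ?thesis
    by (rule ring_hom_ringI2[OF cring.axioms(1)[OF fieldE(1)[OF field_Fp]] h.S.ring_axioms ring_hom_memI])
      (simp_all add: h.S.int_smult_mod[OF char] h.S.int_smult_add h.S.int_smult_mult h.S.int_smult_one
        h.S.add_pow_ldistr_int)
qed

lemma graded_scalars_subfield: "subfield (graded_scalars n) (graded_ring n)"
proof -
  interpret c: ring_hom_ring "Fp p" "graded_ring n" "\<lambda>m. zmul (graded_ring n) m \<one>\<^bsub>graded_ring n\<^esub>"
    by (rule graded_scalar_hom)
  interpret h: ring_hom_ring CA "graded_ring n" "graded_class n" by (rule graded_class_hom)
  have "subfield ((\<lambda>m. zmul (graded_ring n) m \<one>\<^bsub>graded_ring n\<^esub>) ` carrier (Fp p)) (graded_ring n)"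
    by (rule c.img_is_subfield(2)[OF field.carrier_is_subfield[OF field_Fp] graded_one_not_zero])
  moreover have "graded_scalars n = (\<lambda>m. zmul (graded_ring n) m \<one>\<^bsub>graded_ring n\<^esub>) ` carrier (Fp p)"
    using completed_scalar_eq h.hom_int_smult[OF CA.one_closed] by (intro image_cong refl) simp
  ultimately show ?thesis by simp
qed

lemma dvd_if_graded_scalar_zero:
  assumes "zmul (graded_ring n) m \<one>\<^bsub>graded_ring n\<^esub> = \<zero>\<^bsub>graded_ring n\<^esub>"
  shows "int p dvd m"
proof -
  interpret c: ring_hom_ring "Fp p" "graded_ring n" "\<lambda>m. zmul (graded_ring n) m \<one>\<^bsub>graded_ring n\<^esub>"
    by (rule graded_scalar_hom)
  interpret h: ring_hom_ring CA "graded_ring n" "graded_class n" by (rule graded_class_hom)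
  have char: "zmul (graded_ring n) (int p) \<one>\<^bsub>graded_ring n\<^esub> = \<zero>\<^bsub>graded_ring n\<^esub>"
    using h.hom_int_smult[OF CA.one_closed, of "int p"] CA_char by simp
  have inj: "inj_on (\<lambda>m. zmul (graded_ring n) m \<one>\<^bsub>graded_ring n\<^esub>) (carrier (Fp p))"
    by (rule c.img_is_subfield(1)[OF field.carrier_is_subfield[OF field_Fp] graded_one_not_zero])
  have "zmul (graded_ring n) (m mod int p) \<one>\<^bsub>graded_ring n\<^esub> = zmul (graded_ring n) 0 \<one>\<^bsub>graded_ring n\<^esub>"
    using assms c.S.int_smult_mod[OF char c.S.one_closed, of m] c.S.int_smult_zero by simp
  then have "m mod int p = 0"
    by (rule inj_onD[OF inj]) (use prime_gt_0_nat[OF prime_p] in auto)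
  then show ?thesis by auto
qed

text \<open>The equality of sets turns the graded piece into the span of an explicit list, which makes its
  dimension meaningful and comparable with the number of monomials.\<close>

lemma graded_piece_eq_Span:
  assumes x: "\<And>i. i < k \<Longrightarrow> x i \<in> CI"
    and gen: "\<And>y. y \<in> CI \<Longrightarrow> \<exists>c. \<exists>r\<in>ideal_power CA CI 2. y = word_sum CA k x (Suc 0) c \<oplus>\<^bsub>CA\<^esub> r"
  shows "graded_piece n = ring.Span (graded_ring n) (graded_scalars n)
    (map (monomial (graded_ring n) (\<lambda>i. graded_class n (x i))) (words k n))"
proof -
  have xc: "x i \<in> carrier CA" if "i < k" for i using x[OF that] CI_iff by blast
  interpret h: ring_hom_ring CA "graded_ring n" "graded_class n" by (rule graded_class_hom)
  interpret F: ring_family CA k x by unfold_locales (rule xc)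
  interpret FQ: ring_family "graded_ring n" k "\<lambda>i. graded_class n (x i)"
    by unfold_locales (rule h.hom_closed[OF xc])
  have "graded_piece n = range (word_sum (graded_ring n) k (\<lambda>i. graded_class n (x i)) n)"
  proof
    show "graded_piece n \<subseteq> range (word_sum (graded_ring n) k (\<lambda>i. graded_class n (x i)) n)"
    proof clarify
      fix y assume y: "y \<in> ideal_power CA CI n"
      obtain c r where r: "r \<in> ideal_power CA CI (Suc n)" "y = word_sum CA k x n c \<oplus>\<^bsub>CA\<^esub> r"
        using F.ideal_power_expansion[OF CI_ideal x CA_eq_scalar_plus_CI gen y] by blast
      have rc: "r \<in> carrier CA" by (rule CA.ideal_power_closed[OF CI_ideal r(1)])
      have "graded_class n y = graded_class n (word_sum CA k x n c) \<oplus>\<^bsub>graded_ring n\<^esub> graded_class n r"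
        unfolding r(2) by (rule h.hom_add[OF F.word_sum_closed rc])
      also have "graded_class n r = \<zero>\<^bsub>graded_ring n\<^esub>" using graded_class_zero_iff[OF rc] r(1) by blast
      also have "graded_class n (word_sum CA k x n c) \<oplus>\<^bsub>graded_ring n\<^esub> \<zero>\<^bsub>graded_ring n\<^esub>
          = graded_class n (word_sum CA k x n c)"
        by (rule h.S.r_zero[OF h.hom_closed[OF F.word_sum_closed]])
      also have "\<dots> = word_sum (graded_ring n) k (\<lambda>i. graded_class n (x i)) n c"
        by (rule h.hom_word_sum[OF xc])
      finally have eq: "graded_class n y = word_sum (graded_ring n) k (\<lambda>i. graded_class n (x i)) n c" .
      show "graded_class n y \<in> range (word_sum (graded_ring n) k (\<lambda>i. graded_class n (x i)) n)"
        unfolding eq by (rule rangeI)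
    qed
    show "range (word_sum (graded_ring n) k (\<lambda>i. graded_class n (x i)) n) \<subseteq> graded_piece n"
    proof clarify
      fix c
      have "word_sum (graded_ring n) k (\<lambda>i. graded_class n (x i)) n c = graded_class n (word_sum CA k x n c)"
        by (rule h.hom_word_sum[OF xc, symmetric])
      then show "word_sum (graded_ring n) k (\<lambda>i. graded_class n (x i)) n c \<in> graded_piece n"
        using F.word_sum_in_ideal_power[OF CI_ideal x] by (rule image_eqI)
    qed
  qed
  then show ?thesis
    using FQ.Span_monomials[OF graded_scalars_subfield graded_scalars_eq, of n] by simp
qed

text \<open>The monomials are as many as the dimension of their span, hence a basis of it.\<close>

lemma dvd_coeffs_if_dimension_eq:
  assumes x: "\<And>i. i < k \<Longrightarrow> x i \<in> CI"
    and gen: "\<And>y. y \<in> CI \<Longrightarrow> \<exists>c. \<exists>r\<in>ideal_power CA CI 2. y = word_sum CA k x (Suc 0) c \<oplus>\<^bsub>CA\<^esub> r"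
    and dim: "ring.dimension (graded_ring n) (k ^ n) (graded_scalars n) (graded_piece n)"
    and c: "word_sum CA k x n c \<in> ideal_power CA CI (Suc n)"
    and v: "length v = n" "set v \<subseteq> {..<k}"
  shows "int p dvd c v"
proof -
  have xc: "x i \<in> carrier CA" if "i < k" for i using x[OF that] CI_iff by blast
  interpret h: ring_hom_ring CA "graded_ring n" "graded_class n" by (rule graded_class_hom)
  interpret F: ring_family CA k x by unfold_locales (rule xc)
  interpret FQ: ring_family "graded_ring n" k "\<lambda>i. graded_class n (x i)"
    by unfold_locales (rule h.hom_closed[OF xc])
  note K = graded_scalars_subfield[of n]
  have Span_eq: "graded_piece n = h.S.Span (graded_scalars n) (FQ.monomials n)"
    by (rule graded_piece_eq_Span[OF x gen])
  have indep: "h.S.independent (graded_scalars n) (FQ.monomials n)"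
    by (rule h.S.independent_if_length_eq_dimension[OF K FQ.monomials_closed])
      (use dim Span_eq in \<open>simp add: length_words\<close>)
  let ?ks = "map (\<lambda>v. zmul (graded_ring n) (c v) \<one>\<^bsub>graded_ring n\<^esub>) (words k n)"
  have "h.S.combine ?ks (FQ.monomials n) = graded_class n (word_sum CA k x n c)"
    unfolding FQ.word_sum_eq_combine[symmetric] by (rule h.hom_word_sum[OF xc, symmetric])
  also have "\<dots> = \<zero>\<^bsub>graded_ring n\<^esub>" using graded_class_zero_iff[OF F.word_sum_closed] c by blast
  finally have zero: "h.S.combine ?ks (FQ.monomials n) = \<zero>\<^bsub>graded_ring n\<^esub>" .
  have ks: "set ?ks \<subseteq> graded_scalars n"
    unfolding graded_scalars_eq by auto
  have "set (take (length (FQ.monomials n)) ?ks) \<subseteq> {\<zero>\<^bsub>graded_ring n\<^esub>}"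
    by (rule h.S.independent_imp_trivial_combine[OF K indep ks zero])
  then have "zmul (graded_ring n) (c v) \<one>\<^bsub>graded_ring n\<^esub> = \<zero>\<^bsub>graded_ring n\<^esub>"
    using v by (auto simp: set_words)
  then show ?thesis by (rule dvd_if_graded_scalar_zero)
qed

end

context generated_pro_p
begin

lemma graded_dimension:
  "ring.dimension (graded_ring n) (graded_dim p G T n) (graded_scalars n) (graded_piece n)"
proof -
  interpret h: ring_hom_ring CA "graded_ring n" "graded_class n" by (rule graded_class_hom)
  interpret FQ: ring_family "graded_ring n" k "\<lambda>i. graded_class n (gen_diff i)"
    by unfold_locales (rule h.hom_closed[OF gen_diff_closed])
  note K = graded_scalars_subfield[of n]
  have Span_eq: "graded_piece n = h.S.Span (graded_scalars n) (FQ.monomials n)"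
    by (rule graded_piece_eq_Span[OF gen_diff_CI CI_linear_part])
  have "h.S.finite_dimension (graded_scalars n) (graded_piece n)"
    unfolding Span_eq
    by (rule h.S.Span_finite_dimension[OF K FQ.monomials_closed])
  then show ?thesis using h.S.finite_dimensionE[OF K] unfolding graded_dim_eq over_def by blast
qed

text \<open>The basis of the first graded piece has to consist of classes of differences \<open>g - 1\<close> with \<open>g\<close> in the
  group; therefore it is selected from the classes that belong to the given generators.\<close>

lemma exists_minimal_generators:
  assumes "graded_dim p G T (Suc 0) = d"
  shows "\<exists>x. (\<forall>i<d. x i \<in> carrier G) \<and> (\<forall>y\<in>CI. \<exists>c. \<exists>r\<in>ideal_power CA CI 2.
    y = word_sum CA d (\<lambda>i. group_element (x i) \<ominus>\<^bsub>CA\<^esub> \<one>\<^bsub>CA\<^esub>) (Suc 0) c \<oplus>\<^bsub>CA\<^esub> r)"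
proof -
  let ?n = "Suc 0"
  interpret h: ring_hom_ring CA "graded_ring ?n" "graded_class ?n" by (rule graded_class_hom)
  interpret FQ: ring_family "graded_ring ?n" k "\<lambda>i. graded_class ?n (gen_diff i)"
    by unfold_locales (rule h.hom_closed[OF gen_diff_closed])
  note K = graded_scalars_subfield[of ?n]
  have Span_eq: "graded_piece ?n = h.S.Span (graded_scalars ?n) (FQ.monomials ?n)"
    by (rule graded_piece_eq_Span[OF gen_diff_CI CI_linear_part])
  obtain vs where vs: "set vs \<subseteq> set (FQ.monomials ?n)" "h.S.independent (graded_scalars ?n) vs"
    "h.S.Span (graded_scalars ?n) vs = graded_piece ?n"
    using h.S.exists_base_in_list[OF K FQ.monomials_closed[of ?n]] Span_eq by auto
  have len: "length vs = d"
    using h.S.dimension_is_inj[OF K h.S.dimension_independent[OF vs(2)]] graded_dimension[of ?n] vs(3) assms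
    by simp
  have "\<exists>j<k. vs ! i = graded_class ?n (gen_diff j)" if "i < d" for i
  proof -
    have "vs ! i \<in> set vs" using len that by simp
    then have "vs ! i \<in> monomial (graded_ring ?n) (\<lambda>i. graded_class ?n (gen_diff i)) ` {v. length v = ?n \<and> set v \<subseteq> {..<k}}"
      using vs(1) unfolding set_map set_words by blast
    then obtain v where v: "length v = ?n" "set v \<subseteq> {..<k}"
      "vs ! i = monomial (graded_ring ?n) (\<lambda>i. graded_class ?n (gen_diff i)) v"
      by blast
    then obtain j where j: "v = [j]" "j < k" by (auto simp: length_Suc_conv)
    have "monomial (graded_ring ?n) (\<lambda>i. graded_class ?n (gen_diff i)) [j] = graded_class ?n (gen_diff j)"
      unfolding monomial.simps by (rule h.S.r_one[OF h.hom_closed[OF gen_diff_closed[OF j(2)]]])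
    then show ?thesis using v(3) j by auto
  qed
  then obtain j where j: "\<And>i. i < d \<Longrightarrow> j i < k" "\<And>i. i < d \<Longrightarrow> vs ! i = graded_class ?n (gen_diff (j i))"
    by metis
  let ?x = "\<lambda>i. s (j i)"
  let ?g = "\<lambda>i. gen_diff (j i)"
  have gc: "?g i \<in> carrier CA" if "i < d" for i by (rule gen_diff_closed[OF j(1)[OF that]])
  interpret F: ring_family CA d ?g by unfold_locales (rule gc)
  interpret FQ': ring_family "graded_ring ?n" d "\<lambda>i. graded_class ?n (?g i)"
    by unfold_locales (rule h.hom_closed[OF gc])
  have words_1: "words d ?n = map (\<lambda>i. [i]) [0..<d]" for d
    by (simp add: map_concat comp_def)
  have vs_eq: "vs = FQ'.monomials ?n"
  proof (rule nth_equalityI)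
    fix i assume "i < length vs"
    then have i: "i < d" using len by simp
    have "FQ'.monomials ?n ! i = graded_class ?n (?g i) \<otimes>\<^bsub>graded_ring ?n\<^esub> \<one>\<^bsub>graded_ring ?n\<^esub>"
      unfolding words_1 using i by simp
    then show "vs ! i = FQ'.monomials ?n ! i"
      using h.S.r_one[OF h.hom_closed[OF gc[OF i]]] j(2)[OF i] by simp
  qed (use len in \<open>simp add: length_words del: words.simps\<close>)
  have "\<exists>c. \<exists>r\<in>ideal_power CA CI 2. y = word_sum CA d ?g (Suc 0) c \<oplus>\<^bsub>CA\<^esub> r" if y: "y \<in> CI" for y
  proof -
    have yc: "y \<in> carrier CA" using y CI_iff by blast
    have "y \<in> ideal_power CA CI ?n" using y unfolding CA.ideal_power_one[OF CI_ideal] .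
    then have "graded_class ?n y \<in> graded_piece ?n" by (rule imageI)
    then have "graded_class ?n y \<in> range (word_sum (graded_ring ?n) d (\<lambda>i. graded_class ?n (?g i)) ?n)"
      unfolding FQ'.Span_monomials[OF K graded_scalars_eq, symmetric] vs_eq[symmetric] vs(3) .
    then obtain c where "graded_class ?n y = word_sum (graded_ring ?n) d (\<lambda>i. graded_class ?n (?g i)) ?n c"
      by (rule rangeE)
    also have "\<dots> = graded_class ?n (word_sum CA d ?g ?n c)" by (rule h.hom_word_sum[OF gc, symmetric])
    finally have r: "y \<ominus>\<^bsub>CA\<^esub> word_sum CA d ?g ?n c \<in> ideal_power CA CI (Suc ?n)"
      unfolding graded_class_eq_iff[OF yc F.word_sum_closed] .
    have "y = word_sum CA d ?g ?n c \<oplus>\<^bsub>CA\<^esub> (y \<ominus>\<^bsub>CA\<^esub> word_sum CA d ?g ?n c)"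
      by (rule CA.add_diff_cancel[OF yc F.word_sum_closed])
    then show ?thesis using r unfolding numeral_2_eq_2 by blast
  qed
  then show ?thesis using s_closed j(1) by (intro exI[of _ ?x]) blast
qed

end

section \<open>Free groups\<close>

definition word_class :: "'x set \<Rightarrow> ('x \<times> bool) list \<Rightarrow> ('x \<times> bool) list set"
  where "word_class S u = word_rel S `` {u}"

abbreviation letters :: "'x set \<Rightarrow> ('x \<times> bool) list set"
  where "letters S \<equiv> lists (S \<times> UNIV)"

definition inverse_word :: "('x \<times> bool) list \<Rightarrow> ('x \<times> bool) list"
  where "inverse_word w = map (\<lambda>l. (fst l, \<not> snd l)) (rev w)"

lemma cancels_append_right: "cancels S u v \<Longrightarrow> cancels S (u @ w) (v @ w)"
proof (induction rule: cancels.induct)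
  case (1 x u b v)
  then show ?case using cancels.intros[of x S u b "v @ w"] by simp
qed

lemma cancels_append_left: "cancels S u v \<Longrightarrow> cancels S (w @ u) (w @ v)"
proof (induction rule: cancels.induct)
  case (1 x u b v)
  then show ?case using cancels.intros[of x S "w @ u" b v] by simp
qed

lemma equivclp_map:
  assumes "equivclp r u v" "\<And>u v. r u v \<Longrightarrow> r (f u) (f v)"
  shows "equivclp r (f u) (f v)"
  using assms(1)
proof (induction rule: equivclp_induct)
  case (step y z)
  then have "r (f y) (f z) \<or> r (f z) (f y)" using assms(2) by blast
  then show ?case using step.IH equivclp_into_equivclp by metis
qed simp

lemma equivclp_append:
  assumes "equivclp (cancels S) u u'" "equivclp (cancels S) v v'"
  shows "equivclp (cancels S) (u @ v) (u' @ v')"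
proof -
  have "equivclp (cancels S) (u @ v) (u' @ v)"
    by (rule equivclp_map[OF assms(1), of "\<lambda>u. u @ v"]) (rule cancels_append_right)
  also have "equivclp (cancels S) (u' @ v) (u' @ v')"
    by (rule equivclp_map[OF assms(2), of "\<lambda>v. u' @ v"]) (rule cancels_append_left)
  finally (equivclp_trans) show ?thesis .
qed

lemma equiv_word_rel: "equiv (letters S) (word_rel S)"
proof (rule equivI)
  show "word_rel S \<subseteq> letters S \<times> letters S" by (auto simp: word_rel_def)
  show "refl_on (letters S) (word_rel S)" by (auto simp: refl_on_def word_rel_def)
  show "sym (word_rel S)" by (auto simp: sym_def word_rel_def intro: equivclp_sym)
  show "trans (word_rel S)" by (auto simp: trans_def word_rel_def intro: equivclp_trans)
qed

lemma word_class_eq_iff: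
  "u \<in> letters S \<Longrightarrow> v \<in> letters S \<Longrightarrow> word_class S u = word_class S v \<longleftrightarrow> equivclp (cancels S) u v"
  unfolding word_class_def by (subst eq_equiv_class_iff[OF equiv_word_rel]) (simp_all add: word_rel_def)

lemma in_word_class: "u \<in> letters S \<Longrightarrow> u \<in> word_class S u"
  using equiv_class_self[OF equiv_word_rel] by (simp add: word_class_def)

lemma word_classD: "v \<in> word_class S u \<Longrightarrow> v \<in> letters S \<and> word_class S v = word_class S u"
  unfolding word_class_def using equiv_class_eq[OF equiv_word_rel, of u v] by (auto simp: word_rel_def)

lemma carrier_free_group: "carrier (free_group S) = word_class S ` letters S"
  by (auto simp: free_group_def quotient_def word_class_def)

lemma mult_free_group:
  assumes "u \<in> letters S" "v \<in> letters S"
  shows "word_class S u \<otimes>\<^bsub>free_group S\<^esub> word_class S v = word_class S (u @ v)"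
proof -
  have eq: "word_rel S `` {u' @ v'} = word_class S (u @ v)"
    if "u' \<in> word_class S u" "v' \<in> word_class S v" for u' v'
  proof -
    have l: "u' \<in> letters S" "v' \<in> letters S" "word_class S u' = word_class S u" "word_class S v' = word_class S v"
      using that word_classD by blast+
    then have "equivclp (cancels S) (u' @ v') (u @ v)"
      using assms by (intro equivclp_append) (simp_all only: word_class_eq_iff[symmetric])
    then show ?thesis
      using l assms word_class_eq_iff[of "u' @ v'" S "u @ v"] by (simp add: word_class_def)
  qed
  have "word_class S u \<otimes>\<^bsub>free_group S\<^esub> word_class S v
      = (\<Union>u'\<in>word_class S u. \<Union>v'\<in>word_class S v. word_rel S `` {u' @ v'})"
    by (simp add: free_group_def)
  also have "\<dots> = (\<Union>u'\<in>word_class S u. \<Union>v'\<in>word_class S v. word_class S (u @ v))"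
    using eq by simp
  also have "\<dots> = word_class S (u @ v)"
    using in_word_class[OF assms(1)] in_word_class[OF assms(2)] by auto
  finally show ?thesis .
qed

lemma one_free_group: "\<one>\<^bsub>free_group S\<^esub> = word_class S []"
  by (simp add: free_group_def word_class_def)

lemma inverse_word_letters: "w \<in> letters S \<Longrightarrow> inverse_word w \<in> letters S"
  by (auto simp: inverse_word_def in_lists_conv_set)

lemma inverse_word_cancels: "w \<in> letters S \<Longrightarrow> equivclp (cancels S) (inverse_word w @ w) []"
proof (induction w)
  case (Cons l w)
  obtain x b where l: "l = (x, b)" "x \<in> S" using Cons.prems by auto
  have "cancels S (inverse_word w @ [(x, \<not> b), (x, \<not> \<not> b)] @ w) (inverse_word w @ w)"
    by (rule cancels.intros[OF l(2)])
  then have "equivclp (cancels S) (inverse_word (l # w) @ l # w) (inverse_word w @ w)"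
    using l by (auto simp: inverse_word_def intro: r_into_equivclp)
  moreover have "equivclp (cancels S) (inverse_word w @ w) []" using Cons by simp
  ultimately show ?case by (rule equivclp_trans)
qed (simp add: inverse_word_def)

lemma group_free_group: "group (free_group S)"
proof (rule groupI)
  show "\<one>\<^bsub>free_group S\<^esub> \<in> carrier (free_group S)"
    unfolding one_free_group carrier_free_group by auto
  fix A B assume "A \<in> carrier (free_group S)" "B \<in> carrier (free_group S)"
  then obtain u v where uv: "A = word_class S u" "u \<in> letters S" "B = word_class S v" "v \<in> letters S"
    unfolding carrier_free_group by auto
  then show "A \<otimes>\<^bsub>free_group S\<^esub> B \<in> carrier (free_group S)"
    unfolding carrier_free_group by (simp add: mult_free_group)
  fix C assume "C \<in> carrier (free_group S)"
  then obtain w where "C = word_class S w" "w \<in> letters S" unfolding carrier_free_group by auto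
  then show "A \<otimes>\<^bsub>free_group S\<^esub> B \<otimes>\<^bsub>free_group S\<^esub> C = A \<otimes>\<^bsub>free_group S\<^esub> (B \<otimes>\<^bsub>free_group S\<^esub> C)"
    using uv by (simp add: mult_free_group)
next
  fix A assume "A \<in> carrier (free_group S)"
  then obtain u where u: "A = word_class S u" "u \<in> letters S" unfolding carrier_free_group by auto
  then show "\<one>\<^bsub>free_group S\<^esub> \<otimes>\<^bsub>free_group S\<^esub> A = A" by (simp add: one_free_group mult_free_group)
  have "word_class S (inverse_word u) \<otimes>\<^bsub>free_group S\<^esub> A = \<one>\<^bsub>free_group S\<^esub>"
    using u inverse_word_letters[OF u(2)] inverse_word_cancels[OF u(2)]
    by (simp add: one_free_group mult_free_group word_class_eq_iff)
  then show "\<exists>B\<in>carrier (free_group S). B \<otimes>\<^bsub>free_group S\<^esub> A = \<one>\<^bsub>free_group S\<^esub>"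
    using inverse_word_letters[OF u(2)] unfolding carrier_free_group by blast
qed

lemma (in monoid) letter_product_closed:
  "(\<And>l. l \<in> set w \<Longrightarrow> f l \<in> carrier G) \<Longrightarrow> letter_product G f w \<in> carrier G"
  by (induction w) auto

lemma (in monoid) letter_product_append:
  assumes "\<And>l. l \<in> set (u @ v) \<Longrightarrow> f l \<in> carrier G"
  shows "letter_product G f (u @ v) = letter_product G f u \<otimes> letter_product G f v"
  using assms
proof (induction u)
  case Nil
  then show ?case using letter_product_closed[of v f] by simp
next
  case (Cons l u)
  have "f l \<in> carrier G" "letter_product G f u \<in> carrier G" "letter_product G f v \<in> carrier G"
    using Cons.prems by (auto intro!: letter_product_closed)
  then show ?case using Cons by (simp add: m_assoc)
qed

text \<open>The evaluation of letters in a group; the second component is the sign of the exponent.\<close>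

definition (in group) signed :: "('x \<Rightarrow> 'a) \<Rightarrow> 'x \<times> bool \<Rightarrow> 'a"
  where "signed x l = (if snd l then x (fst l) else inv (x (fst l)))"

definition (in group) free_hom :: "('x \<Rightarrow> 'a) \<Rightarrow> ('x \<times> bool) list set \<Rightarrow> 'a"
  where "free_hom x A = letter_product G (signed x) (SOME u. u \<in> A)"

context group
begin

lemma signed_closed: "x \<in> S \<rightarrow> carrier G \<Longrightarrow> l \<in> S \<times> UNIV \<Longrightarrow> signed x l \<in> carrier G"
  by (auto simp: signed_def Pi_def)

text \<open>One of the two words is required to be over \<open>S\<close> because the equivalence generated by
  cancellation is followed in both directions.\<close>

lemma letter_product_cancels:
  assumes x: "x \<in> S \<rightarrow> carrier G" and "cancels S u v" and "u \<in> letters S \<or> v \<in> letters S"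
  shows "u \<in> letters S \<and> v \<in> letters S \<and> letter_product G (signed x) u = letter_product G (signed x) v"
  using assms(2,3)
proof (induction rule: cancels.induct)
  case (1 y u b v)
  have l: "u \<in> letters S" "v \<in> letters S" using 1 by auto
  have sg: "signed x l \<in> carrier G" if "l \<in> set u \<union> set v \<union> {(y, b), (y, \<not> b)}" for l
    using that l 1(1) by (intro signed_closed[OF x]) auto
  have car: "letter_product G (signed x) u \<in> carrier G" "letter_product G (signed x) v \<in> carrier G"
    using sg by (auto intro!: letter_product_closed)
  have "x y \<in> carrier G" using x 1(1) by auto
  then have "signed x (y, b) \<otimes> (signed x (y, \<not> b) \<otimes> letter_product G (signed x) v)
      = letter_product G (signed x) v"
    using car by (cases b) (auto simp: signed_def m_assoc[symmetric])
  moreover have "letter_product G (signed x) (u @ [(y, b), (y, \<not> b)] @ v)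
      = letter_product G (signed x) u \<otimes> letter_product G (signed x) ([(y, b), (y, \<not> b)] @ v)"
    by (rule letter_product_append) (use sg in auto)
  moreover have "letter_product G (signed x) (u @ v)
      = letter_product G (signed x) u \<otimes> letter_product G (signed x) v"
    by (rule letter_product_append) (use sg in auto)
  ultimately show ?case using l 1(1) by simp
qed

lemma letter_product_equivclp:
  assumes x: "x \<in> S \<rightarrow> carrier G" and "equivclp (cancels S) u v" and "u \<in> letters S"
  shows "v \<in> letters S \<and> letter_product G (signed x) u = letter_product G (signed x) v"
  using assms(2)
proof (induction rule: equivclp_induct)
  case base then show ?case using assms(3) by simp
next
  case (step v w)
  then show ?case
    using letter_product_cancels[OF x, of v w] letter_product_cancels[OF x, of w v] by auto
qed

lemma free_hom_word_class:
  assumes x: "x \<in> S \<rightarrow> carrier G" and u: "u \<in> letters S"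
  shows "free_hom x (word_class S u) = letter_product G (signed x) u"
proof -
  let ?v = "SOME v. v \<in> word_class S u"
  have "?v \<in> word_class S u" using in_word_class[OF u] by (rule someI)
  then have "?v \<in> letters S" "word_class S ?v = word_class S u" using word_classD by blast+
  then have "equivclp (cancels S) u ?v"
    using word_class_eq_iff[OF u] by metis
  then show ?thesis using letter_product_equivclp[OF x _ u] unfolding free_hom_def by metis
qed

lemma free_hom_hom:
  assumes x: "x \<in> S \<rightarrow> carrier G"
  shows "free_hom x \<in> hom (free_group S) G"
proof (rule homI)
  have sg: "signed x l \<in> carrier G" if "u \<in> letters S" "l \<in> set u" for u l
    using that by (intro signed_closed[OF x]) auto
  fix A assume "A \<in> carrier (free_group S)"
  then obtain u where u: "A = word_class S u" "u \<in> letters S" unfolding carrier_free_group by auto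
  then show "free_hom x A \<in> carrier G"
    using sg by (auto simp: free_hom_word_class[OF x] intro!: letter_product_closed)
  fix B assume "B \<in> carrier (free_group S)"
  then obtain v where v: "B = word_class S v" "v \<in> letters S" unfolding carrier_free_group by auto
  have "letter_product G (signed x) (u @ v) = letter_product G (signed x) u \<otimes> letter_product G (signed x) v"
    by (rule letter_product_append) (use sg u v in auto)
  then show "free_hom x (A \<otimes>\<^bsub>free_group S\<^esub> B) = free_hom x A \<otimes> free_hom x B"
    using u v by (simp add: mult_free_group free_hom_word_class[OF x])
qed

end

section \<open>Words in minimal generators\<close>

context finite_group_algebra
begin

text \<open>This is the group algebra of \<open>H\<close> inside that of \<open>Q\<close>.\<close>

definition supported :: "'q set \<Rightarrow> ('q \<Rightarrow> int) set"
  where "supported H = {f \<in> carrier A. \<forall>x\<in>carrier Q - H. f x = 0}"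

context
  fixes H assumes H: "subgroup H Q"
begin

lemma supported_add: "f \<in> supported H \<Longrightarrow> h \<in> supported H \<Longrightarrow> f \<oplus>\<^bsub>A\<^esub> h \<in> supported H"
  using add_closed_A by (auto simp: supported_def A_add)

lemma supported_mult: "f \<in> supported H \<Longrightarrow> h \<in> supported H \<Longrightarrow> f \<otimes>\<^bsub>A\<^esub> h \<in> supported H"
proof -
  assume f: "f \<in> supported H" and h: "h \<in> supported H"
  have "(f \<otimes>\<^bsub>A\<^esub> h) x = 0" if x: "x \<in> carrier Q - H" for x
  proof -
    have "f y * h (inv\<^bsub>Q\<^esub> y \<otimes>\<^bsub>Q\<^esub> x) = 0" if y: "y \<in> carrier Q" for y
    proof (cases "y \<in> H")
      case True
      have "inv\<^bsub>Q\<^esub> y \<otimes>\<^bsub>Q\<^esub> x \<notin> H"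
      proof
        assume "inv\<^bsub>Q\<^esub> y \<otimes>\<^bsub>Q\<^esub> x \<in> H"
        then have "y \<otimes>\<^bsub>Q\<^esub> (inv\<^bsub>Q\<^esub> y \<otimes>\<^bsub>Q\<^esub> x) \<in> H" using True subgroup.m_closed[OF H] by blast
        then show False using x y by (simp add: Q.m_assoc[symmetric])
      qed
      then show ?thesis using h x y by (simp add: supported_def)
    qed (use f y in \<open>simp add: supported_def\<close>)
    then have "(\<Sum>y\<in>carrier Q. f y * h (inv\<^bsub>Q\<^esub> y \<otimes>\<^bsub>Q\<^esub> x)) = 0" by (rule sum.neutral[OF ballI])
    then show ?thesis using x by (simp add: A_mult)
  qed
  then show ?thesis using mult_closed_A by (auto simp: supported_def)
qed

lemma supported_delta: "g \<in> H \<Longrightarrow> delta Q g \<in> supported H"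
  using subgroup.subset[OF H] delta_closed[of g] by (auto simp: supported_def delta_def)

lemma supported_zmul: "f \<in> supported H \<Longrightarrow> zmul A m f \<in> supported H"
  using A_zmul[of f m] A.int_smult_closed[of f m] by (auto simp: supported_def)

lemma supported_zero: "\<zero>\<^bsub>A\<^esub> \<in> supported H"
  using A.zero_closed by (auto simp: supported_def A_zero)

lemma supported_word_sum_below:
  assumes x: "\<And>i. i < k \<Longrightarrow> x i \<in> supported H"
  shows "word_sum_below A k x n c \<in> supported H"
proof -
  have ws: "word_sum A k x n c \<in> supported H" for n c
  proof (induction n arbitrary: c)
    case 0
    then show ?case
      using supported_zmul[OF supported_delta[OF subgroup.one_closed[OF H]]] by (simp add: A_one)
  next
    case (Suc n)
    have "finsum A f B \<in> supported H" if "finite B" "\<And>i. i \<in> B \<Longrightarrow> f i \<in> supported H" for f and B :: "nat set"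
      using that
    proof (induction B rule: finite_induct)
      case empty then show ?case using supported_zero by simp
    next
      case (insert i B)
      have "f \<in> B \<rightarrow> carrier A" "f i \<in> carrier A" using insert.prems by (auto simp: supported_def)
      then show ?case using insert supported_add by simp
    qed
    from this[of "{..<k}" "\<lambda>i. x i \<otimes>\<^bsub>A\<^esub> word_sum A k x n (\<lambda>v. c (i # v))"] show ?case
      using x Suc supported_mult by simp
  qed
  show ?thesis by (induction n) (use ws supported_zero supported_add in auto)
qed

end

end

locale minimal_generators = generated_pro_p +
  fixes d :: nat and x :: "nat \<Rightarrow> 'a"
  assumes x_closed: "\<And>i. i < d \<Longrightarrow> x i \<in> carrier G"
    and x_gen: "\<And>y. y \<in> CI \<Longrightarrow> \<exists>c. \<exists>r\<in>ideal_power CA CI 2.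
      y = word_sum CA d (\<lambda>i. group_element (x i) \<ominus>\<^bsub>CA\<^esub> \<one>\<^bsub>CA\<^esub>) (Suc 0) c \<oplus>\<^bsub>CA\<^esub> r"
    and graded_dims: "\<And>n. graded_dim p G T n = d ^ n"
begin

abbreviation x_diff where "x_diff i \<equiv> group_element (x i) \<ominus>\<^bsub>CA\<^esub> \<one>\<^bsub>CA\<^esub>"

abbreviation F where "F \<equiv> free_group {..<d}"

lemma group_F: "group F"
  by (rule group_free_group)

lemma x_Pi: "x \<in> {..<d} \<rightarrow> carrier G"
  using x_closed by auto

lemma x_diff_closed: "i < d \<Longrightarrow> x_diff i \<in> carrier CA"
  by (auto simp: group_element_closed x_closed)

lemma x_diff_CI: "i < d \<Longrightarrow> x_diff i \<in> CI"
  by (rule group_element_minus_one_in_CI[OF x_closed])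

sublocale FX: ring_family CA d x_diff
  by unfold_locales (rule x_diff_closed)

lemma free_hom_closed: "C \<in> carrier F \<Longrightarrow> free_hom x C \<in> carrier G"
  using free_hom_hom[OF x_Pi] by (auto simp: hom_def)

lemma free_hom_mult:
  "C \<in> carrier F \<Longrightarrow> D \<in> carrier F \<Longrightarrow> free_hom x (C \<otimes>\<^bsub>F\<^esub> D) = free_hom x C \<otimes> free_hom x D"
  using free_hom_hom[OF x_Pi] by (auto simp: hom_def)

text \<open>Modulo an open normal subgroup, every group element is an integral combination of monomials,
  hence of elements of the subgroup generated by the \<^term>\<open>x i\<close>; comparing supports, it lies in
  that subgroup.\<close>

lemma free_hom_dense:
  assumes U: "U \<in> ons" and g: "g \<in> carrier G"
  shows "\<exists>C\<in>carrier F. U #> free_hom x C = U #> g"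
proof -
  obtain e where e: "p_group_algebra (G Mod U) p e" using quotient_p_group_algebra[OF U] by blast
  interpret U: p_group_algebra "G Mod U" p e by (rule e)
  interpret h: ring_hom_ring CA "QA U" "\<lambda>y. y U" by (rule component_ring_hom_ring[OF U])
  obtain m where m: "\<And>f. f \<in> ideal_power (QA U) (QI U) m \<Longrightarrow> f = \<zero>\<^bsub>QA U\<^esub>"
    using U.aug_ideal_nilpotent by blast
  let ?H = "(\<lambda>C. U #> free_hom x C) ` carrier F"
  have "(\<lambda>C. U #> free_hom x C) \<in> hom F (G Mod U)"
    by (rule homI)
      (use quotient_mult[OF U] free_hom_closed free_hom_mult coset_in_quotient in \<open>simp_all del: mult_FactGroup\<close>)
  then interpret q: group_hom F "G Mod U" "\<lambda>C. U #> free_hom x C"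
    by (intro group_hom.intro group_hom_axioms.intro group_F U.Q.is_group)
  have H: "subgroup ?H (G Mod U)" by (rule q.img_is_subgroup)
  obtain c r where r: "r \<in> ideal_power CA CI m" "group_element g = FX.wsb m c \<oplus>\<^bsub>CA\<^esub> r"
    using FX.ring_expansion[OF CI_ideal x_diff_CI CA_eq_scalar_plus_CI x_gen group_element_closed[OF g]]
    by blast
  have rc: "r \<in> carrier CA" by (rule CA.ideal_power_closed[OF CI_ideal r(1)])
  have rU: "r U = \<zero>\<^bsub>QA U\<^esub>" by (rule m[OF CI_power_component[OF r(1) U]])
  have "delta (G Mod U) (U #> g) = group_element g U" using U by (simp add: group_element_component)
  also have "\<dots> = FX.wsb m c U \<oplus>\<^bsub>QA U\<^esub> r U"
    unfolding r(2) by (rule h.hom_add[OF FX.word_sum_below_closed rc])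
  also have "\<dots> = FX.wsb m c U"
    unfolding rU by (rule U.A.r_zero[OF h.hom_closed[OF FX.word_sum_below_closed]])
  also have "\<dots> = word_sum_below (QA U) d (\<lambda>i. x_diff i U) m c"
    by (rule h.hom_word_sum_below[OF x_diff_closed])
  also have "\<dots> \<in> U.supported ?H"
  proof (rule U.supported_word_sum_below[OF H])
    fix i assume i: "i < d"
    have "[(i, True)] \<in> letters {..<d}" using i by simp
    then have "word_class {..<d} [(i, True)] \<in> carrier F"
      "free_hom x (word_class {..<d} [(i, True)]) = x i"
      using free_hom_word_class[OF x_Pi, of "[(i, True)]"] x_closed[OF i]
      by (auto simp: carrier_free_group signed_def)
    then have xi: "U #> x i \<in> ?H" by (intro image_eqI) auto
    have one: "\<one>\<^bsub>G Mod U\<^esub> \<in> ?H" using subgroup.one_closed[OF H] .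
    have "x_diff i U = delta (G Mod U) (U #> x i) \<ominus>\<^bsub>QA U\<^esub> \<one>\<^bsub>QA U\<^esub>"
      by (rule group_element_minus_one_component[OF x_closed[OF i] U])
    also have "\<dots> = delta (G Mod U) (U #> x i) \<oplus>\<^bsub>QA U\<^esub> zmul (QA U) (- 1) \<one>\<^bsub>QA U\<^esub>"
      by (simp only: U.A.minus_eq U.A.int_smult_minus[OF U.A.one_closed] U.A.int_smult_one[OF U.A.one_closed])
    also have "\<dots> \<in> U.supported ?H"
      unfolding U.A_one
      by (intro U.supported_add[OF H] U.supported_zmul[OF H] U.supported_delta[OF H] xi one)
    finally show "x_diff i U \<in> U.supported ?H" .
  qed
  finally have sup: "delta (G Mod U) (U #> g) \<in> U.supported ?H" .
  have "U #> g \<in> ?H"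
  proof (rule ccontr)
    assume "U #> g \<notin> ?H"
    then have "delta (G Mod U) (U #> g) (U #> g) = 0"
      using sup coset_in_quotient[OF g] by (simp add: U.supported_def)
    then show False using coset_in_quotient[OF g] by (simp add: delta_def)
  qed
  then show ?thesis by auto
qed

lemma dvd_coeffs:
  "FX.ws n c \<in> ideal_power CA CI (Suc n) \<Longrightarrow> length v = n \<Longrightarrow> set v \<subseteq> {..<d} \<Longrightarrow> int p dvd c v"
  using dvd_coeffs_if_dimension_eq[OF x_diff_CI x_gen] graded_dimension[of n]
  unfolding graded_dims by blast

lemma dvd_coeffs_below:
  "FX.wsb m c \<in> ideal_power CA CI m \<Longrightarrow> length v < m \<Longrightarrow> set v \<subseteq> {..<d} \<Longrightarrow> int p dvd c v"
  using FX.dvd_coeffs_if_word_sum_below_in_power[OF CI_ideal x_diff_CI CA_char, of m c v]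
    dvd_coeffs by blast

text \<open>If the value of a word is congruent to 1 modulo a high power of the augmentation ideal, then its
  Magnus coefficients of low positive degree are divisible by \<open>p\<close>, so its value in \<open>F / N\<close>, which
  they determine when that power vanishes in the group algebra of \<open>F / N\<close>, is trivial.\<close>

lemma p_power_index_contains_preimage:
  assumes N: "N \<in> p_power_index_normal_subgroups p F"
  shows "\<exists>U\<in>ons. \<forall>C\<in>carrier F. free_hom x C \<in> U \<longrightarrow> C \<in> N"
proof -
  interpret F: group F by (rule group_F)
  obtain e where e: "card (rcosets\<^bsub>F\<^esub> N) = p ^ e" and normal: "N \<lhd> F"
    using N by (auto simp: p_power_index_normal_subgroups_def)
  interpret N: normal N F by (rule normal)
  have "finite (carrier (F Mod N))"
    using e prime_gt_0_nat[OF prime_p] by (intro card_ge_0_finite) (simp add: FactGroup_def)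
  then have "p_group_algebra (F Mod N) p e"
    by (intro p_group_algebra.intro finite_group_algebra.intro finite_group_algebra_axioms.intro
        p_group_algebra_axioms.intro N.factorgroup_is_group prime_p)
      (use e in \<open>simp_all add: FactGroup_def\<close>)
  then interpret Q: p_group_algebra "F Mod N" p e .
  obtain m where nil: "\<And>f. f \<in> ideal_power Q.A (aug_ideal p (F Mod N)) m \<Longrightarrow> f = \<zero>\<^bsub>Q.A\<^esub>"
    using Q.aug_ideal_nilpotent by blast
  obtain U where U: "U \<in> ons"
    "\<And>g. g \<in> U \<Longrightarrow> group_element g \<ominus>\<^bsub>CA\<^esub> \<one>\<^bsub>CA\<^esub> \<in> ideal_power CA CI (Suc m)"
    using dimension_subgroup_open by blast
  have in_quotient: "N #>\<^bsub>F\<^esub> C \<in> carrier (F Mod N)" if "C \<in> carrier F" for C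
    using that by (auto simp: carrier_FactGroup)
  let ?\<delta> = "\<lambda>C. delta (F Mod N) (N #>\<^bsub>F\<^esub> C)"
  have \<delta>_closed: "?\<delta> C \<in> carrier Q.A" if "C \<in> carrier F" for C
    by (rule Q.delta_closed[OF in_quotient[OF that]])
  have \<delta>_mult: "?\<delta> C \<otimes>\<^bsub>Q.A\<^esub> ?\<delta> D = ?\<delta> (C \<otimes>\<^bsub>F\<^esub> D)" if "C \<in> carrier F" "D \<in> carrier F" for C D
    using Q.delta_mult[OF in_quotient[OF that(1)] in_quotient[OF that(2)]] N.rcos_sum[OF that] by simp
  have \<delta>_one: "?\<delta> \<one>\<^bsub>F\<^esub> = \<one>\<^bsub>Q.A\<^esub>"
    unfolding Q.A_one using F.coset_mult_one[OF N.subset] by simp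
  have letter: "word_class {..<d} [(i, b)] \<in> carrier F" if "i < d" for i b
    using that by (auto simp: carrier_free_group)
  have letter_inv: "word_class {..<d} [(i, False)] \<otimes>\<^bsub>F\<^esub> word_class {..<d} [(i, True)] = \<one>\<^bsub>F\<^esub>"
    if "i < d" for i
    using inverse_word_cancels[of "[(i, True)]" "{..<d}"] that
    by (simp add: mult_free_group one_free_group word_class_eq_iff inverse_word_def)
  let ?y = "\<lambda>i. ?\<delta> (word_class {..<d} [(i, True)]) \<ominus>\<^bsub>Q.A\<^esub> \<one>\<^bsub>Q.A\<^esub>"
  have y_closed: "?y i \<in> carrier Q.A" if "i < d" for i using \<delta>_closed[OF letter[OF that]] by simp
  have y_aug: "?y i \<in> aug_ideal p (F Mod N)" if "i < d" for i
    by (rule Q.delta_minus_one_in_aug_ideal[OF in_quotient[OF letter[OF that]]])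
  interpret FY: ring_family Q.A d ?y by unfold_locales (rule y_closed)
  have C_in_N: "C \<in> N" if C: "C \<in> carrier F" and CU: "free_hom x C \<in> U" for C
  proof -
    obtain w where w: "C = word_class {..<d} w" "w \<in> letters {..<d}"
      using C unfolding carrier_free_group by auto
    let ?c = "magnus_coeff w"
    have sg: "signed x l \<in> carrier G" if "l \<in> {..<d} \<times> UNIV" for l by (rule signed_closed[OF x_Pi that])
    have prod_G: "letter_product CA (\<lambda>l. group_element (signed x l)) u = group_element (letter_product G (signed x) u)
        \<and> letter_product G (signed x) u \<in> carrier G"
      if "u \<in> letters {..<d}" for u
      using that
    proof (induction u)
      case Nil then show ?case by (simp add: group_element_one)
    next
      case (Cons l u)
      then show ?case using sg[of l] by (simp add: group_element_mult)
    qed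
    have "\<exists>r\<in>ideal_power CA CI (Suc m). letter_product CA (\<lambda>l. group_element (signed x l)) w
        = FX.wsb (Suc m) ?c \<oplus>\<^bsub>CA\<^esub> r"
    proof (rule FX.magnus_expansion[OF CA.ideal_power_ideal[OF CI_ideal] _ _ _ _ w(2)])
      fix i assume i: "i < d"
      show "x_diff i \<otimes>\<^bsub>CA\<^esub> FX.ws m c \<in> ideal_power CA CI (Suc m)" for c
        using CA.ideal_power_mult[OF CI_ideal, of "x_diff i" "Suc 0" "FX.ws m c" m]
          x_diff_CI[OF i] FX.word_sum_in_ideal_power[OF CI_ideal x_diff_CI]
        by (simp add: CA.ideal_power_one[OF CI_ideal])
      show "group_element (signed x (i, b)) \<in> carrier CA" for b
        by (rule group_element_closed[OF sg]) (use i in simp)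
      show "group_element (signed x (i, True)) = \<one>\<^bsub>CA\<^esub> \<oplus>\<^bsub>CA\<^esub> x_diff i"
        using CA.add_diff_cancel[OF group_element_closed[OF x_closed[OF i]] CA.one_closed]
        by (simp add: signed_def)
      show "group_element (signed x (i, False)) \<otimes>\<^bsub>CA\<^esub> group_element (signed x (i, True)) = \<one>\<^bsub>CA\<^esub>"
        using x_closed[OF i] by (simp add: signed_def group_element_mult group_element_one)
    qed
    then obtain r where r: "r \<in> ideal_power CA CI (Suc m)"
      "group_element (free_hom x C) = FX.wsb (Suc m) ?c \<oplus>\<^bsub>CA\<^esub> r"
      using prod_G[OF w(2)] free_hom_word_class[OF x_Pi w(2)] w(1) by auto
    \<comment> \<open>Subtracting 1 from the group element changes the expansion only at the empty word.\<close>
    let ?e = "\<lambda>v. ?c v - (if v = [] then 1 else 0)"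
    have split: "word_sum_below R d z (Suc m) ?c = word_sum_below R d z (Suc m) ?e \<oplus>\<^bsub>R\<^esub> \<one>\<^bsub>R\<^esub>"
      if "ring_family R d z" for R :: "('z, 'y) ring_scheme" and z
    proof -
      interpret R: ring_family R d z by (rule that)
      have "R.wsb (Suc m) (\<lambda>v. ?e v + (if v = [] then 1 else 0))
          = R.wsb (Suc m) ?e \<oplus>\<^bsub>R\<^esub> R.wsb (Suc m) (\<lambda>v. if v = [] then 1 else 0)"
        by (rule R.word_sum_below_add)
      then show ?thesis
        unfolding R.word_sum_below_unit R.int_smult_one[OF R.one_closed] by simp
    qed
    have rc: "r \<in> carrier CA" by (rule CA.ideal_power_closed[OF CI_ideal r(1)])
    have "group_element (free_hom x C) \<ominus>\<^bsub>CA\<^esub> \<one>\<^bsub>CA\<^esub> = FX.wsb (Suc m) ?e \<oplus>\<^bsub>CA\<^esub> r"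
    proof -
      let ?w = "FX.wsb (Suc m) ?e"
      have "?w \<oplus>\<^bsub>CA\<^esub> \<one>\<^bsub>CA\<^esub> \<oplus>\<^bsub>CA\<^esub> r \<ominus>\<^bsub>CA\<^esub> \<one>\<^bsub>CA\<^esub> = ?w \<oplus>\<^bsub>CA\<^esub> r"
        using FX.word_sum_below_closed[of "Suc m" ?e] rc
        by (simp add: CA.minus_eq CA.a_ac CA.r_neg1 CA.r_neg2 del: word_sum_below.simps)
      then show ?thesis
        unfolding r(2) split[OF FX.ring_family_axioms] .
    qed
    then have "FX.wsb (Suc m) ?e \<oplus>\<^bsub>CA\<^esub> r \<in> ideal_power CA CI (Suc m)" using U(2)[OF CU] by simp
    then have "FX.wsb (Suc m) ?e \<in> ideal_power CA CI (Suc m)"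
      by (rule CA.ideal_add_cancel[OF CA.ideal_power_ideal[OF CI_ideal] FX.word_sum_below_closed r(1)])
    then have dvd: "int p dvd ?e v" if "length v < Suc m" "set v \<subseteq> {..<d}" for v
      using dvd_coeffs_below that by blast
    \<comment> \<open>The divisibility obtained in the completed algebra of \<open>G\<close> is now used in the group algebra of
      \<open>F / N\<close>.\<close>
    have "FY.wsb (Suc m) ?e = \<zero>\<^bsub>Q.A\<^esub>"
      by (rule FY.word_sum_below_eq_zero_if_dvd[OF Q.A_char dvd])
    then have FY_c: "FY.wsb (Suc m) ?c = \<one>\<^bsub>Q.A\<^esub>" using split[OF FY.ring_family_axioms] by simp
    have prod_F: "letter_product Q.A (\<lambda>l. ?\<delta> (word_class {..<d} [l])) u = ?\<delta> (word_class {..<d} u)"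
      if "u \<in> letters {..<d}" for u
      using that
    proof (induction u)
      case Nil then show ?case using \<delta>_one by (simp add: one_free_group)
    next
      case (Cons l u)
      have "word_class {..<d} [l] \<in> carrier F" "word_class {..<d} u \<in> carrier F"
        using Cons.hyps by (auto simp: carrier_free_group)
      moreover have "word_class {..<d} [l] \<otimes>\<^bsub>F\<^esub> word_class {..<d} u = word_class {..<d} (l # u)"
        using Cons.hyps by (subst mult_free_group) auto
      ultimately show ?case using Cons.IH \<delta>_mult[of "word_class {..<d} [l]" "word_class {..<d} u"] by simp
    qed
    have "\<exists>r\<in>ideal_power Q.A (aug_ideal p (F Mod N)) m.
        letter_product Q.A (\<lambda>l. ?\<delta> (word_class {..<d} [l])) w = FY.wsb (Suc m) ?c \<oplus>\<^bsub>Q.A\<^esub> r"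
    proof (rule FY.magnus_expansion[OF Q.A.ideal_power_ideal[OF Q.aug_ideal_ideal] _ _ _ _ w(2)])
      fix i assume i: "i < d"
      show "?y i \<otimes>\<^bsub>Q.A\<^esub> FY.ws m c \<in> ideal_power Q.A (aug_ideal p (F Mod N)) m" for c
        by (rule ideal.I_l_closed[OF Q.A.ideal_power_ideal[OF Q.aug_ideal_ideal]
              FY.word_sum_in_ideal_power[OF Q.aug_ideal_ideal y_aug] y_closed[OF i]])
      show "?\<delta> (word_class {..<d} [(i, b)]) \<in> carrier Q.A" for b by (rule \<delta>_closed[OF letter[OF i]])
      show "?\<delta> (word_class {..<d} [(i, True)]) = \<one>\<^bsub>Q.A\<^esub> \<oplus>\<^bsub>Q.A\<^esub> ?y i"
        by (rule Q.A.add_diff_cancel[OF \<delta>_closed[OF letter[OF i]] Q.A.one_closed])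
      show "?\<delta> (word_class {..<d} [(i, False)]) \<otimes>\<^bsub>Q.A\<^esub> ?\<delta> (word_class {..<d} [(i, True)]) = \<one>\<^bsub>Q.A\<^esub>"
        by (simp only: \<delta>_mult[OF letter[OF i] letter[OF i]] letter_inv[OF i] \<delta>_one)
    qed
    then have "?\<delta> C = \<one>\<^bsub>Q.A\<^esub>"
    proof
      fix r assume "r \<in> ideal_power Q.A (aug_ideal p (F Mod N)) m"
        "letter_product Q.A (\<lambda>l. ?\<delta> (word_class {..<d} [l])) w = FY.wsb (Suc m) ?c \<oplus>\<^bsub>Q.A\<^esub> r"
      then show "?\<delta> C = \<one>\<^bsub>Q.A\<^esub>"
        unfolding FY_c prod_F[OF w(2)] w(1)[symmetric] using nil[of r] Q.A.r_zero[OF Q.A.one_closed]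
        by (simp only:)
    qed
    then have "delta (F Mod N) (N #>\<^bsub>F\<^esub> C) (N #>\<^bsub>F\<^esub> C) = delta (F Mod N) \<one>\<^bsub>F Mod N\<^esub> (N #>\<^bsub>F\<^esub> C)"
      unfolding Q.A_one by simp
    then have "N #>\<^bsub>F\<^esub> C = N"
      using in_quotient[OF C] by (auto simp: delta_def split: if_splits)
    then show "C \<in> N" using F.rcos_self[OF C N.is_subgroup] by simp
  qed
  then show ?thesis using U(1) by blast
qed

end

section \<open>Recognising a completion\<close>

context pro_p
begin

text \<open>An open subgroup has finite index by compactness, so its normal core is a finite intersection of
  open sets.\<close>

lemma exists_ons_subset:
  assumes U: "openin T U" "\<one> \<in> U"
  shows "\<exists>N\<in>ons. N \<subseteq> U"
proof -
  obtain H where H: "subgroup H G" "openin T H" "H \<subseteq> U"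
    using pro_p U by (auto simp: pro_p_group_def profinite_group_def)
  interpret H: subgroup H G by (rule H(1))
  let ?N = "{n \<in> carrier G. \<forall>g\<in>carrier G. g \<otimes> n \<otimes> inv g \<in> H}"
  have "?N \<lhd> G"
  proof (rule normal_invI)
    show "subgroup ?N G"
    proof (rule subgroupI)
      show "?N \<noteq> {}" by (auto intro!: exI[of _ \<one>])
    next
      fix a assume a: "a \<in> ?N"
      have "g \<otimes> inv a \<otimes> inv g \<in> H" if g: "g \<in> carrier G" for g
      proof -
        have "inv (g \<otimes> a \<otimes> inv g) \<in> H" using a g by auto
        then show ?thesis using a g by (simp add: inv_mult_group m_assoc)
      qed
      then show "inv a \<in> ?N" using a by auto
    next
      fix a b assume ab: "a \<in> ?N" "b \<in> ?N"
      have "g \<otimes> (a \<otimes> b) \<otimes> inv g \<in> H" if g: "g \<in> carrier G" for g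
      proof -
        have "(g \<otimes> a \<otimes> inv g) \<otimes> (g \<otimes> b \<otimes> inv g) \<in> H" using ab g by auto
        moreover have "(g \<otimes> a \<otimes> inv g) \<otimes> (g \<otimes> b \<otimes> inv g) = g \<otimes> a \<otimes> (inv g \<otimes> g) \<otimes> b \<otimes> inv g"
          using ab g by (simp only: m_assoc m_closed inv_closed mem_Collect_eq)
        ultimately show ?thesis using ab g by (simp add: m_assoc)
      qed
      then show "a \<otimes> b \<in> ?N" using ab by auto
    qed auto
    fix y h assume yh: "y \<in> carrier G" "h \<in> ?N"
    have "g \<otimes> (y \<otimes> h \<otimes> inv y) \<otimes> inv g \<in> H" if g: "g \<in> carrier G" for g
    proof -
      have "(g \<otimes> y) \<otimes> h \<otimes> inv (g \<otimes> y) \<in> H" using yh g by auto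
      then show ?thesis using yh g by (simp add: inv_mult_group m_assoc)
    qed
    then show "y \<otimes> h \<otimes> inv y \<in> ?N" using yh by auto
  qed
  moreover have "openin T ?N"
  proof -
    have "\<exists>\<F>. finite \<F> \<and> \<F> \<subseteq> (\<lambda>g. H #> g) ` carrier G \<and> topspace T \<subseteq> \<Union>\<F>"
      using compact unfolding compact_space_alt
    proof (rule allE[of _ "(\<lambda>g. H #> g) ` carrier G"], elim impE)
      show "(\<forall>V\<in>(\<lambda>g. H #> g) ` carrier G. openin T V) \<and> topspace T \<subseteq> \<Union> ((\<lambda>g. H #> g) ` carrier G)"
        using openin_coset[OF H(2)] rcos_self[OF _ H(1)] by auto
    qed
    then obtain \<F> where \<F>: "finite \<F>" "\<F> \<subseteq> (\<lambda>g. H #> g) ` carrier G" "carrier G \<subseteq> \<Union>\<F>" by auto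
    obtain R where R: "finite R" "R \<subseteq> carrier G" "\<F> = (\<lambda>g. H #> g) ` R"
      using finite_subset_image[OF \<F>(1,2)] by blast
    have "?N = carrier G \<inter> (\<Inter>r\<in>R. {n \<in> carrier G. r \<otimes> n \<otimes> inv r \<in> H})"
    proof (intro equalityI subsetI)
      fix n assume n: "n \<in> carrier G \<inter> (\<Inter>r\<in>R. {n \<in> carrier G. r \<otimes> n \<otimes> inv r \<in> H})"
      have "g \<otimes> n \<otimes> inv g \<in> H" if g: "g \<in> carrier G" for g
      proof -
        obtain r where r: "r \<in> R" "g \<in> H #> r" using g \<F>(3) R(3) by blast
        then obtain h where h: "h \<in> H" "g = h \<otimes> r" by (auto simp: r_coset_def)
        have car: "h \<in> carrier G" "r \<in> carrier G" "n \<in> carrier G" using h r R(2) n by auto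
        have "h \<otimes> (r \<otimes> n \<otimes> inv r) \<otimes> inv h \<in> H" using n r(1) h(1) by auto
        then show ?thesis using car h(2) by (simp add: inv_mult_group m_assoc)
      qed
      then show "n \<in> ?N" using n by auto
    qed (use R(2) in auto)
    moreover have "openin T {n \<in> topspace T. r \<otimes> n \<otimes> inv r \<in> H}" if r: "r \<in> carrier G" for r
    proof -
      have "continuous_map T T ((\<lambda>n. n \<otimes> inv r) \<circ> (\<lambda>n. r \<otimes> n))"
        using r by (intro continuous_map_compose[OF continuous_mult_left continuous_mult_right]) auto
      then have "continuous_map T T (\<lambda>n. r \<otimes> n \<otimes> inv r)" by (simp add: o_def)
      then show ?thesis using H(2) by (rule openin_continuous_map_preimage)
    qed
    moreover have "openin T (carrier G)" using openin_topspace[of T] by simp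
    ultimately show ?thesis
      using R(1,2) by (cases "R = {}") (auto intro!: openin_Int openin_INT2)
  qed
  moreover have "?N \<subseteq> U"
  proof
    fix n assume n: "n \<in> ?N"
    then have "\<one> \<otimes> n \<otimes> inv \<one> \<in> H" by blast
    then show "n \<in> U" using n H(3) by auto
  qed
  ultimately show ?thesis by (auto simp: open_normal_subgroups_def)
qed

lemma eq_one_if_in_all_ons:
  assumes "g \<in> carrier G" "\<And>N. N \<in> ons \<Longrightarrow> g \<in> N"
  shows "g = \<one>"
proof (rule ccontr)
  assume "g \<noteq> \<one>"
  then obtain U V where UV: "openin T U" "openin T V" "g \<in> U" "\<one> \<in> V" "disjnt U V"
    using Hausdorff assms(1) unfolding Hausdorff_space_def by (metis one_closed topspace_T)
  then obtain N where "N \<in> ons" "N \<subseteq> V" using exists_ons_subset by blast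
  then show False using assms(2) UV by (auto simp: disjnt_def)
qed

text \<open>The isomorphism sends \<open>g\<close> to the family of cosets of elements of \<open>F\<close> whose images approximate \<open>g\<close>.
  Cofinality makes the cosets independent of the approximation, and locally constant in \<open>g\<close>. It is
  injective because the preimages of open normal subgroups belong to the family, and surjective by
  compactness of \<open>G\<close>.\<close>

lemma topologically_isomorphic_quotient_limit:
  fixes F :: "('f, 'e) monoid_scheme"
  assumes F: "group F" and \<phi>: "\<phi> \<in> hom F G"
    and dense: "\<And>U g. U \<in> ons \<Longrightarrow> g \<in> carrier G \<Longrightarrow> \<exists>C\<in>carrier F. U #> \<phi> C = U #> g"
    and normal: "\<And>N. N \<in> \<P> \<Longrightarrow> N \<lhd> F"
    and cofinal: "\<And>N. N \<in> \<P> \<Longrightarrow> \<exists>U\<in>ons. \<forall>C\<in>carrier F. \<phi> C \<in> U \<longrightarrow> C \<in> N"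
    and preimage: "\<And>U. U \<in> ons \<Longrightarrow> {C \<in> carrier F. \<phi> C \<in> U} \<in> \<P>"
  shows "topologically_isomorphic G T (quotient_limit F \<P>) (quotient_limit_topology F \<P>)"
proof -
  interpret F: group F by (rule F)
  interpret \<phi>: group_hom F G \<phi> by (intro group_hom.intro group_hom_axioms.intro F \<phi> is_group)
  let ?good = "\<lambda>U N. U \<in> ons \<and> (\<forall>C\<in>carrier F. \<phi> C \<in> U \<longrightarrow> C \<in> N)"
  obtain lev where lev: "\<And>N. N \<in> \<P> \<Longrightarrow> ?good (lev N) N" using cofinal by metis
  define approx where "approx N g = (SOME C. C \<in> carrier F \<and> lev N #> \<phi> C = lev N #> g)" for N g
  have approx: "approx N g \<in> carrier F" "lev N #> \<phi> (approx N g) = lev N #> g"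
    if "N \<in> \<P>" "g \<in> carrier G" for N g
  proof -
    have "\<exists>C. C \<in> carrier F \<and> lev N #> \<phi> C = lev N #> g" using dense lev[OF that(1)] that(2) by blast
    then show "approx N g \<in> carrier F" "lev N #> \<phi> (approx N g) = lev N #> g"
      unfolding approx_def by (rule someI2_ex, blast)+
  qed
  define \<Phi> where "\<Phi> g = (\<lambda>N\<in>\<P>. N #>\<^bsub>F\<^esub> approx N g)" for g
  have coset_eq: "N #>\<^bsub>F\<^esub> C = N #>\<^bsub>F\<^esub> D"
    if N: "N \<in> \<P>" and U: "?good U N" and C: "C \<in> carrier F" and D: "D \<in> carrier F"
      and eq: "U #> \<phi> C = U #> \<phi> D" for N U C D
  proof -
    have U_sub: "subgroup U G" using U ons_subgroup by blast
    have N_sub: "subgroup N F" using normal_imp_subgroup[OF normal[OF N]] .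
    have "\<phi> C \<in> U #> \<phi> D" using rcos_self[OF \<phi>.hom_closed[OF C] U_sub] eq by simp
    then have "\<phi> C \<otimes> inv (\<phi> D) \<in> U"
      using subgroup.rcos_module_imp[OF U_sub is_group \<phi>.hom_closed[OF D]] by blast
    then have "\<phi> (C \<otimes>\<^bsub>F\<^esub> inv\<^bsub>F\<^esub> D) \<in> U" using C D by simp
    then have "C \<otimes>\<^bsub>F\<^esub> inv\<^bsub>F\<^esub> D \<in> N" using U C D by simp
    then have "C \<in> N #>\<^bsub>F\<^esub> D"
      using subgroup.rcos_module_rev[OF N_sub F D C] by blast
    then show ?thesis using F.repr_independence[OF _ D N_sub] by simp
  qed
  have \<Phi>_eq: "\<Phi> g N = N #>\<^bsub>F\<^esub> C"
    if N: "N \<in> \<P>" and U: "?good U N" and C: "C \<in> carrier F" and g: "g \<in> carrier G"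
      and eq: "U #> \<phi> C = U #> g" for N U C g
  proof -
    let ?V = "lev N"
    have V: "?good ?V N" by (rule lev[OF N])
    obtain D where D: "D \<in> carrier F" "(U \<inter> ?V) #> \<phi> D = (U \<inter> ?V) #> g"
      using dense[OF Int_ons g] U V by blast
    have D_coset: "W #> \<phi> D = W #> g" if W: "W \<in> ons" "U \<inter> ?V \<subseteq> W" for W
    proof -
      have "subgroup (U \<inter> ?V) G" using U V Int_ons ons_subgroup by blast
      then have "\<phi> D \<in> (U \<inter> ?V) #> g" using rcos_self[OF \<phi>.hom_closed[OF D(1)]] D(2) by metis
      then have "\<phi> D \<in> W #> g" using W(2) by (auto simp: r_coset_def)
      then show ?thesis using repr_independence[OF _ g ons_subgroup[OF W(1)]] by simp
    qed
    have "N #>\<^bsub>F\<^esub> C = N #>\<^bsub>F\<^esub> D"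
      by (rule coset_eq[OF N U C D(1)]) (use D_coset[of U] U eq in auto)
    also have "\<dots> = N #>\<^bsub>F\<^esub> approx N g"
      by (rule coset_eq[OF N V D(1) approx(1)[OF N g]]) (use D_coset[of ?V] V approx(2)[OF N g] in auto)
    finally show ?thesis using N by (simp add: \<Phi>_def)
  qed
  have good_mono: "?good U M" if "?good U N" "N \<subseteq> M" for U N M using that by blast
  have \<Phi>_component: "\<Phi> g N \<in> carrier (F Mod N)" if "N \<in> \<P>" "g \<in> carrier G" for g N
    using that approx(1)[OF that] by (auto simp: \<Phi>_def carrier_FactGroup)
  have limit_iff: "y \<in> carrier (quotient_limit F \<P>) \<longleftrightarrow> y \<in> (\<Pi>\<^sub>E N\<in>\<P>. carrier (F Mod N)) \<and>
      (\<forall>N\<in>\<P>. \<forall>M\<in>\<P>. N \<subseteq> M \<longrightarrow> y N <#>\<^bsub>F\<^esub> M = y M)" for y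
    by (auto simp: quotient_limit_def)
  have \<Phi>_closed: "\<Phi> g \<in> carrier (quotient_limit F \<P>)" if g: "g \<in> carrier G" for g
  proof -
    have "\<Phi> g N <#>\<^bsub>F\<^esub> M = \<Phi> g M" if NM: "N \<in> \<P>" "M \<in> \<P>" "N \<subseteq> M" for N M
    proof -
      have "\<Phi> g N = N #>\<^bsub>F\<^esub> approx N g" using NM by (simp add: \<Phi>_def)
      moreover have "\<Phi> g M = M #>\<^bsub>F\<^esub> approx N g"
        by (rule \<Phi>_eq[OF NM(2) good_mono[OF lev[OF NM(1)] NM(3)] approx(1)[OF NM(1) g] g approx(2)[OF NM(1) g]])
      ultimately show ?thesis
        using F.coset_mult_normal[OF normal[OF NM(1)] normal[OF NM(2)] NM(3) approx(1)[OF NM(1) g]] by simp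
    qed
    then show ?thesis unfolding limit_iff using \<Phi>_component[OF _ g] by (auto simp: \<Phi>_def)
  qed
  have \<Phi>_hom: "\<Phi> \<in> hom G (quotient_limit F \<P>)"
  proof (rule homI[OF \<Phi>_closed])
    fix g h assume g: "g \<in> carrier G" and h: "h \<in> carrier G"
    have "\<Phi> (g \<otimes> h) N = \<Phi> g N <#>\<^bsub>F\<^esub> \<Phi> h N" if N: "N \<in> \<P>" for N
    proof -
      let ?C = "approx N g" and ?D = "approx N h"
      have CD: "?C \<in> carrier F" "?D \<in> carrier F" using approx(1)[OF N] g h by auto
      have lev_normal: "lev N \<lhd> G" using lev[OF N] onsD(1) by blast
      have "lev N #> \<phi> (?C \<otimes>\<^bsub>F\<^esub> ?D) = (lev N #> \<phi> ?C) <#> (lev N #> \<phi> ?D)"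
        using normal.rcos_sum[OF lev_normal \<phi>.hom_closed[OF CD(1)] \<phi>.hom_closed[OF CD(2)]] CD by simp
      also have "\<dots> = lev N #> (g \<otimes> h)"
        using normal.rcos_sum[OF lev_normal g h] approx(2)[OF N g] approx(2)[OF N h] by simp
      finally have "\<Phi> (g \<otimes> h) N = N #>\<^bsub>F\<^esub> (?C \<otimes>\<^bsub>F\<^esub> ?D)"
        using g h CD by (intro \<Phi>_eq[OF N lev[OF N]]) auto
      also have "\<dots> = \<Phi> g N <#>\<^bsub>F\<^esub> \<Phi> h N"
        using normal.rcos_sum[OF normal[OF N] CD] N by (simp add: \<Phi>_def)
      finally show ?thesis .
    qed
    then show "\<Phi> (g \<otimes> h) = \<Phi> g \<otimes>\<^bsub>quotient_limit F \<P>\<^esub> \<Phi> h"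
      by (auto simp: quotient_limit_def product_group_def \<Phi>_def fun_eq_iff)
  qed
  have \<Phi>_inj: "inj_on \<Phi> (carrier G)"
  proof (rule inj_onI)
    fix g h assume gh: "g \<in> carrier G" "h \<in> carrier G" "\<Phi> g = \<Phi> h"
    have "g \<otimes> inv h \<in> U" if U: "U \<in> ons" for U
    proof -
      let ?N = "{C \<in> carrier F. \<phi> C \<in> U}"
      have N: "?N \<in> \<P>" by (rule preimage[OF U])
      have good: "?good U ?N" using U by simp
      obtain C D where CD: "C \<in> carrier F" "U #> \<phi> C = U #> g" "D \<in> carrier F" "U #> \<phi> D = U #> h"
        using dense[OF U gh(1)] dense[OF U gh(2)] by blast
      have "?N #>\<^bsub>F\<^esub> C = ?N #>\<^bsub>F\<^esub> D"
        using \<Phi>_eq[OF N good CD(1) gh(1) CD(2)] \<Phi>_eq[OF N good CD(3) gh(2) CD(4)] gh(3) by simp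
      then have "C \<in> ?N #>\<^bsub>F\<^esub> D"
        using F.rcos_self[OF CD(1) normal_imp_subgroup[OF normal[OF N]]] by simp
      then obtain n where n: "n \<in> ?N" "C = n \<otimes>\<^bsub>F\<^esub> D" by (auto simp: r_coset_def)
      have "\<phi> C \<in> U #> \<phi> D" using n CD(3) by (auto simp: r_coset_def)
      then have "U #> \<phi> D = U #> \<phi> C"
        using repr_independence[OF _ \<phi>.hom_closed[OF CD(3)] ons_subgroup[OF U]] by simp
      then have "g \<in> U #> h" using rcos_self[OF gh(1) ons_subgroup[OF U]] CD by simp
      then show ?thesis using subgroup.rcos_module_imp[OF ons_subgroup[OF U] is_group gh(2)] by blast
    qed
    then have "g \<otimes> inv h = \<one>" using gh by (intro eq_one_if_in_all_ons) auto
    then show "g = h" using gh inv_equality[of g "inv h"] by simp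
  qed
  have coordinate: "continuous_map T (discrete_topology (carrier (F Mod N))) (\<lambda>g. \<Phi> g N)"
    if N: "N \<in> \<P>" for N
  proof (subst continuous_map, intro conjI allI impI)
    show "(\<lambda>g. \<Phi> g N) ` topspace T \<subseteq> topspace (discrete_topology (carrier (F Mod N)))"
      using \<Phi>_component[OF N] by auto
    fix W
    show "openin T {g \<in> topspace T. \<Phi> g N \<in> W}"
    proof (subst openin_subopen, intro ballI)
      fix g assume g: "g \<in> {g \<in> topspace T. \<Phi> g N \<in> W}"
      have V: "?good (lev N) N" by (rule lev[OF N])
      have "lev N #> g \<subseteq> {g \<in> topspace T. \<Phi> g N \<in> W}"
      proof
        fix h assume h: "h \<in> lev N #> g"
        have hc: "h \<in> carrier G"
          using h g V r_coset_subset_G[OF subgroup.subset[OF ons_subgroup]] by auto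
        have "lev N #> g = lev N #> h" by (rule repr_independence[OF h]) (use g V ons_subgroup in auto)
        then have "\<Phi> h N = N #>\<^bsub>F\<^esub> approx N g"
          using approx[OF N, of g] g hc by (intro \<Phi>_eq[OF N V]) auto
        then have "\<Phi> h N = \<Phi> g N" using N by (simp add: \<Phi>_def)
        then show "h \<in> {g \<in> topspace T. \<Phi> g N \<in> W}" using hc g by simp
      qed
      moreover have "openin T (lev N #> g)" using openin_coset[of "lev N" g] V onsD(2) g by auto
      moreover have "g \<in> lev N #> g" using rcos_self[of g "lev N"] V ons_subgroup g by auto
      ultimately show "\<exists>A. openin T A \<and> g \<in> A \<and> A \<subseteq> {g \<in> topspace T. \<Phi> g N \<in> W}"
        by (intro exI[of _ "lev N #> g"] conjI)
    qed
  qed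
  let ?T = "product_topology (\<lambda>N. discrete_topology (carrier (F Mod N))) \<P>"
  have top_limit: "topspace (quotient_limit_topology F \<P>) = carrier (quotient_limit F \<P>)"
  proof -
    have "carrier (quotient_limit F \<P>) \<subseteq> topspace ?T"
      using limit_iff by (intro subsetI) simp
    then show ?thesis
      unfolding quotient_limit_topology_def topspace_subtopology by (rule Int_absorb1)
  qed
  have continuous: "continuous_map T (quotient_limit_topology F \<P>) \<Phi>"
    unfolding quotient_limit_topology_def continuous_map_in_subtopology continuous_map_componentwise
    using coordinate \<Phi>_closed by (auto simp: \<Phi>_def)
  have surj: "\<Phi> ` carrier G = carrier (quotient_limit F \<P>)"
  proof
    show "\<Phi> ` carrier G \<subseteq> carrier (quotient_limit F \<P>)" using \<Phi>_closed by auto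
    show "carrier (quotient_limit F \<P>) \<subseteq> \<Phi> ` carrier G"
    proof
      fix y assume y: "y \<in> carrier (quotient_limit F \<P>)"
      let ?K = "\<lambda>N. {g \<in> topspace T. \<Phi> g N \<in> {y N} \<inter> carrier (F Mod N)}"
      have closed: "closedin T (?K N)" if "N \<in> \<P>" for N
        by (rule closedin_continuous_map_preimage[OF coordinate[OF that]]) simp
      define \<U> where "\<U> = insert (topspace T) (?K ` \<P>)"
      have fip: "\<Inter> \<F> \<noteq> {}" if \<F>: "finite \<F>" "\<F> \<subseteq> \<U>" for \<F>
      proof -
        have "finite (\<F> - {topspace T})" "\<F> - {topspace T} \<subseteq> ?K ` \<P>"
          using \<F> unfolding \<U>_def by blast+
        from finite_subset_image[OF this] obtain Ns
          where Ns: "finite Ns" "Ns \<subseteq> \<P>" "\<F> - {topspace T} = ?K ` Ns"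
          by (elim exE conjE)
        obtain U where U: "U \<in> ons" "\<And>N. N \<in> Ns \<Longrightarrow> U \<subseteq> lev N"
        proof -
          have "finite (lev ` Ns)" "lev ` Ns \<subseteq> ons" using Ns(1,2) lev by blast+
          from finite_Inter_ons[OF this] obtain L where "L \<in> ons" "\<forall>N\<in>lev ` Ns. L \<subseteq> N"
            by (elim bexE)
          then show thesis by (intro that[of L]) (simp_all only: ball_simps)
        qed
        let ?M = "{C \<in> carrier F. \<phi> C \<in> U}"
        have M: "?M \<in> \<P>" by (rule preimage[OF U(1)])
        have "y ?M \<in> carrier (F Mod ?M)" using y M unfolding limit_iff by auto
        then obtain C where C: "C \<in> carrier F" "y ?M = ?M #>\<^bsub>F\<^esub> C" by (auto simp: carrier_FactGroup)
        have in_K: "\<phi> C \<in> ?K N" if N: "N \<in> Ns" for N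
        proof -
          have NP: "N \<in> \<P>" using N Ns(2) by auto
          have sub: "?M \<subseteq> N" using U(2)[OF N] lev[OF NP] by auto
          have "y N = (?M #>\<^bsub>F\<^esub> C) <#>\<^bsub>F\<^esub> N" using y M NP sub C(2) unfolding limit_iff by metis
          also have "\<dots> = N #>\<^bsub>F\<^esub> C" by (rule F.coset_mult_normal[OF normal[OF M] normal[OF NP] sub C(1)])
          also have "\<dots> = \<Phi> (\<phi> C) N"
            by (rule \<Phi>_eq[OF NP lev[OF NP] C(1) \<phi>.hom_closed[OF C(1)] refl, symmetric])
          finally show ?thesis using \<phi>.hom_closed[OF C(1)] \<Phi>_component[OF NP] by simp
        qed
        have "\<phi> C \<in> \<Inter> \<F>"
        proof (rule InterI)
          fix E assume E: "E \<in> \<F>"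
          show "\<phi> C \<in> E"
          proof (cases "E = topspace T")
            case True then show ?thesis using \<phi>.hom_closed[OF C(1)] by simp
          next
            case False
            then have "E \<in> ?K ` Ns" using E unfolding Ns(3)[symmetric] by blast
            then show ?thesis using in_K by (elim imageE) (simp only:)
          qed
        qed
        then show ?thesis by blast
      qed
      have "(\<forall>D\<in>\<U>. closedin T D) \<and> (\<forall>\<F>. finite \<F> \<and> \<F> \<subseteq> \<U> \<longrightarrow> \<Inter> \<F> \<noteq> {}) \<longrightarrow> \<Inter> \<U> \<noteq> {}"
        using compact unfolding compact_space_fip by (rule spec)
      then have "\<Inter> \<U> \<noteq> {}"
      proof (rule mp, intro conjI ballI allI impI)
        fix \<F> assume "finite \<F> \<and> \<F> \<subseteq> \<U>"
        then show "\<Inter> \<F> \<noteq> {}" using fip[of \<F>] by (elim conjE)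
      next
        fix D assume "D \<in> \<U>"
        then show "closedin T D" using closed closedin_topspace[of T] unfolding \<U>_def by auto
      qed
      then obtain g where g: "g \<in> \<Inter> \<U>" by blast
      then have gc: "g \<in> carrier G" "\<And>N. N \<in> \<P> \<Longrightarrow> \<Phi> g N = y N" unfolding \<U>_def by auto
      have "\<Phi> g = y"
      proof (rule extensionalityI)
        show "\<Phi> g \<in> extensional \<P>" unfolding \<Phi>_def by (rule restrict_extensional)
        show "y \<in> extensional \<P>" using y unfolding limit_iff by (simp add: PiE_iff)
      qed (rule gc(2))
      then show "y \<in> \<Phi> ` carrier G" using gc(1) by auto
    qed
  qed
  have "Hausdorff_space (quotient_limit_topology F \<P>)"
    unfolding quotient_limit_topology_def
    by (intro Hausdorff_space_subtopology) (simp add: Hausdorff_space_product_topology)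
  then have "homeomorphic_map T (quotient_limit_topology F \<P>) \<Phi>"
    by (intro continuous_imp_homeomorphic_map continuous compact)
      (simp_all add: top_limit surj \<Phi>_inj)
  moreover have "\<Phi> \<in> iso G (quotient_limit F \<P>)"
    using \<Phi>_hom \<Phi>_inj surj by (simp add: iso_def bij_betw_def)
  ultimately show ?thesis unfolding topologically_isomorphic_def by blast
qed

end

context minimal_generators
begin

text \<open>By density the quotient by the preimage of \<open>U\<close> is isomorphic to the quotient of \<open>G\<close> by \<open>U\<close>.\<close>

lemma preimage_p_power_index:
  assumes U: "U \<in> ons"
  shows "{C \<in> carrier F. free_hom x C \<in> U} \<in> p_power_index_normal_subgroups p F"
proof -
  interpret U: normal U G by (rule onsD(1)[OF U])
  let ?q = "\<lambda>C. U #> free_hom x C"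
  have "?q \<in> hom F (G Mod U)"
    by (rule homI)
      (use quotient_mult[OF U] free_hom_closed free_hom_mult coset_in_quotient in \<open>simp_all del: mult_FactGroup\<close>)
  then interpret q: group_hom F "G Mod U" ?q
    by (intro group_hom.intro group_hom_axioms.intro group_F U.factorgroup_is_group)
  have ker: "kernel F (G Mod U) ?q = {C \<in> carrier F. free_hom x C \<in> U}"
    using coset_join1[OF _ _ U.is_subgroup] coset_join2[OF _ U.is_subgroup] free_hom_closed U.subset
    unfolding kernel_def one_FactGroup by blast
  have onto: "?q ` carrier F = carrier (G Mod U)"
    using free_hom_dense[OF U] free_hom_closed by (fastforce simp: carrier_FactGroup image_iff)
  have "card (carrier (F Mod kernel F (G Mod U) ?q)) = card (carrier (G Mod U))"
    using q.FactGroup_iso_set[OF onto] unfolding iso_def by (auto intro: bij_betw_same_card)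
  moreover obtain e where "card (rcosets U) = p ^ e"
    using pro_p U by (auto simp: pro_p_group_def)
  ultimately have "card (rcosets\<^bsub>F\<^esub> (kernel F (G Mod U) ?q)) = p ^ e" by (simp add: FactGroup_def)
  then show ?thesis
    using q.normal_kernel unfolding ker p_power_index_normal_subgroups_def by blast
qed

theorem free_of_rank_d: "is_free_pro_p_of_rank p d G T"
  unfolding is_free_pro_p_of_rank_def free_pro_p_group_def free_pro_p_topology_def
proof (rule topologically_isomorphic_quotient_limit[OF group_F free_hom_hom[OF x_Pi]])
  show "\<exists>C\<in>carrier F. U #> free_hom x C = U #> g" if "U \<in> ons" "g \<in> carrier G" for U g
    by (rule free_hom_dense[OF that])
  show "N \<lhd> F" if "N \<in> p_power_index_normal_subgroups p F" for N
    using that by (simp add: p_power_index_normal_subgroups_def)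
qed (rule p_power_index_contains_preimage preimage_p_power_index; assumption)+

end

section \<open>The geometric Hilbert--Poincare series\<close>

lemma geometric_fps_coeffs:
  fixes a :: "nat \<Rightarrow> 'c :: field"
  assumes "Abs_fps a = 1 / (1 - fps_const c * fps_X)"
  shows "a n = c ^ n"
proof -
  have "fps_nth (1 - fps_const c * fps_X) 0 \<noteq> (0::'c)" by simp
  then have eq: "Abs_fps a * (1 - fps_const c * fps_X) = 1"
    using assms by (simp add: fps_divide_unit inverse_mult_eq_1)
  show ?thesis
  proof (induction n)
    case 0
    have "fps_nth (Abs_fps a * (1 - fps_const c * fps_X)) 0 = 1" unfolding eq by simp
    then show ?case by simp
  next
    case (Suc n)
    have "fps_nth (Abs_fps a - fps_const c * (Abs_fps a * fps_X)) (Suc n) = 0"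
      using arg_cong[OF eq, of "\<lambda>f. fps_nth f (Suc n)"] by (simp add: algebra_simps)
    then show ?case using Suc by (simp add: fps_mult_fps_X_commute[symmetric])
  qed
qed

theorem mainTheorem3:
  fixes p d :: nat
    and G :: "('a, 'b) monoid_scheme"
    and T :: "'a topology"
  assumes "Factorial_Ring.prime p"
    and "pro_p_group p G T"
    and "topologically_finitely_generated G T"
    and "hilbert_poincare_series p G T = 1 / (1 - fps_const (of_nat d) * fps_X)"
  shows "is_free_pro_p_of_rank p d G T"
proof -
  have "group G"
    using assms(2) by (auto simp: pro_p_group_def profinite_group_def topological_group_def)
  then interpret pro_p G p T by (intro pro_p.intro pro_p_axioms.intro assms(1,2))
  have "(of_nat (graded_dim p G T n) :: rat) = of_nat d ^ n" for n
    using geometric_fps_coeffs[OF assms(4)[unfolded hilbert_poincare_series_def]] .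
  then have dims: "graded_dim p G T n = d ^ n" for n
    by (metis of_nat_eq_iff of_nat_power)
  obtain S where S: "finite S" "S \<subseteq> carrier G" "T closure_of (generate G S) = carrier G"
    using assms(3) by (auto simp: topologically_finitely_generated_def)
  obtain k and s :: "nat \<Rightarrow> 'a" where s: "S = s ` {..<k}"
    using finite_imp_nat_seg_image_inj_on[OF S(1)] by (metis lessThan_def)
  interpret generated_pro_p G p T k s
    by unfold_locales (use S s in auto)
  obtain x where x: "\<And>i. i < d \<Longrightarrow> x i \<in> carrier G"
    "\<And>y. y \<in> CI \<Longrightarrow> \<exists>c. \<exists>r\<in>ideal_power CA CI 2.
      y = word_sum CA d (\<lambda>i. group_element (x i) \<ominus>\<^bsub>CA\<^esub> \<one>\<^bsub>CA\<^esub>) (Suc 0) c \<oplus>\<^bsub>CA\<^esub> r"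
    using exists_minimal_generators[of d] dims[of "Suc 0"] by auto
  interpret minimal_generators G p T k s d x
    by unfold_locales (use x dims in auto)
  show ?thesis by (rule free_of_rank_d)
qed

end
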